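(* (Spanne type result) Let $1<p<\infty$, $0<\alpha<\frac{Q}{p}$, $\frac1q=\frac1p-\frac{\alpha}{Q}$ and $b\in BMO(H_n)$. Let $T_{b,\alpha}$ be a sublinear operator which satisfies the size condition that, for any $f\in L_1(H_n)$ with compact support and any $g\notin\operatorname{supp} f$, $$|T_{b,\alpha}f(g)|\le c_0\int_{H_n}|b(g)-b(h)|\,\frac{|f(h)|}{|g^{-1}h|^{Q-\alpha}}\,dh,$$ where $c_0$ is independent of $f$ and $g$, and which is bounded from $L_p(H_n)$ to $L_q(H_n)$. Let also the pair $(\varphi_1,\varphi_2)$ of positive measurable functions on $H_n\times(0,\infty)$ satisfy the condition $$\int_r^\infty\Big(1+\ln\frac{\tau}{r}\Big)\,\frac{\operatorname*{ess\,inf}_{\tau<s<\infty}\varphi_1(g,s)\,s^{\frac{Q}{p}}}{\tau^{\frac Qq+1}}\,d\tau\le C\,\varphi_2(g,r),$$ where $C$ does not depend on $g\in H_n$ and $r>0$. Then the operator $T_{b,\alpha}$ is bounded from $M_{p,\varphi_1}(H_n)$ to $M_{q,\varphi_2}(H_n)$. Moreover, $$\|T_{b,\alpha}f\|_{M_{q,\varphi_2}}\lesssim\|b\|_*\,\|f\|_{M_{p,\varphi_1}}.$$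
   Context: The Heisenberg group $H_n$ is $\mathbb{R}^{2n}\times\mathbb{R}$ with group law $(x,t)\circ(x',t')=\big(x+x',\,t+t'+2\sum_{j=1}^n(x_{2j}x'_{2j-1}-x_{2j-1}x'_{2j})\big)$; $Q=2n+2$ is its homogeneous dimension; Haar measure is Lebesgue measure on $\mathbb{R}^{2n+1}$, and $|E|$ denotes the measure of a measurable set $E$. The homogeneous norm is $|(x,t)|=\big[(\sum_{j=1}^{2n}x_j^2)^2+t^2\big]^{1/4}$, and $B(g,r)=\{h\in H_n:|g^{-1}h|<r\}$. $BMO(H_n)$ is the set of $b\in L_1^{loc}(H_n)$ with $\|b\|_*=\sup_{g\in H_n,r>0}\frac1{|B(g,r)|}\int_{B(g,r)}|b(h)-b_{B(g,r)}|\,dh<\infty$, where $b_{B(g,r)}=\frac1{|B(g,r)|}\int_{B(g,r)}b(h)\,dh$. For $1\le p<\infty$ and a positive measurable function $\varphi$ on $H_n\times(0,\infty)$, the generalized Morrey space $M_{p,\varphi}=M_{p,\varphi}(H_n)$ is the set of $f\in L_p^{loc}(H_n)$ with $\|f\|_{M_{p,\varphi}}=\sup_{g\in H_n,r>0}\varphi(g,r)^{-1}|B(g,r)|^{-1/p}\|f\|_{L_p(B(g,r))}<\infty$. Sublinear means $|T_{b,\alpha}(f_1+f_2)|\le|T_{b,\alpha}f_1|+|T_{b,\alpha}f_2|$. $A\lesssim B$ means $A\le C'B$ with some positive constant $C'$ independent of appropriate quantities.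
   Formalization: Added assumption: for f in M_{p,φ1} not in L_p, Tf is measurable and |Tf| ≤ limsup_k |T(f·1_{B(0,k)})| a.e.; without it the hypotheses do not restrict T on such f and the claim is false. *)

theory Defs
  imports "HOL-Analysis.Analysis"
begin

section \<open>The Heisenberg group\<close>

text \<open>
  The group \<open>H_n\<close> with \<open>n = CARD('n)\<close>. The coordinates of \<open>g = (x, t)\<close> are
  \<open>x_{2j-1} = x $ j $ 1\<close> and \<open>x_{2j} = x $ j $ 2\<close>. As a euclidean space this type is
  \<open>\<real>^{2n+1}\<close>, so its topology and its measure \<^const>\<open>lebesgue\<close> (the Haar measure) are the usual ones.
\<close>

type_synonym 'n heis = "((real ^ 2) ^ 'n) \<times> real"

definition hmult :: "'n::finite heis \<Rightarrow> 'n heis \<Rightarrow> 'n heis" where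
  "hmult g h =
     (fst g + fst h,
      snd g + snd h + 2 * (\<Sum>j\<in>UNIV. fst g $ j $ 2 * fst h $ j $ 1 - fst g $ j $ 1 * fst h $ j $ 2))"

definition hinv :: "'n::finite heis \<Rightarrow> 'n heis" where
  "hinv g = (- fst g, - snd g)"

lemma hmult_group_laws:
  fixes g h k :: "'n::finite heis"
  shows "hmult (hmult g h) k = hmult g (hmult h k)"
    and "hmult 0 g = g" "hmult g 0 = g"
    and "hmult (hinv g) g = 0" "hmult g (hinv g) = 0"
  by (auto simp: hmult_def hinv_def prod_eq_iff algebra_simps sum.distrib sum_subtractf sum_negf)

definition hnorm :: "'n::finite heis \<Rightarrow> real" where
  "hnorm g = root 4 ((\<Sum>j\<in>UNIV. (fst g $ j $ 1)\<^sup>2 + (fst g $ j $ 2)\<^sup>2)\<^sup>2 + (snd g)\<^sup>2)"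

definition hdist :: "'n::finite heis \<Rightarrow> 'n heis \<Rightarrow> real" where
  "hdist g h = hnorm (hmult (hinv g) h)"

definition hball :: "'n::finite heis \<Rightarrow> real \<Rightarrow> 'n heis set" where
  "hball g r = {h. hdist g h < r}"

definition hdim :: "'n::finite itself \<Rightarrow> real" where
  "hdim _ = real (2 * CARD('n) + 2)"


section \<open>Lebesgue, BMO and Morrey spaces\<close>

text \<open>
  Elements of the spaces are functions, not equivalence classes. All functions are real valued and
  Lebesgue measurable.
\<close>

definition Lp_space :: "real \<Rightarrow> ('a::euclidean_space \<Rightarrow> real) set" where
  "Lp_space p = {f \<in> borel_measurable lebesgue. integrable lebesgue (\<lambda>x. \<bar>f x\<bar> powr p)}"

definition Lp_loc :: "real \<Rightarrow> ('a::euclidean_space \<Rightarrow> real) set" where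
  "Lp_loc p = {f \<in> borel_measurable lebesgue.
     \<forall>K. compact K \<longrightarrow> set_integrable lebesgue K (\<lambda>x. \<bar>f x\<bar> powr p)}"

text \<open>The Bochner integral is \<open>0\<close> on non-integrable functions, so this is the \<open>L_p(A)\<close> norm
  only for \<open>f\<close> that is \<open>p\<close>-integrable on \<open>A\<close>; it is used only for such \<open>f\<close>.\<close>

definition Lp_norm :: "real \<Rightarrow> 'a::euclidean_space set \<Rightarrow> ('a \<Rightarrow> real) \<Rightarrow> real" where
  "Lp_norm p A f = (LINT x:A|lebesgue. \<bar>f x\<bar> powr p) powr (1 / p)"

definition ball_avg :: "('n::finite heis \<Rightarrow> real) \<Rightarrow> 'n heis \<Rightarrow> real \<Rightarrow> real" where
  "ball_avg b g r = 1 / measure lebesgue (hball g r) * (LINT h:hball g r|lebesgue. b h)"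

definition bmo_norm :: "('n::finite heis \<Rightarrow> real) \<Rightarrow> ennreal" where
  "bmo_norm b = (SUP g. SUP r\<in>{0<..}.
     ennreal (1 / measure lebesgue (hball g r) * (LINT h:hball g r|lebesgue. \<bar>b h - ball_avg b g r\<bar>)))"

definition BMO :: "('n::finite heis \<Rightarrow> real) set" where
  "BMO = {b \<in> Lp_loc 1. bmo_norm b < \<infinity>}"

definition morrey_norm :: "real \<Rightarrow> ('n::finite heis \<Rightarrow> real \<Rightarrow> real) \<Rightarrow> ('n heis \<Rightarrow> real) \<Rightarrow> ennreal" where
  "morrey_norm p \<phi> f = (SUP g. SUP r\<in>{0<..}.
     ennreal (inverse (\<phi> g r) * measure lebesgue (hball g r) powr (- 1 / p) * Lp_norm p (hball g r) f))"

definition morrey_space :: "real \<Rightarrow> ('n::finite heis \<Rightarrow> real \<Rightarrow> real) \<Rightarrow> ('n heis \<Rightarrow> real) set" where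
  "morrey_space p \<phi> = {f \<in> Lp_loc p. morrey_norm p \<phi> f < \<infinity>}"

definition positive_measurable_weight :: "('n::finite heis \<Rightarrow> real \<Rightarrow> real) \<Rightarrow> bool" where
  "positive_measurable_weight \<phi> \<longleftrightarrow>
     (\<forall>g. \<forall>r>0. \<phi> g r > 0) \<and>
     (\<lambda>(g, r). \<phi> g r) \<in> borel_measurable (restrict_space lebesgue (UNIV \<times> {0<..}))"

text \<open>A section \<open>\<phi> g\<close> of a Lebesgue measurable weight need not be measurable; this definition of the
  essential infimum over \<open>(\<tau>, \<infinity>)\<close> is meaningful for any function.\<close>

definition ess_inf_above :: "real \<Rightarrow> (real \<Rightarrow> ennreal) \<Rightarrow> ennreal" where
  "ess_inf_above \<tau> u = Sup {c. AE s in lebesgue. \<tau> < s \<longrightarrow> c \<le> u s}"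


section \<open>Operators\<close>

definition sublinear_on :: "('a::euclidean_space \<Rightarrow> real) set \<Rightarrow> (('a \<Rightarrow> real) \<Rightarrow> 'a \<Rightarrow> real) \<Rightarrow> bool" where
  "sublinear_on X T \<longleftrightarrow> (\<forall>f1\<in>X. \<forall>f2\<in>X. AE g in lebesgue.
     \<bar>T (\<lambda>h. f1 h + f2 h) g\<bar> \<le> \<bar>T f1 g\<bar> + \<bar>T f2 g\<bar>)"

definition bounded_between ::
    "'f set \<Rightarrow> ('f \<Rightarrow> ennreal) \<Rightarrow> 'f set \<Rightarrow> ('f \<Rightarrow> ennreal) \<Rightarrow> ('f \<Rightarrow> 'f) \<Rightarrow> bool" where
  "bounded_between X normX Y normY T \<longleftrightarrow>
     (\<exists>K::real. \<forall>f\<in>X. T f \<in> Y \<and> normY (T f) \<le> ennreal K * normX f)"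

abbreviation bounded_Lp :: "real \<Rightarrow> real \<Rightarrow> (('n::finite heis \<Rightarrow> real) \<Rightarrow> 'n heis \<Rightarrow> real) \<Rightarrow> bool" where
  "bounded_Lp p q \<equiv>
     bounded_between (Lp_space p) (\<lambda>f. ennreal (Lp_norm p UNIV f))
                     (Lp_space q) (\<lambda>f. ennreal (Lp_norm q UNIV f))"

abbreviation bounded_morrey ::
    "real \<Rightarrow> ('n::finite heis \<Rightarrow> real \<Rightarrow> real) \<Rightarrow> real \<Rightarrow> ('n heis \<Rightarrow> real \<Rightarrow> real) \<Rightarrow>
     (('n heis \<Rightarrow> real) \<Rightarrow> 'n heis \<Rightarrow> real) \<Rightarrow> bool" where
  "bounded_morrey p \<phi>1 q \<phi>2 \<equiv>
     bounded_between (morrey_space p \<phi>1) (morrey_norm p \<phi>1) (morrey_space q \<phi>2) (morrey_norm q \<phi>2)"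

text \<open>The right-hand side of the size condition may be infinite, in which case it is void.\<close>

definition size_condition ::
    "real \<Rightarrow> real \<Rightarrow> ('n::finite heis \<Rightarrow> real) \<Rightarrow> (('n heis \<Rightarrow> real) \<Rightarrow> 'n heis \<Rightarrow> real) \<Rightarrow> bool" where
  "size_condition \<alpha> c0 b T \<longleftrightarrow>
     (\<forall>f\<in>Lp_space 1. compact (closure {h. f h \<noteq> 0}) \<longrightarrow>
       (AE g in lebesgue. g \<notin> closure {h. f h \<noteq> 0} \<longrightarrow>
         ennreal \<bar>T f g\<bar> \<le> ennreal c0 *
           (\<integral>\<^sup>+h. ennreal (\<bar>b g - b h\<bar> * (\<bar>f h\<bar> / hdist g h powr (hdim TYPE('n) - \<alpha>))) \<partial>lebesgue)))"

text \<open>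
  The size condition and the boundedness on \<open>L_p\<close> say nothing about \<open>T f\<close> for \<open>f\<close> that is not
  in \<open>L_p\<close> and not compactly supported. For those \<open>f\<close>, the following condition ties \<open>T f\<close> to the
  values of \<open>T\<close> on truncations of \<open>f\<close>. For \<open>f\<close> in \<open>L_p\<close> it is a consequence of sublinearity and
  \<open>L_p\<close>-to-\<open>L_q\<close> boundedness.
\<close>

definition determined_by_truncations ::
    "('n::finite heis \<Rightarrow> real) set \<Rightarrow> (('n heis \<Rightarrow> real) \<Rightarrow> 'n heis \<Rightarrow> real) \<Rightarrow> bool" where
  "determined_by_truncations X T \<longleftrightarrow>
     (\<forall>f\<in>X. T f \<in> borel_measurable lebesgue \<and>
       (AE g in lebesgue. ennreal \<bar>T f g\<bar> \<le>
         limsup (\<lambda>k::nat. ennreal \<bar>T (\<lambda>h. indicator (hball 0 (real k)) h * f h) g\<bar>)))"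

definition spanne_condition ::
    "real \<Rightarrow> real \<Rightarrow> real \<Rightarrow> ('n::finite heis \<Rightarrow> real \<Rightarrow> real) \<Rightarrow> ('n heis \<Rightarrow> real \<Rightarrow> real) \<Rightarrow> bool" where
  "spanne_condition p q C \<phi>1 \<phi>2 \<longleftrightarrow>
     (\<forall>g. \<forall>r>0.
       (\<integral>\<^sup>+\<tau>\<in>{r<..}. ennreal (1 + ln (\<tau> / r)) *
           (ess_inf_above \<tau> (\<lambda>s. ennreal (\<phi>1 g s * s powr (hdim TYPE('n) / p))) /
            ennreal (\<tau> powr (hdim TYPE('n) / q + 1))) \<partial>lebesgue)
       \<le> ennreal (C * \<phi>2 g r))"

end

theory Submission
  imports Defs
begin

text \<open>
  Since \<open>q > p\<close>, the operator has no local part: cutting \<open>f\<close> into thin slabs \<open>f_i\<close>, the diagonal contribution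
  satisfies \<open>\<Sum>\<parallel>T f_i\<parallel>_q^q \<le> K^q \<Sum>\<parallel>f_i\<parallel>_p^q \<rightarrow> 0\<close>, so the size condition yields \<open>\<bar>T f\<bar> \<le> c0 [b, I_\<alpha>]f\<close> almost
  everywhere for the positive commutator \<open>[b, I_\<alpha>]f(g) = \<integral>\<bar>b(g) - b(h)\<bar> \<bar>f(h)\<bar> d(g, h)^(\<alpha> - Q) dh\<close>. This is what makes
  the final constant independent of the operator norm of \<open>T\<close>.

  The positive commutator maps \<open>L_p\<close> to \<open>L_q\<close> with norm at most a multiple of \<open>\<parallel>b\<parallel>_*\<close>. At distance
  comparable to \<open>2^k\<close>, \<open>\<bar>b(g) - b(h)\<bar>\<close> is split into two terms that are mirror images of each other. After
  dualising, both are controlled through the John-Nirenberg and Hoelder inequalities by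
  \<open>\<Sum>_k 2^(k \<alpha>) (avg_{B(g, 2^k)} \<bar>f\<bar>^s)^(1/s)\<close> with \<open>1 < s < p\<close>, which Hedberg's argument bounds by a
  power of the maximal function.

  On a ball \<open>B(g, r)\<close> the part of \<open>f\<close> in \<open>B(g, 2r)\<close> is handled by this global bound, and the rest shell
  by shell; the averages of \<open>b\<close> over \<open>B(g, 2^k r)\<close> drift by at most \<open>O(k \<parallel>b\<parallel>_*)\<close>, which is the
  logarithm in the hypothesis on \<open>(\<phi>1, \<phi>2)\<close>.
\<close>

section \<open>Real powers and norms of extended nonnegative functions\<close>

text \<open>The constant \<open>C'\<close> is fixed before \<open>b\<close> and \<open>T\<close>, so
  the norm of \<open>T\<close> on L_p must not enter it. This rules out treating the part of
  \<open>f\<close> near a ball by the boundedness of \<open>T\<close>. With q > p, a piece whose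
  p-th power integral is at most \<delta> keeps one factor of that integral for the summation over
  pieces and turns the remaining power q/p - 1 into smallness.

  The two mirror terms of the commutator are not equally accessible. In one, the oscillation of
  \<open>b\<close> over a ball about g is integrated against \<open>f\<close>, and Hoelder applies;
  in the other it is evaluated at g itself. The kernels are transposes of each other and the dual
  exponents satisfy 1/p' = 1/q' - \<alpha>/Q, so a single bound serves for both.

  Estimates are stated for every N > 0 above the BMO norm, not for the norm itself. This permits
  division by N, and the limit at the end includes norm 0. Nonnegative quantities stay in
  \<open>ennreal\<close>, where divergent integrals are legitimate values.\<close>

text \<open>Meant for positive exponents: \<open>0 powr a = 0\<close> for every \<open>a\<close>, and \<open>\<infinity>\<close> is always mapped to \<open>\<infinity>\<close>.\<close>

definition epowr :: "ennreal \<Rightarrow> real \<Rightarrow> ennreal" where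
  "epowr x a = (if x = \<infinity> then \<infinity> else ennreal (enn2real x powr a))"

lemma epowr_ennreal [simp]: "0 \<le> x \<Longrightarrow> epowr (ennreal x) a = ennreal (x powr a)"
  by (simp add: epowr_def)

lemma epowr_0 [simp]: "epowr 0 a = 0"
  by (simp add: epowr_def)

lemma epowr_top [simp]: "epowr top a = top"
  by (simp add: epowr_def)

lemma epowr_one [simp]: "epowr 1 a = 1"
  by (simp add: epowr_def)

lemma epowr_1 [simp]: "epowr x 1 = x"
  by (cases x rule: ennreal_cases) auto

lemma epowr_eq_0_iff [simp]: "epowr x a = 0 \<longleftrightarrow> x = 0"
  by (cases x rule: ennreal_cases) auto

lemma epowr_eq_top_iff [simp]: "epowr x a = top \<longleftrightarrow> x = top"
  by (cases x rule: ennreal_cases) auto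

lemma epowr_mono: "0 \<le> a \<Longrightarrow> x \<le> y \<Longrightarrow> epowr x a \<le> epowr y a"
  by (cases x rule: ennreal_cases; cases y rule: ennreal_cases)
     (auto intro!: ennreal_leI powr_mono2 simp: top_unique)

lemma epowr_mult: "epowr (x * y) a = epowr x a * epowr y a"
  by (cases x rule: ennreal_cases; cases y rule: ennreal_cases)
     (auto simp: ennreal_mult[symmetric] powr_mult ennreal_mult_top ennreal_top_mult)

lemma epowr_epowr: "epowr (epowr x a) b = epowr x (a * b)"
  by (cases x rule: ennreal_cases) (auto simp: powr_powr)

lemma epowr_add: "0 < a \<Longrightarrow> 0 < b \<Longrightarrow> epowr x (a + b) = epowr x a * epowr x b"
  by (cases x rule: ennreal_cases) (auto simp: powr_add ennreal_mult[symmetric] ennreal_top_mult)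

lemma epowr_measurable [measurable]:
  assumes [measurable]: "f \<in> borel_measurable M"
  shows "(\<lambda>x. epowr (f x) a) \<in> borel_measurable M"
proof -
  have "{x \<in> space M. f x = \<infinity>} = f -` {\<infinity>} \<inter> space M" by auto
  then have [measurable]: "{x \<in> space M. f x = \<infinity>} \<in> sets M" by simp
  show ?thesis unfolding epowr_def by measurable
qed

lemma epowr_cancel: "0 < a \<Longrightarrow> epowr (epowr x a) (1 / a) = x" "0 < a \<Longrightarrow> epowr (epowr x (1 / a)) a = x"
  by (simp_all add: epowr_epowr)

text \<open>The sum is at most twice the maximum. This covers all exponents \<open>a \<ge> 0\<close>
  at once, convex or not.\<close>

lemma epowr_add_le:
  assumes "0 \<le> a" shows "epowr (x + y) a \<le> ennreal (2 powr a) * (epowr x a + epowr y a)"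
proof -
  have "epowr (x + y) a \<le> epowr (2 * max x y) a"
    using add_mono[of x "max x y" y "max x y"] by (intro epowr_mono assms) (auto simp: mult_2)
  also have "\<dots> = epowr (ennreal 2) a * epowr (max x y) a"
    unfolding epowr_mult by simp
  also have "epowr (ennreal 2) a = ennreal (2 powr a)"
    by (rule epowr_ennreal) simp
  also have "epowr (max x y) a \<le> epowr x a + epowr y a"
    by (auto simp: max_def add_increasing add_increasing2)
  finally show ?thesis by (simp add: mult_left_mono)
qed

lemma epowr_Young:
  fixes x y :: ennreal
  assumes "1 < p" "1 < q" "1 / p + 1 / q = 1"
  shows "x * y \<le> epowr x p * ennreal (1 / p) + epowr y q * ennreal (1 / q)"
proof (cases "x = top \<or> y = top")
  case True
  then show ?thesis using assms by (auto simp: ennreal_top_mult)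
next
  case False
  then obtain a b where ab: "x = ennreal a" "y = ennreal b" "0 \<le> a" "0 \<le> b"
    by (cases x rule: ennreal_cases; cases y rule: ennreal_cases) auto
  have "a * b \<le> a powr p / p + b powr q / q"
    using Youngs_inequality[of p q a b] assms ab by auto
  then show ?thesis using ab assms
    by (auto simp: ennreal_mult[symmetric] ennreal_plus[symmetric] intro!: ennreal_leI
        simp del: ennreal_plus)
qed

text \<open>Unlike \<open>Lp_norm\<close>, this is infinite on functions that are not p-integrable,
  so inequalities between such norms carry no integrability hypotheses.\<close>

definition eLp :: "real \<Rightarrow> 'a measure \<Rightarrow> ('a \<Rightarrow> ennreal) \<Rightarrow> ennreal" where
  "eLp p M f = epowr (\<integral>\<^sup>+x. epowr (f x) p \<partial>M) (1 / p)"

lemma epowr_eLp: "0 < p \<Longrightarrow> epowr (eLp p M f) p = (\<integral>\<^sup>+x. epowr (f x) p \<partial>M)"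
  by (simp add: eLp_def epowr_cancel)

lemma eLp_mono: "0 < p \<Longrightarrow> (\<And>x. x \<in> space M \<Longrightarrow> f x \<le> g x) \<Longrightarrow> eLp p M f \<le> eLp p M g"
  unfolding eLp_def by (intro epowr_mono nn_integral_mono) auto

lemma eLp_mono_AE: "0 < p \<Longrightarrow> AE x in M. f x \<le> g x \<Longrightarrow> eLp p M f \<le> eLp p M g"
  unfolding eLp_def by (intro epowr_mono nn_integral_mono_AE) (auto elim!: eventually_mono intro: epowr_mono)

lemma eLp_cmult:
  assumes [measurable]: "f \<in> borel_measurable M" and "0 < p"
  shows "eLp p M (\<lambda>x. c * f x) = c * eLp p M f"
  using assms(2) by (simp add: eLp_def epowr_mult nn_integral_cmult epowr_cancel)

text \<open>Minkowski's inequality with a crude constant: one factor 2 from the pointwise bound for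
  the p-th power, another from taking the root of the sum.\<close>

lemma eLp_add_le:
  assumes [measurable]: "f \<in> borel_measurable M" "g \<in> borel_measurable M" and "1 \<le> p"
  shows "eLp p M (\<lambda>x. f x + g x) \<le> 4 * (eLp p M f + eLp p M g)"
proof -
  let ?F = "\<integral>\<^sup>+x. epowr (f x) p \<partial>M" and ?G = "\<integral>\<^sup>+x. epowr (g x) p \<partial>M"
  have "(\<integral>\<^sup>+x. epowr (f x + g x) p \<partial>M) \<le> (\<integral>\<^sup>+x. ennreal (2 powr p) * (epowr (f x) p + epowr (g x) p) \<partial>M)"
    using assms(3) by (intro nn_integral_mono epowr_add_le) auto
  also have "\<dots> = ennreal (2 powr p) * (?F + ?G)"
    by (simp add: nn_integral_cmult nn_integral_add)
  finally have "eLp p M (\<lambda>x. f x + g x) \<le> epowr (ennreal (2 powr p) * (?F + ?G)) (1 / p)"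
    unfolding eLp_def using assms(3) by (intro epowr_mono) auto
  also have "\<dots> = ennreal 2 * epowr (?F + ?G) (1 / p)"
    using assms(3) by (simp add: epowr_mult powr_powr)
  also have "epowr (?F + ?G) (1 / p) \<le> ennreal (2 powr (1 / p)) * (eLp p M f + eLp p M g)"
    unfolding eLp_def using assms(3) by (intro epowr_add_le) auto
  also have "ennreal (2 powr (1 / p)) \<le> ennreal 2"
    using assms(3) powr_mono[of "1 / p" 1 2] by (intro ennreal_leI) auto
  also have "ennreal 2 * (ennreal 2 * (eLp p M f + eLp p M g)) = 4 * (eLp p M f + eLp p M g)"
    unfolding mult.assoc[symmetric] by (simp add: ennreal_mult[symmetric])
  finally show ?thesis by (simp add: mult_left_mono mult_right_mono)
qed

text \<open>Young's inequality, integrated after normalising both norms to 1. Vanishing norms are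
  treated first: the function is then zero almost everywhere, and the right-hand side is 0 even if
  the other norm is infinite.\<close>

lemma Hoelder_eLp:
  assumes [measurable]: "f \<in> borel_measurable M" "g \<in> borel_measurable M"
    and pq: "1 < p" "1 < q" "1 / p + 1 / q = 1"
  shows "(\<integral>\<^sup>+x. f x * g x \<partial>M) \<le> eLp p M f * eLp q M g"
proof -
  have p0: "0 < p" "0 < q" using pq by auto
  let ?A = "eLp p M f" and ?B = "eLp q M g"
  consider "?A = 0" | "?B = 0" | "?A \<noteq> 0" "?B \<noteq> 0" "?A = top \<or> ?B = top"
    | "?A \<noteq> 0" "?B \<noteq> 0" "?A \<noteq> top" "?B \<noteq> top" by blast
  then show ?thesis
  proof cases
    case 1
    then have "AE x in M. f x = 0" by (simp add: eLp_def nn_integral_0_iff_AE)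
    then have "(\<integral>\<^sup>+x. f x * g x \<partial>M) = (\<integral>\<^sup>+x. 0 \<partial>M)" by (intro nn_integral_cong_AE) auto
    then show ?thesis by simp
  next
    case 2
    then have "AE x in M. g x = 0" by (simp add: eLp_def nn_integral_0_iff_AE)
    then have "(\<integral>\<^sup>+x. f x * g x \<partial>M) = (\<integral>\<^sup>+x. 0 \<partial>M)" by (intro nn_integral_cong_AE) auto
    then show ?thesis by simp
  next
    case 3
    then show ?thesis by (auto simp: ennreal_mult_top ennreal_top_mult)
  next
    case 4
    then obtain A B where AB: "?A = ennreal A" "?B = ennreal B" "0 < A" "0 < B"
      by (cases ?A rule: ennreal_cases; cases ?B rule: ennreal_cases) (auto simp: less_le)
    let ?a = "ennreal (1 / A)" and ?b = "ennreal (1 / B)"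
    have "(\<integral>\<^sup>+x. (?a * f x) * (?b * g x) \<partial>M)
       \<le> (\<integral>\<^sup>+x. epowr (?a * f x) p * ennreal (1 / p) + epowr (?b * g x) q * ennreal (1 / q) \<partial>M)"
      by (intro nn_integral_mono epowr_Young pq)
    also have "\<dots> = epowr (eLp p M (\<lambda>x. ?a * f x)) p * ennreal (1 / p)
         + epowr (eLp q M (\<lambda>x. ?b * g x)) q * ennreal (1 / q)"
      using p0 by (simp add: nn_integral_add nn_integral_multc epowr_eLp)
    also have "\<dots> = ennreal (1 / p) + ennreal (1 / q)"
      using p0 AB by (simp add: eLp_cmult ennreal_mult[symmetric])
    also have "\<dots> = 1" using pq p0 by (simp add: ennreal_plus[symmetric] del: ennreal_plus)
    finally have *: "(\<integral>\<^sup>+x. (?a * f x) * (?b * g x) \<partial>M) \<le> 1" .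
    have "(\<integral>\<^sup>+x. f x * g x \<partial>M) = (\<integral>\<^sup>+x. ennreal (A * B) * ((?a * f x) * (?b * g x)) \<partial>M)"
    proof (intro nn_integral_cong)
      fix x
      have "ennreal (A * B) * ((?a * f x) * (?b * g x)) = (ennreal (A * B) * (?a * ?b)) * (f x * g x)"
        by (simp add: mult_ac)
      also have "ennreal (A * B) * (?a * ?b) = 1"
        using AB by (simp add: ennreal_mult[symmetric])
      finally show "f x * g x = ennreal (A * B) * ((?a * f x) * (?b * g x))" by simp
    qed
    also have "\<dots> = ennreal (A * B) * (\<integral>\<^sup>+x. (?a * f x) * (?b * g x) \<partial>M)"
      by (intro nn_integral_cmult) measurable
    also have "\<dots> \<le> ennreal (A * B) * 1" by (intro mult_left_mono *) simp
    finally show ?thesis using AB by (simp add: ennreal_mult)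
  qed
qed

section \<open>Geometry of the Heisenberg group\<close>

abbreviation horiz_sq :: "'n::finite heis \<Rightarrow> real" where
  "horiz_sq g \<equiv> \<Sum>j\<in>UNIV. (fst g $ j $ 1)\<^sup>2 + (fst g $ j $ 2)\<^sup>2"

lemma horiz_sq_eq_norm: "horiz_sq g = (norm (fst g))\<^sup>2"
  by (simp add: norm_vec_def L2_set_def sum_nonneg UNIV_2)

text \<open>With |x|^2 + i t as a complex number, bounds on the fourth root become bounds on
  moduli.\<close>

lemma hnorm_eq_sqrt_cmod: "hnorm g = sqrt (cmod (Complex (horiz_sq g) (snd g)))"
  using real_root_mult_exp[of 2 2 "(horiz_sq g)\<^sup>2 + (snd g)\<^sup>2"]
  by (simp add: hnorm_def cmod_def sqrt_def)

lemma hnorm_nonneg [simp]: "0 \<le> hnorm g"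
  by (simp add: hnorm_eq_sqrt_cmod)

text \<open>Cygan's observation: the cross terms of the group law form the hermitian product of the horizontal parts.\<close>

lemma hnorm_triangle: "hnorm (hmult g h) \<le> hnorm g + hnorm h"
proof -
  define w :: "'a heis \<Rightarrow> 'a \<Rightarrow> complex" where "w g j = Complex (fst g $ j $ 1) (fst g $ j $ 2)" for g j
  define Z :: "'a heis \<Rightarrow> complex" where "Z g = Complex (horiz_sq g) (snd g)" for g
  let ?H = "\<Sum>j\<in>UNIV. w g j * cnj (w h j)"
  have hn: "hnorm g = sqrt (cmod (Z g))" for g :: "'a heis"
    by (simp add: hnorm_eq_sqrt_cmod Z_def)
  have w_sq: "(L2_set (\<lambda>j. cmod (w g j)) UNIV)\<^sup>2 = horiz_sq g" for g :: "'a heis"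
    by (simp add: L2_set_def w_def cmod_def sum_nonneg)
  have w_le: "L2_set (\<lambda>j. cmod (w g j)) UNIV \<le> hnorm g" for g :: "'a heis"
  proof -
    have "horiz_sq g \<le> cmod (Z g)"
      using complex_Re_le_cmod[of "Z g"] by (simp add: Z_def)
    then have "L2_set (\<lambda>j. cmod (w g j)) UNIV \<le> sqrt (cmod (Z g))"
      using w_sq[of g] by (intro real_le_rsqrt) simp
    then show ?thesis by (simp add: hn)
  qed
  have "cmod ?H \<le> (\<Sum>j\<in>UNIV. cmod (w g j) * cmod (w h j))"
    by (rule order_trans[OF norm_sum]) (simp add: norm_mult)
  also have "\<dots> \<le> L2_set (\<lambda>j. cmod (w g j)) UNIV * L2_set (\<lambda>j. cmod (w h j)) UNIV"
    using L2_set_mult_ineq[of "\<lambda>j. cmod (w g j)" "\<lambda>j. cmod (w h j)" UNIV] by simp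
  also have "\<dots> \<le> hnorm g * hnorm h"
    by (intro mult_mono w_le) auto
  finally have H: "cmod ?H \<le> hnorm g * hnorm h" .
  \<comment> \<open>The real part is the polarisation of |x + x'|^2; the imaginary part is the
    symplectic term of the group law, and the factor 2 fits both.\<close>
  have Z: "Z (hmult g h) = Z g + Z h + 2 * ?H"
    by (auto simp: complex_eq_iff Z_def w_def hmult_def sum.distrib[symmetric] sum_distrib_left
        power2_eq_square algebra_simps intro!: sum.cong)
  have "cmod (Z (hmult g h)) \<le> cmod (Z g) + cmod (Z h) + 2 * cmod ?H"
    unfolding Z using norm_triangle_ineq[of "Z g + Z h" "2 * ?H"] norm_triangle_ineq[of "Z g" "Z h"]
    by (simp add: norm_mult)
  also have "\<dots> \<le> (hnorm g)\<^sup>2 + (hnorm h)\<^sup>2 + 2 * (hnorm g * hnorm h)"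
    using H by (simp add: hn)
  also have "\<dots> = (hnorm g + hnorm h)\<^sup>2"
    by (simp add: power2_sum)
  finally show ?thesis
    unfolding hn[of "hmult g h"] by (intro real_le_lsqrt) auto
qed

lemma hinv_hmult: "hinv (hmult g h) = hmult (hinv h) (hinv g)"
  by (simp add: hinv_def hmult_def sum_negf[symmetric] algebra_simps sum_subtractf)

lemma hdist_nonneg [simp]: "0 \<le> hdist g h"
  by (simp add: hdist_def)

lemma hdist_self [simp]: "hdist g g = 0"
  by (simp add: hdist_def hmult_group_laws hnorm_def)

lemma hdist_commute: "hdist g h = hdist h g"
proof -
  have "hmult (hinv g) h = hinv (hmult (hinv h) g)"
    unfolding hinv_hmult by (simp add: hinv_def)
  then show ?thesis by (simp add: hdist_def hnorm_def hinv_def)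
qed

lemma hdist_triangle: "hdist g k \<le> hdist g h + hdist h k"
proof -
  have "hmult (hinv g) k = hmult (hmult (hinv g) h) (hmult (hinv h) k)"
    by (metis hmult_group_laws)
  then show ?thesis unfolding hdist_def by (metis hnorm_triangle)
qed

lemma continuous_on_hdist [continuous_intros]:
  assumes "continuous_on A f" "continuous_on A g"
  shows "continuous_on A (\<lambda>x. hdist (f x) (g x))"
  using assms unfolding hdist_def hnorm_def hmult_def hinv_def
  by (auto intro!: continuous_intros)

lemma hdist_measurable_pair: "(\<lambda>x. hdist (fst x) (snd x)) \<in> borel_measurable borel"
  by (intro borel_measurable_continuous_onI continuous_intros)

lemma mem_hball [simp]: "h \<in> hball g r \<longleftrightarrow> hdist g h < r"
  by (simp add: hball_def)

lemma open_hball [simp]: "open (hball g r)"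
  unfolding hball_def by (intro open_Collect_less continuous_intros)

lemma hball_borel [measurable]: "hball g r \<in> sets borel"
  by simp

lemma hball_lebesgue [measurable]: "hball g r \<in> sets lebesgue"
  by (simp add: borel_open)

lemma hball_mono: "hdist g h + r \<le> s \<Longrightarrow> hball h r \<subseteq> hball g s"
  using hdist_triangle[of g _ h] by (fastforce intro: order.strict_trans1)

lemma abs_snd_le_hnorm: "\<bar>snd g\<bar> \<le> (hnorm g)\<^sup>2"
  using abs_Im_le_cmod[of "Complex (horiz_sq g) (snd g)"] by (simp add: hnorm_eq_sqrt_cmod)

lemma norm_fst_le_hnorm: "norm (fst g) \<le> hnorm g"
proof -
  have "(norm (fst g))\<^sup>2 \<le> (hnorm g)\<^sup>2"
    using complex_Re_le_cmod[of "Complex (horiz_sq g) (snd g)"]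
    by (simp add: hnorm_eq_sqrt_cmod horiz_sq_eq_norm)
  then show ?thesis by (simp add: power2_le_iff_abs_le)
qed

lemma hdist_0 [simp]: "hdist 0 h = hnorm h"
  by (simp add: hdist_def hinv_def hmult_def hnorm_def)

text \<open>A ball about the identity sits in a Euclidean cylinder. This yields boundedness of
  balls, the volume bound for slabs, and the fact that finitely many slabs suffice to cover a
  ball.\<close>

lemma hball_0_subset: "0 \<le> r \<Longrightarrow> hball 0 r \<subseteq> cball 0 r \<times> {-(r\<^sup>2)..r\<^sup>2}"
proof
  fix h :: "'a heis" assume "0 \<le> r" "h \<in> hball 0 r"
  then have "hnorm h \<le> r" by simp
  with norm_fst_le_hnorm[of h] abs_snd_le_hnorm[of h] power_mono[of "hnorm h" r 2]
  show "h \<in> cball 0 r \<times> {-(r\<^sup>2)..r\<^sup>2}" by (auto simp: mem_Times_iff abs_le_iff)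
qed

lemma bounded_hball [simp]: "bounded (hball g r)"
proof -
  have "hball g r \<subseteq> hball 0 (hdist 0 g + \<bar>r\<bar>)"
    by (rule hball_mono) simp
  also have "\<dots> \<subseteq> cball 0 (hdist 0 g + \<bar>r\<bar>) \<times> {-((hdist 0 g + \<bar>r\<bar>)\<^sup>2)..(hdist 0 g + \<bar>r\<bar>)\<^sup>2}"
    by (rule hball_0_subset) simp
  finally show ?thesis
    by (rule bounded_subset[rotated]) (intro bounded_Times bounded_cball bounded_closed_interval)
qed

lemma compact_subset_hball:
  fixes K :: "'n::finite heis set"
  assumes "compact K" obtains R where "0 < R" "K \<subseteq> hball 0 R"
proof -
  have "bounded ((\<lambda>h. hdist 0 h) ` K)"
    using assms by (intro compact_imp_bounded compact_continuous_image continuous_intros) auto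
  then obtain R where "0 < R" "\<And>h. h \<in> K \<Longrightarrow> \<bar>hdist 0 h\<bar> \<le> R"
    by (auto simp: bounded_pos)
  then show ?thesis by (intro that[of "R + 1"]) force+
qed

section \<open>Left invariance and anisotropic scaling of Lebesgue measure\<close>

lemma nn_integral_lborel_scale:
  fixes f :: "'a::euclidean_space \<Rightarrow> ennreal"
  assumes [measurable]: "f \<in> borel_measurable borel" and "0 < c"
  shows "(\<integral>\<^sup>+x. f x \<partial>lborel) = ennreal (c ^ DIM('a)) * (\<integral>\<^sup>+x. f (c *\<^sub>R x) \<partial>lborel)"
  by (subst lborel_affine[of c 0])
     (use assms(2) in \<open>auto simp: nn_integral_density nn_integral_distr nn_integral_cmult\<close>)

lemma nn_integral_lborel_translate:
  fixes f :: "'a::euclidean_space \<Rightarrow> ennreal"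
  assumes [measurable]: "f \<in> borel_measurable borel"
  shows "(\<integral>\<^sup>+x. f (a + x) \<partial>lborel) = (\<integral>\<^sup>+x. f x \<partial>lborel)"
  by (subst (2) lborel_distr_plus[of a, symmetric]) (simp add: nn_integral_distr)

text \<open>A left translation is a shear: for fixed horizontal part x it shifts the last coordinate
  by an amount depending on x alone, and then x is shifted by a constant. Fubini removes the two
  shifts one after the other.\<close>

lemma emeasure_hmult_vimage:
  fixes k :: "'n::finite heis"
  assumes [measurable]: "A \<in> sets borel"
  shows "emeasure lborel {h. hmult k h \<in> A} = emeasure lborel A"
proof -
  let ?L = "\<lambda>x. 2 * (\<Sum>j\<in>UNIV. fst k $ j $ 2 * x $ j $ 1 - fst k $ j $ 1 * x $ j $ 2) :: real"
  have A2 [measurable]: "A \<in> sets (borel \<Otimes>\<^sub>M borel)"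
    using assms unfolding borel_prod .
  have "continuous_on UNIV (\<lambda>h. hmult k h)"
    unfolding hmult_def by (intro continuous_intros)
  then have m [measurable]: "hmult k \<in> borel \<rightarrow>\<^sub>M borel"
    by (rule borel_measurable_continuous_onI)
  have B: "{h. hmult k h \<in> A} \<in> sets borel"
    using measurable_sets[OF m assms] by (simp add: vimage_def)
  have "emeasure lborel {h. hmult k h \<in> A}
      = emeasure (lborel \<Otimes>\<^sub>M lborel) {h. hmult k h \<in> A}"
    by (simp add: lborel_prod)
  also have "\<dots> = (\<integral>\<^sup>+x. emeasure lborel (Pair x -` {h. hmult k h \<in> A}) \<partial>lborel)"
    using B by (intro lborel.emeasure_pair_measure_alt) (metis lborel_prod sets_lborel)
  also have "\<dots> = (\<integral>\<^sup>+x. (\<integral>\<^sup>+t. indicator A (fst k + x, t) \<partial>lborel) \<partial>lborel)"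
  proof (intro nn_integral_cong)
    fix x :: "(real ^ 2) ^ 'n"
    have "emeasure lborel (Pair x -` {h. hmult k h \<in> A})
        = (\<integral>\<^sup>+t. indicator (Pair x -` {h. hmult k h \<in> A}) t \<partial>lborel)"
      using B by (subst nn_integral_indicator) (auto intro!: sets_Pair1 simp: borel_prod)
    also have "\<dots> = (\<integral>\<^sup>+t. indicator A (fst k + x, (snd k + ?L x) + t) \<partial>lborel)"
      by (intro nn_integral_cong) (auto simp: indicator_def hmult_def algebra_simps)
    also have "\<dots> = (\<integral>\<^sup>+t. indicator A (fst k + x, t) \<partial>lborel)"
      by (rule nn_integral_lborel_translate) measurable
    finally show "emeasure lborel (Pair x -` {h. hmult k h \<in> A}) = (\<integral>\<^sup>+t. indicator A (fst k + x, t) \<partial>lborel)" .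
  qed
  also have "\<dots> = (\<integral>\<^sup>+x. (\<integral>\<^sup>+t. indicator A (x, t) \<partial>lborel) \<partial>lborel)"
    by (rule nn_integral_lborel_translate) measurable
  also have "\<dots> = (\<integral>\<^sup>+h. indicator A h \<partial>(lborel \<Otimes>\<^sub>M lborel))"
    by (intro lborel.nn_integral_fst) (simp add: borel_prod lborel_prod)
  finally show ?thesis by (simp add: lborel_prod)
qed

text \<open>The gauge is homogeneous under the dilation (x, t) -> (r x, r^2 t), whose Jacobian is
  r^(2n) r^2 = r^Q.\<close>

lemma emeasure_hball_0:
  assumes "0 < r"
  shows "emeasure lborel (hball (0 :: 'n::finite heis) r)
    = ennreal (r ^ (2 * CARD('n) + 2)) * emeasure lborel (hball (0 :: 'n heis) 1)"
proof -
  have A2 [measurable]: "hball g s \<in> sets (borel \<Otimes>\<^sub>M borel)" for g :: "'n heis" and s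
    unfolding borel_prod by (rule hball_borel)
  have scale: "hnorm (r *\<^sub>R x, r\<^sup>2 * t) = r * hnorm (x, t)" for x :: "(real ^ 2) ^ 'n" and t
  proof -
    have "horiz_sq (r *\<^sub>R x, r\<^sup>2 * t) = r\<^sup>2 * horiz_sq (x, t)"
      by (simp add: sum_distrib_left power_mult_distrib algebra_simps)
    then have "(horiz_sq (r *\<^sub>R x, r\<^sup>2 * t))\<^sup>2 + (r\<^sup>2 * t)\<^sup>2 = r ^ 4 * ((horiz_sq (x, t))\<^sup>2 + t\<^sup>2)"
      by (simp add: power_mult_distrib algebra_simps)
    then show ?thesis
      using assms by (simp add: hnorm_def real_root_mult real_root_pos2)
  qed
  have "emeasure lborel (hball (0 :: 'n heis) r) = (\<integral>\<^sup>+h. indicator (hball (0 :: 'n heis) r) h \<partial>(lborel \<Otimes>\<^sub>M lborel))"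
    by (simp add: lborel_prod)
  also have "\<dots> = (\<integral>\<^sup>+x. (\<integral>\<^sup>+t. indicator (hball (0 :: 'n heis) r) (x, t) \<partial>lborel) \<partial>lborel)"
    by (intro lborel.nn_integral_fst[symmetric]) (simp add: borel_prod lborel_prod)
  also have "\<dots> = ennreal (r ^ (2 * CARD('n))) *
      (\<integral>\<^sup>+x. (\<integral>\<^sup>+t. indicator (hball (0 :: 'n heis) r) (r *\<^sub>R x, t) \<partial>lborel) \<partial>lborel)"
    by (subst nn_integral_lborel_scale[OF _ assms]) (auto simp: mult.commute)
  also have "\<dots> = ennreal (r ^ (2 * CARD('n))) *
      (\<integral>\<^sup>+x. ennreal (r\<^sup>2) * (\<integral>\<^sup>+t. indicator (hball (0 :: 'n heis) r) (r *\<^sub>R x, r\<^sup>2 *\<^sub>R t) \<partial>lborel) \<partial>lborel)"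
    using assms by (subst (2) nn_integral_lborel_scale[of _ "r\<^sup>2"]) auto
  also have "\<dots> = ennreal (r ^ (2 * CARD('n))) *
      (ennreal (r\<^sup>2) * (\<integral>\<^sup>+x. (\<integral>\<^sup>+t. indicator (hball (0 :: 'n heis) 1) (x, t) \<partial>lborel) \<partial>lborel))"
  proof -
    have "indicator (hball (0 :: 'n heis) r) (r *\<^sub>R x, r\<^sup>2 *\<^sub>R t) = (indicator (hball (0 :: 'n heis) 1) (x, t) :: ennreal)"
      for x t using assms by (simp add: indicator_def scale)
    then show ?thesis by (simp only:) (subst nn_integral_cmult; measurable)
  qed
  also have "(\<integral>\<^sup>+x. (\<integral>\<^sup>+t. indicator (hball (0 :: 'n heis) 1) (x, t) \<partial>lborel) \<partial>lborel)
     = (\<integral>\<^sup>+h. indicator (hball (0 :: 'n heis) 1) h \<partial>(lborel \<Otimes>\<^sub>M lborel))"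
    by (intro lborel.nn_integral_fst) (simp add: borel_prod lborel_prod)
  finally show ?thesis
    using assms unfolding power_add[of r "2 * CARD('n)" 2]
    by (simp add: lborel_prod mult.assoc[symmetric] ennreal_mult[symmetric] del: power_add_numeral)
qed

definition unit_vol :: "'n::finite itself \<Rightarrow> real" where
  "unit_vol _ = measure lebesgue (hball (0 :: 'n heis) 1)"

lemma emeasure_lebesgue_eq: "A \<in> sets borel \<Longrightarrow> emeasure lebesgue A = emeasure lborel A"
  by (simp add: emeasure_completion)

lemma emeasure_hball_finite [simp]: "emeasure lebesgue (hball g r) < \<infinity>"
  using emeasure_bounded_finite[of "hball g r"] by (simp add: emeasure_lebesgue_eq)

lemma unit_vol_pos [simp]: "0 < unit_vol TYPE('n::finite)"
proof -
  have "(0 :: 'n heis) \<in> hball 0 1"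
    unfolding mem_hball hdist_self by simp
  then have "hball (0 :: 'n heis) 1 \<noteq> {}" by blast
  then have "emeasure lebesgue (hball (0 :: 'n heis) 1) \<noteq> 0"
    using open_not_negligible[of "hball (0 :: 'n heis) 1"] by (simp add: negligible_iff_emeasure0)
  then show ?thesis
    using emeasure_hball_finite[of "0 :: 'n heis" 1]
    unfolding unit_vol_def measure_def enn2real_positive_iff infinity_ennreal_def
    by (metis not_gr_zero)
qed

lemma hdim_pos [simp]: "0 < hdim TYPE('n::finite)"
  by (simp add: hdim_def)

lemma emeasure_hball:
  fixes g :: "'n::finite heis"
  assumes "0 < r"
  shows "emeasure lebesgue (hball g r) = ennreal (unit_vol TYPE('n) * r powr hdim TYPE('n))"
proof -
  have "emeasure lebesgue (hball g r) = emeasure lborel {h. hmult (hinv g) h \<in> hball 0 r}"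
    unfolding emeasure_lebesgue_eq[OF hball_borel] by (simp add: hball_def hdist_def[of g])
  also have "\<dots> = ennreal (r ^ (2 * CARD('n) + 2)) * emeasure lborel (hball (0 :: 'n heis) 1)"
    by (simp only: emeasure_hmult_vimage[OF hball_borel] emeasure_hball_0[OF assms])
  also have "emeasure lborel (hball (0 :: 'n heis) 1) = ennreal (unit_vol TYPE('n))"
    using emeasure_hball_finite[of "0 :: 'n heis" 1] emeasure_lebesgue_eq[OF hball_borel, of "0 :: 'n heis" 1]
    unfolding unit_vol_def by (metis emeasure_eq_ennreal_measure infinity_ennreal_def order_less_irrefl)
  also have "r ^ (2 * CARD('n) + 2) = r powr hdim TYPE('n)"
    unfolding hdim_def using assms by (rule powr_realpow[symmetric])
  finally show ?thesis using unit_vol_pos[where 'n='n] by (simp add: ennreal_mult[symmetric] mult.commute)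
qed

lemma measure_hball:
  fixes g :: "'n::finite heis"
  shows "0 < r \<Longrightarrow> measure lebesgue (hball g r) = unit_vol TYPE('n) * r powr hdim TYPE('n)"
  unfolding measure_def by (subst emeasure_hball) (auto simp: less_imp_le)

declare emeasure_completion [simp del] measure_completion [simp del]

section \<open>Covering, density points and the maximal function\<close>

definition vol :: "'n::finite itself \<Rightarrow> real \<Rightarrow> real" where
  "vol n r = unit_vol n * r powr hdim n"

lemma vol_pos [simp]: "0 < r \<Longrightarrow> 0 < vol TYPE('n::finite) r"
  by (simp add: vol_def)

lemma vol_mult: "0 < c \<Longrightarrow> 0 < r \<Longrightarrow> vol TYPE('n::finite) (c * r) = c powr hdim TYPE('n) * vol TYPE('n) r"
  by (simp add: vol_def powr_mult)

lemma emeasure_hball_vol: "0 < r \<Longrightarrow> emeasure lebesgue (hball (g :: 'n::finite heis) r) = ennreal (vol TYPE('n) r)"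
  unfolding vol_def by (rule emeasure_hball)

lemma measure_hball_vol: "0 < r \<Longrightarrow> measure lebesgue (hball (g :: 'n::finite heis) r) = vol TYPE('n) r"
  unfolding vol_def by (rule measure_hball)

lemma emeasure_hball_mult:
  "0 < c \<Longrightarrow> 0 < r \<Longrightarrow> emeasure lebesgue (hball (g :: 'n::finite heis) (c * r))
    = ennreal (c powr hdim TYPE('n)) * ennreal (vol TYPE('n) r)"
  by (simp add: emeasure_hball_vol vol_mult ennreal_mult less_imp_le)

interpretation leb: sigma_finite_measure "lebesgue :: 'a::euclidean_space measure"
proof
  have "emeasure lebesgue (cball 0 (real n) :: 'a set) \<noteq> \<infinity>" for n
    using emeasure_bounded_finite[of "cball 0 (real n) :: 'a set"] by (simp add: emeasure_lebesgue_eq)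
  moreover have "(\<Union>n. cball 0 (real n)) = (UNIV :: 'a set)"
    by (auto simp: real_arch_simple)
  ultimately show "\<exists>A. countable A \<and> A \<subseteq> sets (lebesgue :: 'a measure) \<and> \<Union>A = space lebesgue \<and>
      (\<forall>a\<in>A. emeasure lebesgue a \<noteq> \<infinity>)"
    by (intro exI[of _ "range (\<lambda>n. cball 0 (real n))"]) (auto simp: borel_closed)
qed

interpretation leb_pair: pair_sigma_finite "lebesgue :: 'a::euclidean_space measure" "lebesgue :: 'b::euclidean_space measure" ..

lemma measurable_lebesgue_borel: "(\<lambda>x. x) \<in> lebesgue \<rightarrow>\<^sub>M borel"
  by (simp add: measurable_completion)

lemma fst_lebesgue_measurable [measurable]: "fst \<in> lebesgue \<Otimes>\<^sub>M N \<rightarrow>\<^sub>M borel"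
  using measurable_compose[OF measurable_fst measurable_lebesgue_borel] .

lemma snd_lebesgue_measurable [measurable]: "snd \<in> N \<Otimes>\<^sub>M lebesgue \<rightarrow>\<^sub>M borel"
  using measurable_compose[OF measurable_snd measurable_lebesgue_borel] .

lemma hdist_measurable [measurable (raw)]:
  assumes [measurable]: "f \<in> M \<rightarrow>\<^sub>M borel" "g \<in> M \<rightarrow>\<^sub>M borel"
  shows "(\<lambda>x. hdist (f x) (g x)) \<in> borel_measurable M"
proof -
  have "(\<lambda>x. (f x, g x)) \<in> M \<rightarrow>\<^sub>M borel"
    by (rule borel_measurable_Pair) measurable
  from measurable_compose[OF this hdist_measurable_pair] show ?thesis by simp
qed

lemma nn_integral_hball_measurable [measurable]:
  assumes [measurable]: "f \<in> borel_measurable lebesgue"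
  shows "(\<lambda>x :: 'n::finite heis. \<integral>\<^sup>+h. f h * indicator (hball x r) h \<partial>lebesgue) \<in> borel_measurable lebesgue"
proof (rule leb.borel_measurable_nn_integral)
  have "(\<lambda>z :: 'n heis \<times> 'n heis. f (snd z) * indicator {z. hdist (fst z) (snd z) < r} z)
      \<in> borel_measurable (lebesgue \<Otimes>\<^sub>M lebesgue)"
    by measurable
  then show "(\<lambda>(x, h). f h * indicator (hball x r) h) \<in> borel_measurable (lebesgue \<Otimes>\<^sub>M (lebesgue :: 'n heis measure))"
    by (rule measurable_cong[THEN iffD1, rotated]) (auto simp: indicator_def)
qed

text \<open>Inner regularity. It reduces estimates for measurable sets to compact subsets, where
  covers by balls are finite and a ball of largest radius exists.\<close>

lemma emeasure_le_compact:
  fixes A :: "'a::euclidean_space set"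
  assumes A: "A \<in> sets lebesgue" and K: "\<And>K. compact K \<Longrightarrow> K \<subseteq> A \<Longrightarrow> emeasure lebesgue K \<le> B"
  shows "emeasure lebesgue A \<le> B"
proof (rule ennreal_le_epsilon)
  fix e :: real assume "0 < e"
  with A obtain T where T: "closed T" "T \<subseteq> A" "A - T \<in> lmeasurable" "emeasure lebesgue (A - T) < ennreal e"
    by (rule sets_lebesgue_inner_closed)
  have Tn: "T = (\<Union>n. T \<inter> cball 0 (real n))"
    by (auto simp: real_arch_simple)
  have "emeasure lebesgue T = (SUP n. emeasure lebesgue (T \<inter> cball 0 (real n)))"
    using T by (subst Tn, intro SUP_emeasure_incseq[symmetric])
      (auto simp: incseq_def borel_closed closed_Int)
  also have "\<dots> \<le> B"
    using T by (intro SUP_least K) (auto intro: closed_Int_compact)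
  finally have *: "emeasure lebesgue T \<le> B" .
  have "emeasure lebesgue A \<le> emeasure lebesgue T + emeasure lebesgue (A - T)"
    using emeasure_subadditive[of T lebesgue "A - T"] T A by (auto simp: borel_closed Un_absorb1)
  with * T(4) show "emeasure lebesgue A \<le> B + ennreal e"
    by (meson add_mono order.trans less_imp_le)
qed

text \<open>Greedy selection: take a ball of largest radius, discard all balls that meet it, and
  recurse. A discarded ball has at most the radius of the chosen one, hence lies in its triple.
  Balls are indexed by their centres.\<close>

lemma Vitali_finite:
  assumes "finite I" "\<And>x. x \<in> I \<Longrightarrow> 0 < \<rho> x"
  shows "\<exists>J\<subseteq>I. disjoint_family_on (\<lambda>x. hball x (\<rho> x)) J \<and>
    (\<Union>x\<in>I. hball x (\<rho> x)) \<subseteq> (\<Union>x\<in>J. hball x (3 * \<rho> x))"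
  using assms
proof (induction I rule: finite_psubset_induct)
  case (psubset I)
  show ?case
  proof (cases "I = {}")
    case False
    then obtain z where z: "z \<in> I" "\<And>x. x \<in> I \<Longrightarrow> \<rho> x \<le> \<rho> z"
      using Max_in[of "\<rho> ` I"] Max_ge[of "\<rho> ` I"] psubset.hyps by fastforce
    define I' where "I' = {x \<in> I. hball x (\<rho> x) \<inter> hball z (\<rho> z) = {}}"
    have "hdist z z < \<rho> z" using psubset.prems[OF z(1)] by simp
    then have "z \<notin> I'" by (auto simp: I'_def simp del: hdist_self)
    then have "I' \<subset> I" using z by (auto simp: I'_def)
    then obtain J where J: "J \<subseteq> I'" "disjoint_family_on (\<lambda>x. hball x (\<rho> x)) J"
       "(\<Union>x\<in>I'. hball x (\<rho> x)) \<subseteq> (\<Union>x\<in>J. hball x (3 * \<rho> x))"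
      using psubset.IH[of I'] psubset.prems by (auto simp: I'_def)
    have "disjoint_family_on (\<lambda>x. hball x (\<rho> x)) (insert z J)"
      using J(1,2) unfolding disjoint_family_on_def I'_def by blast
    moreover have "hball x (\<rho> x) \<subseteq> hball z (3 * \<rho> z)" if x: "x \<in> I" "x \<notin> I'" for x
    proof -
      obtain y where y: "hdist x y < \<rho> x" "hdist z y < \<rho> z"
        using x by (auto simp: I'_def)
      show ?thesis
      proof
        fix h assume "h \<in> hball x (\<rho> x)"
        then have "hdist x h < \<rho> x" by simp
        then show "h \<in> hball z (3 * \<rho> z)"
          using hdist_triangle[of z h y] hdist_triangle[of y h x] hdist_commute[of y x] z(2)[OF x(1)] y
          by simp
      qed
    qed
    then have "(\<Union>x\<in>I. hball x (\<rho> x)) \<subseteq> (\<Union>x\<in>insert z J. hball x (3 * \<rho> x))"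
      using J(3) by blast
    ultimately show ?thesis
      using J(1) z(1) by (intro exI[of _ "insert z J"]) (auto simp: I'_def)
  qed (auto simp: disjoint_family_on_def)
qed

text \<open>Disjointness of the selected balls prevents the mass of \<open>f\<close> from being
  counted twice. The hypothesis concerns only the part of \<open>K\<close> in each triple; the
  John-Nirenberg argument relies on this.\<close>

lemma Vitali_estimate:
  fixes K :: "'n::finite heis set"
  assumes K: "compact K" and \<rho>: "\<And>x. x \<in> K \<Longrightarrow> 0 < \<rho> x"
    and [measurable]: "f \<in> borel_measurable lebesgue"
    and le: "\<And>x. x \<in> K \<Longrightarrow> emeasure lebesgue (K \<inter> hball x (3 * \<rho> x))
       \<le> c * (\<integral>\<^sup>+h. f h * indicator (hball x (\<rho> x)) h \<partial>lebesgue)"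
  shows "emeasure lebesgue K \<le> c * (\<integral>\<^sup>+h. f h \<partial>lebesgue)"
proof -
  have [measurable]: "K \<in> sets lebesgue" using K by (simp add: borel_compact)
  have "x \<in> hball x (\<rho> x)" if "x \<in> K" for x using \<rho>[OF that] by simp
  then have "K \<subseteq> (\<Union>x\<in>K. hball x (\<rho> x))" by blast
  then obtain I where I: "I \<subseteq> K" "finite I" "K \<subseteq> (\<Union>x\<in>I. hball x (\<rho> x))"
    using compactE_image[OF K, of K "\<lambda>x. hball x (\<rho> x)"] by auto
  obtain J where J: "J \<subseteq> I" "disjoint_family_on (\<lambda>x. hball x (\<rho> x)) J"
     "(\<Union>x\<in>I. hball x (\<rho> x)) \<subseteq> (\<Union>x\<in>J. hball x (3 * \<rho> x))"
    using Vitali_finite[of I \<rho>] I \<rho> by blast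
  have fin: "finite J" using I J finite_subset by blast
  have "emeasure lebesgue K \<le> emeasure lebesgue (\<Union>x\<in>J. K \<inter> hball x (3 * \<rho> x))"
    using I(3) J(3) fin by (intro emeasure_mono sets.finite_UN) auto
  also have "\<dots> \<le> (\<Sum>x\<in>J. emeasure lebesgue (K \<inter> hball x (3 * \<rho> x)))"
    using fin by (intro emeasure_subadditive_finite) auto
  also have "\<dots> \<le> (\<Sum>x\<in>J. c * (\<integral>\<^sup>+h. f h * indicator (hball x (\<rho> x)) h \<partial>lebesgue))"
    using I J by (intro sum_mono le) auto
  also have "\<dots> = c * (\<integral>\<^sup>+h. (\<Sum>x\<in>J. f h * indicator (hball x (\<rho> x)) h) \<partial>lebesgue)"
    by (subst nn_integral_sum) (auto simp: sum_distrib_left)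
  also have "\<dots> \<le> c * (\<integral>\<^sup>+h. f h \<partial>lebesgue)"
  proof (intro mult_left_mono nn_integral_mono)
    fix h
    have "(\<Sum>x\<in>J. f h * indicator (hball x (\<rho> x)) h) = f h * indicator (\<Union>x\<in>J. hball x (\<rho> x)) h"
      unfolding sum_distrib_left[symmetric] indicator_UN_disjoint[OF fin J(2)] by simp
    also have "\<dots> \<le> f h" by (auto simp: indicator_def)
    finally show "(\<Sum>x\<in>J. f h * indicator (hball x (\<rho> x)) h) \<le> f h" .
  qed simp
  finally show ?thesis .
qed

text \<open>After translation to the identity, the Euclidean norm of k is at most
  \<open>hnorm k + (hnorm k)\<^sup>2\<close>, which is at most 2 r once
  \<open>r \<le> 1\<close>.\<close>

lemma open_contains_hball:
  fixes U :: "'n::finite heis set"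
  assumes "open U" "x \<in> U"
  obtains r where "0 < r" "hball x r \<subseteq> U"
proof -
  have "continuous_on UNIV (\<lambda>h. hmult x h)"
    unfolding hmult_def by (intro continuous_intros)
  then have "open ((\<lambda>h. hmult x h) -` U)"
    using assms by (simp add: open_vimage)
  moreover have "0 \<in> (\<lambda>h. hmult x h) -` U"
    using assms by (simp add: hmult_group_laws)
  ultimately obtain d where d: "0 < d" "ball 0 d \<subseteq> (\<lambda>h. hmult x h) -` U"
    using open_contains_ball by blast
  define r where "r = min 1 (d / 4)"
  have r: "0 < r" "r \<le> 1" "2 * r < d" using d by (auto simp: r_def min_def)
  have "h \<in> U" if "h \<in> hball x r" for h
  proof -
    define k where "k = hmult (hinv x) h"
    have k: "hnorm k < r" using that by (simp add: k_def hdist_def)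
    have "norm k \<le> norm (fst k) + norm (snd k)"
      using norm_Pair_le[of "fst k" "snd k"] by simp
    also have "\<dots> \<le> hnorm k + (hnorm k)\<^sup>2"
      using norm_fst_le_hnorm[of k] abs_snd_le_hnorm[of k] by simp
    also have "\<dots> \<le> 2 * r"
      using power_mono[of "hnorm k" 1 1] mult_mono[of "hnorm k" 1 "hnorm k" "hnorm k"] k r
      by (simp add: power2_eq_square)
    finally have "k \<in> ball 0 d" using r by simp
    then have "hmult x k \<in> U" using d by auto
    then show ?thesis by (metis k_def hmult_group_laws)
  qed
  with r show ?thesis by (intro that[of r]) auto
qed

text \<open>A weak Lebesgue density theorem: density above 1/2 at one of the radii r0 / 3^j. Around
  an exceptional point every such ball has at least half its volume outside \<open>E\<close>. If the
  ball lies in an open \<open>U\<close> around the exceptional set \<open>Z\<close>, that half lies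
  in \<open>U - Z\<close>, so the covering lemma bounds the measure of \<open>Z\<close> by a
  multiple of that of \<open>U - Z\<close>, which is arbitrarily small.\<close>

lemma density_point:
  fixes E :: "'n::finite heis set"
  assumes E [measurable]: "E \<in> sets lebesgue" and "0 < r0"
  shows "AE x in lebesgue. x \<in> E \<longrightarrow>
    (\<exists>j\<ge>1::nat. ennreal (vol TYPE('n) (r0 / 3 ^ j)) < 2 * emeasure lebesgue (E \<inter> hball x (r0 / 3 ^ j)))"
proof -
  define \<rho> where "\<rho> j = r0 / 3 ^ j" for j :: nat
  have \<rho>: "0 < \<rho> j" for j using assms by (simp add: \<rho>_def)
  have m: "emeasure lebesgue (E \<inter> hball x r) = (\<integral>\<^sup>+h. indicator E h * indicator (hball x r) h \<partial>lebesgue)" for x r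
    by (simp add: indicator_inter_arith[symmetric])
  define Z where "Z = {x \<in> E. \<forall>j\<ge>1. 2 * emeasure lebesgue (E \<inter> hball x (\<rho> j)) \<le> ennreal (vol TYPE('n) (\<rho> j))}"
  have Z [measurable]: "Z \<in> sets lebesgue"
  proof -
    have "Z = {x \<in> space lebesgue. x \<in> E \<and> (\<forall>j\<in>{1..}. 2 * emeasure lebesgue (E \<inter> hball x (\<rho> j)) \<le> ennreal (vol TYPE('n) (\<rho> j)))}"
      by (auto simp: Z_def)
    also have "\<dots> \<in> sets lebesgue"
      unfolding m by measurable
    finally show ?thesis .
  qed
  \<comment> \<open>The factor 2 comes from density at most 1/2, the factor 3^Q from passing to
    triples; \<open>e'\<close> below is chosen to cancel both.\<close>
  let ?c = "ennreal (2 * 3 powr hdim TYPE('n))"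
  have "emeasure lebesgue Z \<le> 0"
  proof (rule ennreal_le_epsilon)
    fix e :: real assume e: "0 < e"
    define e' where "e' = e / (2 * 3 powr hdim TYPE('n))"
    have "0 < e'" using e by (simp add: e'_def)
    then obtain U where U: "open U" "Z \<subseteq> U" "U - Z \<in> lmeasurable" "emeasure lebesgue (U - Z) < ennreal e'"
      using sets_lebesgue_outer_open[OF Z] by blast
    have [measurable]: "U \<in> sets lebesgue" using U by (simp add: borel_open)
    have "emeasure lebesgue K \<le> ?c * (\<integral>\<^sup>+h. indicator (U - Z) h \<partial>lebesgue)" if K: "compact K" "K \<subseteq> Z" for K
    proof -
      have "\<exists>j\<ge>1. hball x (\<rho> j) \<subseteq> U" if x: "x \<in> K" for x
      proof -
        obtain r where r: "0 < r" "hball x r \<subseteq> U"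
          using open_contains_hball[of U x] U K x by blast
        obtain n where "r0 / r < 3 ^ n" using real_arch_pow[of 3 "r0 / r"] by auto
        then have "r0 / r < 3 ^ Suc n"
          by (rule less_le_trans) simp
        then have "\<rho> (Suc n) \<le> r"
          using r by (simp add: \<rho>_def field_simps)
        then have "hball x (\<rho> (Suc n)) \<subseteq> hball x r" by (intro hball_mono) simp
        with r show ?thesis by (intro exI[of _ "Suc n"]) auto
      qed
      then obtain J where J: "\<And>x. x \<in> K \<Longrightarrow> J x \<ge> 1 \<and> hball x (\<rho> (J x)) \<subseteq> U" by metis
      show ?thesis
      proof (rule Vitali_estimate[OF K(1), where \<rho>="\<lambda>x. \<rho> (J x)"])
        fix x assume x: "x \<in> K"
        let ?B = "hball x (\<rho> (J x))"
        have "emeasure lebesgue (E \<inter> ?B) + emeasure lebesgue (E \<inter> ?B) \<le> ennreal (vol TYPE('n) (\<rho> (J x)))"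
          using x K J[OF x] by (auto simp: Z_def mult_2)
        moreover have v: "ennreal (vol TYPE('n) (\<rho> (J x))) = emeasure lebesgue (E \<inter> ?B) + emeasure lebesgue (?B - E)"
        proof -
          have "E \<inter> ?B \<inter> (?B - E) = {}" "E \<inter> ?B \<union> (?B - E) = ?B" by blast+
          then show ?thesis
            using plus_emeasure[of "E \<inter> ?B" lebesgue "?B - E"] by (simp add: emeasure_hball_vol[OF \<rho>])
        qed
        moreover have "emeasure lebesgue (E \<inter> ?B) \<noteq> \<infinity>"
          using v by (metis ennreal_add_eq_top ennreal_neq_top infinity_ennreal_def)
        ultimately have "emeasure lebesgue (E \<inter> ?B) \<le> emeasure lebesgue (?B - E)"
          unfolding v ennreal_add_left_cancel_le by blast
        then have "ennreal (vol TYPE('n) (\<rho> (J x))) \<le> 2 * emeasure lebesgue (?B - E)"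
          unfolding v mult_2 by (intro add_mono) auto
        also have "emeasure lebesgue (?B - E) \<le> (\<integral>\<^sup>+h. indicator (U - Z) h * indicator ?B h \<partial>lebesgue)"
        proof -
          have "?B - E \<subseteq> (U - Z) \<inter> ?B"
            using J[OF x] by (auto simp only: Z_def)
          then have "emeasure lebesgue (?B - E) \<le> emeasure lebesgue ((U - Z) \<inter> ?B)"
            by (rule emeasure_mono) measurable
          also have "\<dots> = (\<integral>\<^sup>+h. indicator ((U - Z) \<inter> ?B) h \<partial>lebesgue)"
            by (rule nn_integral_indicator[symmetric]) measurable
          finally show ?thesis unfolding indicator_inter_arith .
        qed
        finally have *: "ennreal (vol TYPE('n) (\<rho> (J x))) \<le> 2 * (\<integral>\<^sup>+h. indicator (U - Z) h * indicator ?B h \<partial>lebesgue)"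
          by (simp add: mult_left_mono)
        have "emeasure lebesgue (K \<inter> hball x (3 * \<rho> (J x))) \<le> emeasure lebesgue (hball x (3 * \<rho> (J x)))"
          by (intro emeasure_mono) auto
        also have "\<dots> = ennreal (3 powr hdim TYPE('n)) * ennreal (vol TYPE('n) (\<rho> (J x)))"
          by (rule emeasure_hball_mult) (use \<rho> in auto)
        also have "\<dots> \<le> ennreal (3 powr hdim TYPE('n)) * (2 * (\<integral>\<^sup>+h. indicator (U - Z) h * indicator ?B h \<partial>lebesgue))"
          by (intro mult_left_mono *) simp
        finally show "emeasure lebesgue (K \<inter> hball x (3 * \<rho> (J x)))
           \<le> ?c * (\<integral>\<^sup>+h. indicator (U - Z) h * indicator ?B h \<partial>lebesgue)"
          by (simp add: ennreal_mult mult_ac)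
      qed (use \<rho> in auto)
    qed
    then have "emeasure lebesgue Z \<le> ?c * (\<integral>\<^sup>+h. indicator (U - Z) h \<partial>lebesgue)"
      by (rule emeasure_le_compact[OF Z])
    also have "(\<integral>\<^sup>+h. indicator (U - Z) h \<partial>lebesgue) = emeasure lebesgue (U - Z)"
      by (rule nn_integral_indicator) measurable
    also have "?c * emeasure lebesgue (U - Z) \<le> ?c * ennreal e'"
      using U(4) by (intro mult_left_mono) (simp_all only: less_imp_le zero_le)
    also have "\<dots> = ennreal e"
      using e by (simp add: e'_def ennreal_mult[symmetric])
    finally show "emeasure lebesgue Z \<le> 0 + ennreal e" by simp
  qed
  then have "Z \<in> null_sets lebesgue" by (auto simp: null_sets_def)
  then show ?thesis
    by (rule AE_I') (auto simp: Z_def \<rho>_def not_less)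
qed

section \<open>The dyadic maximal function\<close>

definition havg :: "('n::finite heis \<Rightarrow> ennreal) \<Rightarrow> 'n heis \<Rightarrow> real \<Rightarrow> ennreal" where
  "havg f g r = ennreal (1 / vol TYPE('n) r) * (\<integral>\<^sup>+h. f h * indicator (hball g r) h \<partial>lebesgue)"

text \<open>Only dyadic radii occur: the supremum is then countable, hence measurable, and it
  dominates exactly the averages that appear in \<open>hed\<close>.\<close>

definition hmax :: "('n::finite heis \<Rightarrow> ennreal) \<Rightarrow> 'n heis \<Rightarrow> ennreal" where
  "hmax f g = (SUP k::int. havg f g (2 powr k))"

lemma havg_measurable [measurable]:
  "f \<in> borel_measurable lebesgue \<Longrightarrow> (\<lambda>g. havg f g r) \<in> borel_measurable lebesgue"
  unfolding havg_def by measurable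

lemma hmax_measurable [measurable]:
  assumes [measurable]: "f \<in> borel_measurable lebesgue"
  shows "hmax f \<in> borel_measurable lebesgue"
proof -
  have "(\<lambda>g. SUP k::int. havg f g (2 powr k)) \<in> borel_measurable lebesgue"
    by measurable
  then show ?thesis by (simp add: hmax_def[abs_def])
qed

lemma havg_le_hmax: "havg f g (2 powr of_int k) \<le> hmax f g"
  unfolding hmax_def by (rule SUP_upper) simp

lemma nn_integral_hball_eq_havg:
  "0 < r \<Longrightarrow> (\<integral>\<^sup>+h. f h * indicator (hball g r) h \<partial>lebesgue) = ennreal (vol TYPE('n) r) * havg f (g :: 'n::finite heis) r"
  using vol_pos[of r, where 'n='n]
  by (simp add: havg_def mult.assoc[symmetric] ennreal_mult[symmetric] less_imp_le del: vol_pos)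

lemma havg_add:
  assumes [measurable]: "f \<in> borel_measurable lebesgue" "f' \<in> borel_measurable lebesgue"
  shows "havg (\<lambda>h. f h + f' h) g r = havg f g r + havg f' g r"
  by (simp add: havg_def distrib_right nn_integral_add distrib_left)

lemma havg_mono: "(\<And>h. f h \<le> f' h) \<Longrightarrow> havg f g r \<le> havg f' g r"
  unfolding havg_def by (intro mult_left_mono nn_integral_mono mult_right_mono) auto

lemma havg_const: "0 < r \<Longrightarrow> havg (\<lambda>h. c) g r = c"
  for g :: "'n::finite heis"
  using vol_pos[of r, where 'n='n]
  by (simp add: havg_def nn_integral_cmult emeasure_hball_vol mult.left_commute[of _ c]
      ennreal_mult[symmetric] del: vol_pos)

text \<open>Each point of the level set has a dyadic ball whose mass exceeds t times its volume, so
  the volume of the triple is at most 3^Q / t times that mass.\<close>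

lemma hmax_weak_type:
  fixes f :: "'n::finite heis \<Rightarrow> ennreal"
  assumes [measurable]: "f \<in> borel_measurable lebesgue" and t: "0 < t"
  shows "emeasure lebesgue {g. ennreal t < hmax f g}
    \<le> ennreal (3 powr hdim TYPE('n) / t) * (\<integral>\<^sup>+h. f h \<partial>lebesgue)"
proof (rule emeasure_le_compact)
  have "{g \<in> space lebesgue. ennreal t < hmax f g} \<in> sets lebesgue" by measurable
  then show "{g. ennreal t < hmax f g} \<in> sets lebesgue" by simp
  fix K assume K: "compact K" "K \<subseteq> {g. ennreal t < hmax f g}"
  then have "\<forall>x\<in>K. \<exists>k::int. ennreal t < havg f x (2 powr k)"
    by (auto simp: hmax_def less_SUP_iff)
  then obtain k :: "'n heis \<Rightarrow> int" where k: "\<And>x. x \<in> K \<Longrightarrow> ennreal t < havg f x (2 powr k x)" by metis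
  show "emeasure lebesgue K \<le> ennreal (3 powr hdim TYPE('n) / t) * (\<integral>\<^sup>+h. f h \<partial>lebesgue)"
  proof (rule Vitali_estimate[OF K(1), where \<rho>="\<lambda>x. 2 powr k x"])
    fix x assume x: "x \<in> K"
    let ?v = "vol TYPE('n) (2 powr k x)"
    have v: "0 < ?v" by simp
    have "emeasure lebesgue (K \<inter> hball x (3 * 2 powr k x)) \<le> emeasure lebesgue (hball x (3 * 2 powr k x))"
      by (intro emeasure_mono) auto
    also have "\<dots> = ennreal (3 powr hdim TYPE('n)) * ennreal ?v"
      by (rule emeasure_hball_mult) auto
    also have "\<dots> = ennreal (3 powr hdim TYPE('n) / t) * (ennreal ?v * ennreal t)"
      using t v by (simp add: ennreal_mult[symmetric] del: vol_pos)
    also have "\<dots> \<le> ennreal (3 powr hdim TYPE('n) / t) * (ennreal ?v * havg f x (2 powr k x))"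
      using k[OF x] by (intro mult_left_mono) auto
    finally show "emeasure lebesgue (K \<inter> hball x (3 * 2 powr k x))
      \<le> ennreal (3 powr hdim TYPE('n) / t) * (\<integral>\<^sup>+h. f h * indicator (hball x (2 powr k x)) h \<partial>lebesgue)"
      by (simp add: nn_integral_hball_eq_havg)
  qed auto
qed

section \<open>Sums over all integers as integrals for counting measure; geometric series and dyadic
  levels\<close>

abbreviation isum :: "(int \<Rightarrow> ennreal) \<Rightarrow> ennreal" where
  "isum F \<equiv> \<integral>\<^sup>+k. F k \<partial>count_space UNIV"

lemma isum_eq_suminf: "isum F = (\<Sum>n. F (from_nat_into UNIV n))"
  by (subst nn_integral_bij_count_space[OF bij_betw_from_nat_into, symmetric])
     (auto simp: infinite_UNIV_int nn_integral_count_space_nat)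

lemma isum_measurable [measurable]:
  assumes [measurable]: "\<And>k. F k \<in> borel_measurable M"
  shows "(\<lambda>x. isum (\<lambda>k::int. F k x)) \<in> borel_measurable M"
  unfolding isum_eq_suminf by measurable

lemma isum_shift: "isum (\<lambda>k::int. F (k + c)) = isum F"
  by (rule nn_integral_bij_count_space) (auto intro: bij_betwI[where g="\<lambda>k. k - c"])

lemma isum_uminus: "isum (\<lambda>k::int. F (- k)) = isum F"
  by (rule nn_integral_bij_count_space) (auto intro: bij_betwI[where g=uminus])

lemma nn_integral_isum:
  "(\<And>k. F k \<in> borel_measurable M) \<Longrightarrow> (\<integral>\<^sup>+x. isum (\<lambda>k::int. F k x) \<partial>M) = isum (\<lambda>k::int. \<integral>\<^sup>+x. F k x \<partial>M)"
  by (rule nn_integral_count_space_nn_integral) auto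

lemma ennreal_pos_mult_top: "0 < c \<Longrightarrow> ennreal c * top = top"
  by (simp add: ennreal_mult_top)

lemma two_powr_minus_less: "0 < x \<Longrightarrow> 2 powr - x < (1::real)"
  using powr_less_mono[of "- x" 0 "2::real"] by simp

lemma isum_geometric:
  fixes m :: int and \<beta> :: real
  assumes "0 < \<beta>"
  shows "isum (\<lambda>k::int. ennreal (2 powr (\<beta> * k)) * indicator {..m} k) = ennreal (2 powr (\<beta> * m) / (1 - 2 powr - \<beta>))"
proof -
  have "isum (\<lambda>k::int. ennreal (2 powr (\<beta> * k)) * indicator {..m} k)
      = (\<integral>\<^sup>+k. ennreal (2 powr (\<beta> * real_of_int k)) \<partial>count_space {..m})"
    by (simp add: nn_integral_count_space_indicator)
  also have "\<dots> = (\<integral>\<^sup>+n. ennreal (2 powr (\<beta> * (m - int n))) \<partial>count_space UNIV)"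
    by (rule nn_integral_bij_count_space[where g="\<lambda>n. m - int n", symmetric])
       (auto intro: bij_betwI[where g="\<lambda>k. nat (m - k)"])
  also have "\<dots> = (\<Sum>n. ennreal (2 powr (\<beta> * m) * (2 powr - \<beta>) ^ n))"
    unfolding nn_integral_count_space_nat
    by (intro suminf_cong) (simp add: powr_realpow[symmetric] powr_powr powr_add[symmetric] algebra_simps)
  also have "\<dots> = ennreal (2 powr (\<beta> * m) / (1 - 2 powr - \<beta>))"
  proof (rule suminf_ennreal_eq)
    have "(\<lambda>n. (2 powr - \<beta>) ^ n) sums (1 / (1 - 2 powr - \<beta>))"
      using two_powr_minus_less[OF assms] by (intro geometric_sums) simp
    from sums_mult[OF this, of "2 powr (\<beta> * m)"]
    show "(\<lambda>n. 2 powr (\<beta> * m) * (2 powr - \<beta>) ^ n) sums (2 powr (\<beta> * m) / (1 - 2 powr - \<beta>))" by simp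
  qed simp
  finally show ?thesis .
qed

lemma isum_geometric_neg:
  fixes m :: int and \<beta> :: real
  assumes "0 < \<beta>"
  shows "isum (\<lambda>k::int. ennreal (2 powr (- \<beta> * k)) * indicator {m..} k) = ennreal (2 powr (- \<beta> * m) / (1 - 2 powr - \<beta>))"
proof -
  have "isum (\<lambda>k::int. ennreal (2 powr (- \<beta> * k)) * indicator {m..} k)
      = isum (\<lambda>k::int. ennreal (2 powr (- \<beta> * real_of_int (- k))) * indicator {m..} (- k))"
    by (subst isum_uminus[symmetric]) simp
  also have "\<dots> = isum (\<lambda>k::int. ennreal (2 powr (\<beta> * k)) * indicator {..- m} k)"
    by (intro nn_integral_cong) (auto simp: indicator_def)
  finally show ?thesis using isum_geometric[OF assms, of "- m"] by simp
qed

text \<open>The series of the dyadic powers below y is geometric, hence comparable with its largest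
  term, which is at most y^\<beta>.\<close>

lemma isum_geometric_le:
  fixes \<beta> :: real
  assumes "0 < \<beta>"
  shows "isum (\<lambda>k::int. ennreal (2 powr (\<beta> * k)) * indicator {k::int. ennreal (2 powr k) < y} k)
    \<le> ennreal (1 / (1 - 2 powr - \<beta>)) * epowr y \<beta>"
proof -
  have c: "0 < 1 / (1 - 2 powr - \<beta>)" using two_powr_minus_less[OF assms] by simp
  show ?thesis
  proof (cases y rule: ennreal_cases)
    case (real a)
    show ?thesis
    proof (cases "a = 0")
      case True
      then show ?thesis using real by simp
    next
      case False
      then have a: "0 < a" using real by simp
      define m where "m = \<lfloor>log 2 a\<rfloor>"
      have "isum (\<lambda>k::int. ennreal (2 powr (\<beta> * k)) * indicator {k::int. ennreal (2 powr k) < y} k)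
          \<le> isum (\<lambda>k::int. ennreal (2 powr (\<beta> * k)) * indicator {..m} k)"
      proof (intro nn_integral_mono mult_left_mono)
        fix k :: int
        have "k \<le> m" if "2 powr k < a"
          using that a unfolding m_def le_floor_iff by (simp add: le_log_iff)
        then show "indicator {k::int. ennreal (2 powr k) < y} k \<le> (indicator {..m} k :: ennreal)"
          using real by (auto simp: indicator_def ennreal_less_iff)
      qed simp
      also have "\<dots> = ennreal (1 / (1 - 2 powr - \<beta>) * 2 powr (\<beta> * m))"
        by (simp add: isum_geometric assms)
      also have "\<dots> \<le> ennreal (1 / (1 - 2 powr - \<beta>) * a powr \<beta>)"
      proof (intro ennreal_leI mult_left_mono)
        have "2 powr m \<le> a"
          unfolding m_def using a le_log_iff[of 2 a "of_int \<lfloor>log 2 a\<rfloor>"] by simp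
        then have "(2 powr m) powr \<beta> \<le> a powr \<beta>"
          using assms by (intro powr_mono2) auto
        then show "2 powr (\<beta> * m) \<le> a powr \<beta>" by (simp add: powr_powr mult.commute)
      qed (use c in auto)
      finally show ?thesis using real c by (simp add: ennreal_mult[symmetric] less_imp_le)
    qed
  next
    case top
    then show ?thesis using c assms by (simp add: ennreal_mult_top)
  qed
qed

text \<open>A dyadic layer-cake bound: for finite positive y the single term with 2^k < y and y at
  most 2^(k+1) already dominates. For infinite y every term is present and the terms are
  unbounded.\<close>

lemma epowr_le_isum_levels:
  fixes p :: real
  assumes "0 < p"
  shows "epowr y p \<le> isum (\<lambda>k::int. ennreal (2 powr (p * (k + 1))) * indicator {k::int. ennreal (2 powr k) < y} k)"
proof -
  have ge: "ennreal (2 powr (p * (k + 1))) \<le> isum (\<lambda>k::int. ennreal (2 powr (p * (k + 1))) * indicator {k::int. ennreal (2 powr k) < y} k)"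
    if "ennreal (2 powr k) < y" for k :: int
    using nn_integral_ge_point[of k UNIV "\<lambda>k::int. ennreal (2 powr (p * (k + 1))) * indicator {k::int. ennreal (2 powr k) < y} k"] that
    by simp
  show ?thesis
  proof (cases y rule: ennreal_cases)
    case (real a)
    show ?thesis
    proof (cases "a = 0")
      case True
      then show ?thesis using real by simp
    next
      case False
      then have a: "0 < a" using real by simp
      \<comment> \<open>The ceiling minus one makes the lower inequality 2^k < a strict, as
        membership in the level set demands.\<close>
      define k where "k = \<lceil>log 2 a\<rceil> - 1"
      have "of_int k < log 2 a" "log 2 a \<le> of_int (k + 1)"
        by (auto simp: k_def) linarith
      then have k: "2 powr k < a" "a \<le> 2 powr (k + 1)"
        using a by (auto simp: less_log_iff log_le_iff)
      have "epowr y p = ennreal (a powr p)" using real by simp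
      also have "\<dots> \<le> ennreal ((2 powr (k + 1)) powr p)"
        using k a assms by (intro ennreal_leI powr_mono2) auto
      also have "\<dots> = ennreal (2 powr (p * (k + 1)))" by (simp add: powr_powr mult.commute)
      also have "\<dots> \<le> isum (\<lambda>k::int. ennreal (2 powr (p * (k + 1))) * indicator {k::int. ennreal (2 powr k) < y} k)"
        using k real a by (intro ge) (simp add: ennreal_less_iff)
      finally show ?thesis .
    qed
  next
    case top
    have "isum (\<lambda>k::int. ennreal (2 powr (p * (k + 1))) * indicator {k::int. ennreal (2 powr k) < y} k) = top"
    proof (rule ccontr)
      assume "\<not> ?thesis"
      then obtain B where B: "isum (\<lambda>k::int. ennreal (2 powr (p * (k + 1))) * indicator {k::int. ennreal (2 powr k) < y} k) = ennreal B"
        "0 \<le> B"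
        by (meson ennreal_cases)
      define k where "k = \<lceil>log 2 (B + 1) / p\<rceil>"
      have "log 2 (B + 1) / p \<le> of_int k + 1" unfolding k_def by linarith
      then have "log 2 (B + 1) \<le> p * (k + 1)" using assms by (simp add: field_simps)
      then have "B + 1 \<le> 2 powr (p * (k + 1))" using B by (simp add: log_le_iff)
      then show False
        using ge[of k] top B by (simp add: ennreal_less_top)
    qed
    then show ?thesis by simp
  qed
qed

lemma Collect_lebesgue: "Measurable.pred lebesgue P \<Longrightarrow> {x. P x} \<in> sets lebesgue"
  by (simp add: pred_def)

text \<open>Marcinkiewicz interpolation by hand. At level 2^k the part of \<open>f\<close> below
  2^(k-1) contributes at most half the level, so the weak type bound is applied to the part above.
  After exchanging sum and integral, the levels form a geometric series with exponent p - 1, which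
  converges because p > 1.\<close>

lemma hmax_strong_type:
  assumes p: "1 < p"
  shows "\<exists>C>0. \<forall>f \<in> borel_measurable (lebesgue :: 'n::finite heis measure).
    (\<integral>\<^sup>+g. epowr (hmax f g) p \<partial>lebesgue) \<le> ennreal C * (\<integral>\<^sup>+h. epowr (f h) p \<partial>lebesgue)"
proof -
  let ?Q = "hdim TYPE('n)"
  let ?G = "1 / (1 - 2 powr - (p - 1))"
  have G: "0 < ?G" using two_powr_minus_less[of "p - 1"] p by simp
  \<comment> \<open>Obtained from p (k + 1) = 2 p + (p - 1)(k - 1) + (k - 1): the last summand
    cancels the denominator of the weak type bound, the middle one enters the geometric series
    \<open>?G\<close>.\<close>
  let ?A = "3 powr ?Q * 2 powr (2 * p)"
  have "(\<integral>\<^sup>+g. epowr (hmax f g) p \<partial>lebesgue) \<le> ennreal (?A * ?G) * (\<integral>\<^sup>+h. epowr (f h) p \<partial>lebesgue)"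
    if [measurable]: "f \<in> borel_measurable lebesgue" for f :: "'n heis \<Rightarrow> ennreal"
  proof -
    define S where "S k = {h. ennreal (2 powr (real_of_int k - 1)) < f h}" for k :: int
    define E where "E F t = {g. ennreal t < hmax F g}" for F :: "'n heis \<Rightarrow> ennreal" and t
    have S [measurable]: "S k \<in> sets lebesgue" for k
      unfolding S_def by (rule Collect_lebesgue) measurable
    have E [measurable]: "E F t \<in> sets lebesgue" if [measurable]: "F \<in> borel_measurable lebesgue" for t F
      unfolding E_def by (rule Collect_lebesgue) measurable
    have trunc: "emeasure lebesgue (E f (2 powr k))
        \<le> ennreal (3 powr ?Q / 2 powr (real_of_int k - 1)) * (\<integral>\<^sup>+h. f h * indicator (S k) h \<partial>lebesgue)" for k :: int
    proof -
      have "hmax f g \<le> hmax (\<lambda>h. f h * indicator (S k) h) g + ennreal (2 powr (real_of_int k - 1))" for g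
        unfolding hmax_def[of f]
      proof (rule SUP_least)
        fix i :: int
        have "havg f g (2 powr i) \<le> havg (\<lambda>h. f h * indicator (S k) h + ennreal (2 powr (real_of_int k - 1))) g (2 powr i)"
          by (rule havg_mono) (auto simp: S_def indicator_def not_less)
        also have "\<dots> = havg (\<lambda>h. f h * indicator (S k) h) g (2 powr i) + ennreal (2 powr (real_of_int k - 1))"
          by (subst havg_add) (auto simp: havg_const)
        also have "\<dots> \<le> hmax (\<lambda>h. f h * indicator (S k) h) g + ennreal (2 powr (real_of_int k - 1))"
          by (intro add_right_mono havg_le_hmax)
        finally show "havg f g (2 powr i) \<le> hmax (\<lambda>h. f h * indicator (S k) h) g + ennreal (2 powr (real_of_int k - 1))" .
      qed
      moreover have "ennreal (2 powr k) = ennreal (2 powr (real_of_int k - 1)) + ennreal (2 powr (real_of_int k - 1))"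
        by (simp add: powr_diff ennreal_plus[symmetric] del: ennreal_plus)
      ultimately have "E f (2 powr k)
          \<subseteq> E (\<lambda>h. f h * indicator (S k) h) (2 powr (real_of_int k - 1))"
        unfolding E_def by (auto simp: not_less[symmetric]) (meson add_right_mono leD le_less_trans not_less)
      then have "emeasure lebesgue (E f (2 powr k))
          \<le> emeasure lebesgue (E (\<lambda>h. f h * indicator (S k) h) (2 powr (real_of_int k - 1)))"
        by (intro emeasure_mono E) measurable
      also have "\<dots> \<le> ennreal (3 powr ?Q / 2 powr (real_of_int k - 1)) * (\<integral>\<^sup>+h. f h * indicator (S k) h \<partial>lebesgue)"
        unfolding E_def by (rule hmax_weak_type) simp_all
      finally show ?thesis .
    qed
    have "(\<integral>\<^sup>+g. epowr (hmax f g) p \<partial>lebesgue)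
        \<le> (\<integral>\<^sup>+g. isum (\<lambda>k::int. ennreal (2 powr (p * (real_of_int k + 1))) * indicator (E f (2 powr k)) g) \<partial>lebesgue)"
    proof (intro nn_integral_mono)
      fix g
      show "epowr (hmax f g) p \<le> isum (\<lambda>k::int. ennreal (2 powr (p * (real_of_int k + 1))) * indicator (E f (2 powr k)) g)"
        using epowr_le_isum_levels[of p "hmax f g"] p by (simp add: E_def indicator_def)
    qed
    also have "\<dots> = isum (\<lambda>k::int. ennreal (2 powr (p * (real_of_int k + 1))) * emeasure lebesgue (E f (2 powr k)))"
    proof -
      have "(\<integral>\<^sup>+g. isum (\<lambda>k::int. ennreal (2 powr (p * (real_of_int k + 1))) * indicator (E f (2 powr k)) g) \<partial>lebesgue)
        = isum (\<lambda>k::int. \<integral>\<^sup>+g. ennreal (2 powr (p * (real_of_int k + 1))) * indicator (E f (2 powr k)) g \<partial>lebesgue)"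
        by (rule nn_integral_isum) measurable
      also have "\<dots> = isum (\<lambda>k::int. ennreal (2 powr (p * (real_of_int k + 1))) * emeasure lebesgue (E f (2 powr k)))"
        by (intro nn_integral_cong nn_integral_cmult_indicator E) measurable
      finally show ?thesis .
    qed
    also have "\<dots> \<le> isum (\<lambda>k::int. ennreal (2 powr (p * (real_of_int k + 1))) *
        (ennreal (3 powr ?Q / 2 powr (real_of_int k - 1)) * (\<integral>\<^sup>+h. f h * indicator (S k) h \<partial>lebesgue)))"
      by (intro nn_integral_mono mult_left_mono trunc) simp
    also have "\<dots> = isum (\<lambda>k::int. \<integral>\<^sup>+h. ennreal (?A * 2 powr ((p - 1) * (real_of_int k - 1))) * (f h * indicator (S k) h) \<partial>lebesgue)"
    proof (intro nn_integral_cong)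
      fix k :: int
      have "p * (real_of_int k + 1) = 2 * p + (p - 1) * (real_of_int k - 1) + (real_of_int k - 1)" by (simp add: algebra_simps)
      then have "2 powr (p * (real_of_int k + 1)) * (3 powr ?Q / 2 powr (real_of_int k - 1)) = ?A * 2 powr ((p - 1) * (real_of_int k - 1))"
        by (simp add: powr_add)
      then show "ennreal (2 powr (p * (real_of_int k + 1))) *
        (ennreal (3 powr ?Q / 2 powr (real_of_int k - 1)) * (\<integral>\<^sup>+h. f h * indicator (S k) h \<partial>lebesgue))
        = (\<integral>\<^sup>+h. ennreal (?A * 2 powr ((p - 1) * (real_of_int k - 1))) * (f h * indicator (S k) h) \<partial>lebesgue)"
        by (subst nn_integral_cmult) (auto simp: mult.assoc[symmetric] ennreal_mult[symmetric])
    qed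
    also have "\<dots> = (\<integral>\<^sup>+h. isum (\<lambda>k::int. ennreal (?A * 2 powr ((p - 1) * (real_of_int k - 1))) * (f h * indicator (S k) h)) \<partial>lebesgue)"
      by (rule nn_integral_isum[symmetric]) measurable
    also have "\<dots> \<le> (\<integral>\<^sup>+h. ennreal (?A * ?G) * epowr (f h) p \<partial>lebesgue)"
    proof (intro nn_integral_mono)
      fix h
      have "isum (\<lambda>k::int. ennreal (?A * 2 powr ((p - 1) * (real_of_int k - 1))) * (f h * indicator (S k) h))
         = isum (\<lambda>k::int. (ennreal ?A * f h) * (ennreal (2 powr ((p - 1) * (k + - 1))) * indicator {k::int. ennreal (2 powr k) < f h} (k + - 1)))"
        by (intro nn_integral_cong) (auto simp: S_def indicator_def ennreal_mult mult_ac)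
      also have "\<dots> = isum (\<lambda>k::int. (ennreal ?A * f h) * (ennreal (2 powr ((p - 1) * k)) * indicator {k::int. ennreal (2 powr k) < f h} k))"
        using isum_shift[of "\<lambda>k. (ennreal ?A * f h) * (ennreal (2 powr ((p - 1) * k)) * indicator {k::int. ennreal (2 powr k) < f h} k)" "- 1"]
        by simp
      also have "\<dots> = (ennreal ?A * f h) * isum (\<lambda>k::int. ennreal (2 powr ((p - 1) * k)) * indicator {k::int. ennreal (2 powr k) < f h} k)"
        by (rule nn_integral_cmult) simp
      also have "\<dots> \<le> (ennreal ?A * f h) * (ennreal ?G * epowr (f h) (p - 1))"
        using p by (intro mult_left_mono isum_geometric_le) auto
      also have "\<dots> = ennreal (?A * ?G) * epowr (f h) p"
      proof -
        have "ennreal (?A * ?G) = ennreal ?A * ennreal ?G"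
          using less_imp_le[OF G] by (intro ennreal_mult) auto
        then show ?thesis using epowr_add[of 1 "p - 1" "f h"] p by (simp add: mult_ac)
      qed
      finally show "isum (\<lambda>k::int. ennreal (?A * 2 powr ((p - 1) * (real_of_int k - 1))) * (f h * indicator (S k) h))
        \<le> ennreal (?A * ?G) * epowr (f h) p" .
    qed
    also have "\<dots> = ennreal (?A * ?G) * (\<integral>\<^sup>+h. epowr (f h) p \<partial>lebesgue)"
      by (rule nn_integral_cmult) measurable
    finally show ?thesis .
  qed
  moreover have "0 < ?A * ?G" using G by (intro mult_pos_pos) auto
  ultimately show ?thesis by blast
qed

lemma nn_integral_hball_Hoelder:
  fixes g :: "'n::finite heis"
  assumes [measurable]: "f \<in> borel_measurable lebesgue" and "1 < \<sigma>" and r: "0 < r"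
  shows "(\<integral>\<^sup>+h. f h * indicator (hball g r) h \<partial>lebesgue)
    \<le> epowr (\<integral>\<^sup>+h. epowr (f h) \<sigma> * indicator (hball g r) h \<partial>lebesgue) (1 / \<sigma>) * ennreal (vol TYPE('n) r powr (1 - 1 / \<sigma>))"
proof -
  define \<sigma>' where "\<sigma>' = \<sigma> / (\<sigma> - 1)"
  have \<sigma>': "1 < \<sigma>'" "1 / \<sigma> + 1 / \<sigma>' = 1" using assms by (auto simp: \<sigma>'_def field_simps)
  have "(\<integral>\<^sup>+h. f h * indicator (hball g r) h \<partial>lebesgue)
      = (\<integral>\<^sup>+h. (f h * indicator (hball g r) h) * indicator (hball g r) h \<partial>lebesgue)"
    by (intro nn_integral_cong) (auto simp: indicator_def)
  also have "\<dots> \<le> eLp \<sigma> lebesgue (\<lambda>h. f h * indicator (hball g r) h) * eLp \<sigma>' lebesgue (indicator (hball g r))"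
    by (rule Hoelder_eLp) (use assms \<sigma>' in \<open>auto intro: hball_lebesgue\<close>)
  also have "eLp \<sigma> lebesgue (\<lambda>h. f h * indicator (hball g r) h)
      = epowr (\<integral>\<^sup>+h. epowr (f h) \<sigma> * indicator (hball g r) h \<partial>lebesgue) (1 / \<sigma>)"
    unfolding eLp_def by (intro arg_cong[where f="\<lambda>x. epowr x (1 / \<sigma>)"] nn_integral_cong) (auto simp: indicator_def)
  also have "eLp \<sigma>' lebesgue (indicator (hball g r)) = ennreal (vol TYPE('n) r powr (1 - 1 / \<sigma>))"
  proof -
    have "(\<integral>\<^sup>+h. epowr (indicator (hball g r) h) \<sigma>' \<partial>lebesgue) = (\<integral>\<^sup>+h. indicator (hball g r) h \<partial>lebesgue)"
      by (intro nn_integral_cong) (auto simp: indicator_def)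
    also have "\<dots> = ennreal (vol TYPE('n) r)"
      using emeasure_hball_vol[OF r, of g] hball_lebesgue[of g r] by simp
    finally have eq: "(\<integral>\<^sup>+h. epowr (indicator (hball g r) h) \<sigma>' \<partial>lebesgue) = ennreal (vol TYPE('n) r)" .
    show ?thesis
    proof -
      have "1 / \<sigma>' = 1 - 1 / \<sigma>" using \<sigma>'(2) by simp
      then show ?thesis
        unfolding eLp_def eq
        using vol_pos[OF r, where 'n='n] by (simp add: less_imp_le)
    qed
  qed
  finally show ?thesis .
qed

lemma havg_Hoelder:
  fixes g :: "'n::finite heis"
  assumes [measurable]: "f \<in> borel_measurable lebesgue" and \<sigma>: "1 < \<sigma>" and r: "0 < r"
  shows "havg f g r \<le> epowr (havg (\<lambda>h. epowr (f h) \<sigma>) g r) (1 / \<sigma>)"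
proof -
  let ?v = "vol TYPE('n) r" and ?I = "\<integral>\<^sup>+h. epowr (f h) \<sigma> * indicator (hball g r) h \<partial>lebesgue"
  have v: "0 < ?v" using r by simp
  have "havg f g r \<le> ennreal (1 / ?v) * (epowr ?I (1 / \<sigma>) * ennreal (?v powr (1 - 1 / \<sigma>)))"
    unfolding havg_def by (intro mult_left_mono nn_integral_hball_Hoelder assms) simp
  also have "\<dots> = ennreal (1 / ?v * ?v powr (1 - 1 / \<sigma>)) * epowr ?I (1 / \<sigma>)"
    using v by (simp add: ennreal_mult[of "1 / ?v" "?v powr (1 - 1 / \<sigma>)"] mult_ac del: times_divide_eq_left times_divide_eq_right)
  also have "1 / ?v * ?v powr (1 - 1 / \<sigma>) = (1 / ?v) powr (1 / \<sigma>)"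
    using v by (simp add: powr_diff powr_divide)
  also have "ennreal ((1 / ?v) powr (1 / \<sigma>)) * epowr ?I (1 / \<sigma>) = epowr (havg (\<lambda>h. epowr (f h) \<sigma>) g r) (1 / \<sigma>)"
    unfolding havg_def epowr_mult using v by (simp add: epowr_ennreal)
  finally show ?thesis .
qed

section \<open>Hedberg's inequality for sums of averages\<close>

text \<open>For \<open>s = 1\<close> this is comparable with the fractional integral of order
  \<alpha>, decomposed into dyadic scales. Power means with \<open>s > 1\<close> leave room for
  Hoelder's inequality against the oscillation of \<open>b\<close>.\<close>

definition hed :: "real \<Rightarrow> real \<Rightarrow> ('n::finite heis \<Rightarrow> ennreal) \<Rightarrow> 'n heis \<Rightarrow> ennreal" where
  "hed \<alpha> s f g = isum (\<lambda>k::int. ennreal (2 powr (\<alpha> * k)) * epowr (havg (\<lambda>h. epowr (f h) s) g (2 powr k)) (1 / s))"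

lemma hed_measurable [measurable]:
  "f \<in> borel_measurable lebesgue \<Longrightarrow> hed \<alpha> s f \<in> borel_measurable lebesgue"
  unfolding hed_def[abs_def] by measurable

text \<open>Hedberg's argument: at small scales each power mean is bounded by the maximal function,
  at large scales by the L_p norm with decay 2^(-k Q/p). Both resulting series are geometric, one
  increasing and one decreasing, and they are cut where they balance.\<close>

lemma hed_pointwise:
  fixes f :: "'n::finite heis \<Rightarrow> ennreal"
  assumes s: "1 \<le> s" "s < p" and \<alpha>: "0 < \<alpha>" "\<alpha> < hdim TYPE('n) / p" and q: "1 / q = 1 / p - \<alpha> / hdim TYPE('n)"
    and [measurable]: "f \<in> borel_measurable lebesgue"
    and F: "eLp p lebesgue f = ennreal F" "0 < F"
  shows "hed \<alpha> s f g \<le> ennreal ((1 / (1 - 2 powr - \<alpha>)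
        + unit_vol TYPE('n) powr (- 1 / p) / (1 - 2 powr - (hdim TYPE('n) / p - \<alpha>))) * F powr (1 - p / q))
      * epowr (hmax (\<lambda>h. epowr (f h) s) g) (p / (q * s))"
    (is "_ \<le> ennreal ((?c1 + ?V powr (- 1 / p) / ?c2) * _) * _")
proof -
  let ?Q = "hdim TYPE('n)"
  define \<beta> where "\<beta> = ?Q / p - \<alpha>"
  have p: "0 < p" "0 < s" and \<beta>: "0 < \<beta>" using s \<alpha> by (auto simp: \<beta>_def)
  have qp: "p / q = 1 - p * \<alpha> / ?Q"
    using arg_cong[OF q, of "\<lambda>x. p * x"] p by (simp add: right_diff_distrib)
  have c: "0 < ?c1" "0 < ?c2"
    using two_powr_minus_less[OF \<alpha>(1)] two_powr_minus_less[OF \<beta>] by (simp_all add: \<beta>_def)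
  have cc: "0 < (?c1 + ?V powr (- 1 / p) / ?c2) * F powr (1 - p / q)"
    using c F by (intro mult_pos_pos add_pos_nonneg) auto
  let ?A = "\<lambda>r. epowr (havg (\<lambda>h. epowr (f h) s) g r) (1 / s)"
  have A2: "?A (2 powr k) \<le> ennreal (2 powr (- (?Q / p) * k) * (?V powr (- 1 / p) * F))" for k :: int
  proof -
    let ?r = "2 powr real_of_int k"
    have "havg (\<lambda>h. epowr (f h) s) g ?r \<le> epowr (havg (\<lambda>h. epowr (f h) p) g ?r) (s / p)"
      using havg_Hoelder[of "\<lambda>h. epowr (f h) s" "p / s" ?r g] s p by (simp add: epowr_epowr)
    also have "havg (\<lambda>h. epowr (f h) p) g ?r \<le> ennreal (1 / vol TYPE('n) ?r) * epowr (eLp p lebesgue f) p"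
      unfolding havg_def epowr_eLp[OF p(1)]
      by (intro mult_left_mono nn_integral_mono) (auto simp: indicator_def)
    finally have "?A ?r \<le> epowr (epowr (ennreal (1 / vol TYPE('n) ?r) * epowr (eLp p lebesgue f) p) (s / p)) (1 / s)"
      using p by (simp add: epowr_mono)
    also have "\<dots> = ennreal ((1 / vol TYPE('n) ?r) powr (1 / p) * F)"
      using p F vol_pos[of ?r, where 'n='n] by (simp add: epowr_epowr epowr_mult powr_powr ennreal_mult less_imp_le del: vol_pos)
    also have "(1 / vol TYPE('n) ?r) powr (1 / p) = 2 powr (- (?Q / p) * k) * ?V powr (- 1 / p)"
      using unit_vol_pos[where 'n='n]
      by (simp add: vol_def powr_divide powr_mult powr_powr powr_minus divide_simps mult.commute)
    finally show ?thesis by (simp add: mult_ac)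
  qed
  show ?thesis
  proof (cases "hmax (\<lambda>h. epowr (f h) s) g" rule: ennreal_cases)
    case top
    then show ?thesis unfolding top epowr_top ennreal_pos_mult_top[OF cc] by simp
  next
    case (real b)
    define a where "a = b powr (1 / s)"
    have A1: "?A (2 powr k) \<le> ennreal a" for k :: int
      using epowr_mono[OF _ havg_le_hmax[of "\<lambda>h. epowr (f h) s" g k], of "1 / s"] p real by (simp add: a_def)
    have apq: "epowr (hmax (\<lambda>h. epowr (f h) s) g) (p / (q * s)) = ennreal (a powr (p / q))"
      using real by (simp add: a_def powr_powr mult.commute)
    show ?thesis
    proof (cases "b = 0")
      case True
      then have "?A (2 powr k) = 0" for k :: int using A1[of k] by (simp add: a_def)
      then show ?thesis by (simp add: hed_def)
    next
      case False
      then have a: "0 < a" using real by (simp add: a_def)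
      \<comment> \<open>This radius satisfies R^(Q/p) = F / a, so the two bounds a R^\<alpha> and F
        R^(\<alpha> - Q/p) agree. Their common value is F^(1 - p/q) a^(p/q). The cut is made at the
        dyadic exponent \<open>m\<close> below it.\<close>
      define R where "R = (F / a) powr (p / ?Q)"
      define m where "m = \<lfloor>log 2 R\<rfloor>"
      have R: "0 < R" using a F by (simp add: R_def)
      have "of_int m \<le> log 2 R" "log 2 R \<le> of_int (m + 1)" unfolding m_def by linarith+
      then have m: "2 powr m \<le> R" "R \<le> 2 powr (m + 1)"
        using R by (auto simp: le_log_iff log_le_iff)
      have "hed \<alpha> s f g \<le> isum (\<lambda>k. ennreal (2 powr (\<alpha> * k)) * indicator {..m} k * ennreal a
          + ennreal (2 powr (- \<beta> * k)) * indicator {m + 1..} k * ennreal (?V powr (- 1 / p) * F))"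
        unfolding hed_def
      proof (intro nn_integral_mono)
        fix k :: int
        show "ennreal (2 powr (\<alpha> * k)) * ?A (2 powr k)
          \<le> ennreal (2 powr (\<alpha> * k)) * indicator {..m} k * ennreal a
          + ennreal (2 powr (- \<beta> * k)) * indicator {m + 1..} k * ennreal (?V powr (- 1 / p) * F)"
        proof (cases "k \<le> m")
          case True
          then show ?thesis using A1[of k] by (simp add: mult_left_mono)
        next
          case False
          have "ennreal (2 powr (\<alpha> * k)) * ?A (2 powr k)
            \<le> ennreal (2 powr (\<alpha> * k)) * ennreal (2 powr (- (?Q / p) * k) * (?V powr (- 1 / p) * F))"
            by (intro mult_left_mono A2) simp
          also have "\<dots> = ennreal (2 powr (\<alpha> * k) * 2 powr (- (?Q / p) * k)) * ennreal (?V powr (- 1 / p) * F)"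
            using F by (simp add: ennreal_mult[symmetric] mult_ac)
          also have "2 powr (\<alpha> * k) * 2 powr (- (?Q / p) * k) = 2 powr (- \<beta> * k)"
            by (simp add: powr_add[symmetric] \<beta>_def algebra_simps)
          finally show ?thesis using False by simp
        qed
      qed
      also have "\<dots> = ennreal (2 powr (\<alpha> * m) * ?c1) * ennreal a
         + ennreal (2 powr (- \<beta> * (m + 1)) / ?c2) * ennreal (?V powr (- 1 / p) * F)"
        using isum_geometric[OF \<alpha>(1), of m] isum_geometric_neg[OF \<beta>, of "m + 1"]
        by (simp add: nn_integral_add nn_integral_multc \<beta>_def del: of_int_add)
      also have "\<dots> = ennreal (2 powr (\<alpha> * m) * a * ?c1 + (2 powr (- \<beta> * (m + 1)) * F) * (?V powr (- 1 / p) / ?c2))"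
        using a F c by (simp add: ennreal_mult[symmetric] ennreal_plus[symmetric] mult_ac del: ennreal_plus of_int_add)
      also have "\<dots> \<le> ennreal (F powr (1 - p / q) * a powr (p / q) * ?c1 + F powr (1 - p / q) * a powr (p / q) * (?V powr (- 1 / p) / ?c2))"
      proof (intro ennreal_leI add_mono mult_right_mono)
        have "2 powr (\<alpha> * m) = (2 powr m) powr \<alpha>" by (simp add: powr_powr mult.commute)
        also have "\<dots> \<le> R powr \<alpha>" using m \<alpha> by (intro powr_mono2) auto
        also have "\<dots> = (F / a) powr (1 - p / q)" unfolding R_def powr_powr qp by simp
        finally have "2 powr (\<alpha> * m) * a \<le> (F / a) powr (1 - p / q) * a"
          using a by simp
        also have "\<dots> = F powr (1 - p / q) * a powr (p / q)"
          using a F by (simp add: powr_divide powr_diff)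
        finally show "2 powr (\<alpha> * m) * a \<le> F powr (1 - p / q) * a powr (p / q)" .
        have "2 powr (- \<beta> * (m + 1)) = (2 powr (m + 1)) powr (- \<beta>)" by (simp add: powr_powr mult.commute)
        also have "\<dots> \<le> R powr (- \<beta>)" using m \<beta> R by (intro powr_mono2') auto
        also have "\<dots> = (F / a) powr (- (p / q))"
        proof -
          have "p / ?Q * \<beta> = p / q"
            unfolding qp using p less_imp_neq[OF hdim_pos[where 'n='n]] by (simp add: \<beta>_def right_diff_distrib)
          then show ?thesis unfolding R_def powr_powr by simp
        qed
        finally have "2 powr (- \<beta> * (m + 1)) * F \<le> (F / a) powr (- (p / q)) * F"
          using F by simp
        also have "\<dots> = F powr (1 - p / q) * a powr (p / q)"
          using a F by (simp add: powr_divide powr_diff powr_minus field_simps)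
        finally show "2 powr (- \<beta> * (m + 1)) * F \<le> F powr (1 - p / q) * a powr (p / q)" .
      qed (use c in auto)
      also have "\<dots> = ennreal ((?c1 + ?V powr (- 1 / p) / ?c2) * F powr (1 - p / q)) * ennreal (a powr (p / q))"
        using cc by (simp add: ennreal_mult[symmetric] algebra_simps)
      finally show ?thesis unfolding apq .
    qed
  qed
qed

text \<open>The q-th power of the pointwise bound contains the maximal function of f^s to the power
  p / s > 1, so the maximal theorem returns the p-th power of the norm of \<open>f\<close>. The
  exponents 1 - p/q and p/q of that norm add up to 1.\<close>

lemma hed_bounded:
  assumes s: "1 \<le> s" "s < p" and \<alpha>: "0 < \<alpha>" "\<alpha> < hdim TYPE('n::finite) / p" and q: "1 / q = 1 / p - \<alpha> / hdim TYPE('n)"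
  shows "\<exists>C>0. \<forall>f \<in> borel_measurable (lebesgue :: 'n heis measure).
    eLp q lebesgue (hed \<alpha> s f) \<le> ennreal C * eLp p lebesgue f"
proof -
  let ?Q = "hdim TYPE('n)"
  have p: "0 < p" "0 < s" "1 < p / s" using s by auto
  have "\<alpha> / ?Q < 1 / p" using \<alpha> p hdim_pos[where 'n='n] by (simp add: field_simps)
  then have q0: "0 < q" using q zero_less_divide_1_iff[of q] by simp
  obtain M where M: "0 < M" "\<And>f. f \<in> borel_measurable (lebesgue :: 'n heis measure) \<Longrightarrow>
      (\<integral>\<^sup>+g. epowr (hmax f g) (p / s) \<partial>lebesgue) \<le> ennreal M * (\<integral>\<^sup>+h. epowr (f h) (p / s) \<partial>lebesgue)"
    using hmax_strong_type[OF p(3), where 'n='n] by blast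
  define c where "c = 1 / (1 - 2 powr - \<alpha>) + unit_vol TYPE('n) powr (- 1 / p) / (1 - 2 powr - (?Q / p - \<alpha>))"
  have c: "0 < c"
    using two_powr_minus_less[of \<alpha>] two_powr_minus_less[of "?Q / p - \<alpha>"] \<alpha>
    unfolding c_def by (intro add_pos_nonneg divide_nonneg_nonneg) auto
  define C where "C = c * M powr (1 / q)"
  have "eLp q lebesgue (hed \<alpha> s f) \<le> ennreal C * eLp p lebesgue f"
    if [measurable]: "f \<in> borel_measurable lebesgue" for f :: "'n heis \<Rightarrow> ennreal"
  proof -
    consider "eLp p lebesgue f = top" | "eLp p lebesgue f = 0" | F where "eLp p lebesgue f = ennreal F" "0 < F"
      by (cases "eLp p lebesgue f" rule: ennreal_cases) (auto simp: less_le)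
    then show ?thesis
    proof cases
      case 1
      then show ?thesis using c M by (simp add: C_def ennreal_mult_top)
    next
      case 2
      then have "AE h in lebesgue. f h = 0"
        by (simp add: eLp_def nn_integral_0_iff_AE)
      then have "(\<integral>\<^sup>+h. epowr (f h) s * indicator (hball g r) h \<partial>lebesgue) = (\<integral>\<^sup>+h. 0 \<partial>(lebesgue :: 'n heis measure))" for g r
        by (intro nn_integral_cong_AE) (auto elim: eventually_mono)
      then have "hed \<alpha> s f g = 0" for g
        by (simp add: hed_def havg_def)
      then show ?thesis by (simp add: eLp_def)
    next
      case (3 F)
      let ?c = "c * F powr (1 - p / q)"
      have "(\<integral>\<^sup>+g. epowr (hed \<alpha> s f g) q \<partial>lebesgue)
        \<le> (\<integral>\<^sup>+g. epowr (ennreal ?c) q * epowr (hmax (\<lambda>h. epowr (f h) s) g) (p / s) \<partial>lebesgue)"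
      proof (intro nn_integral_mono)
        fix g
        have "epowr (hed \<alpha> s f g) q \<le> epowr (ennreal ?c * epowr (hmax (\<lambda>h. epowr (f h) s) g) (p / (q * s))) q"
          unfolding c_def using q0 by (intro epowr_mono hed_pointwise assms 3) auto
        then show "epowr (hed \<alpha> s f g) q \<le> epowr (ennreal ?c) q * epowr (hmax (\<lambda>h. epowr (f h) s) g) (p / s)"
          using q0 by (simp add: epowr_mult epowr_epowr)
      qed
      also have "\<dots> = epowr (ennreal ?c) q * (\<integral>\<^sup>+g. epowr (hmax (\<lambda>h. epowr (f h) s) g) (p / s) \<partial>lebesgue)"
        by (rule nn_integral_cmult) measurable
      also have "\<dots> \<le> epowr (ennreal ?c) q * (ennreal M * (\<integral>\<^sup>+h. epowr (epowr (f h) s) (p / s) \<partial>lebesgue))"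
        by (intro mult_left_mono M) measurable
      also have "(\<integral>\<^sup>+h. epowr (epowr (f h) s) (p / s) \<partial>lebesgue) = epowr (ennreal F) p"
        using p epowr_eLp[of p lebesgue f] 3 by (simp add: epowr_epowr)
      finally have "eLp q lebesgue (hed \<alpha> s f) \<le> epowr (epowr (ennreal ?c) q * (ennreal M * epowr (ennreal F) p)) (1 / q)"
        unfolding eLp_def using q0 by (intro epowr_mono) auto
      also have "\<dots> = ennreal (?c * (M powr (1 / q) * F powr (p / q)))"
        using q0 c M 3 by (simp add: epowr_mult epowr_epowr powr_powr ennreal_mult)
      also have "?c * (M powr (1 / q) * F powr (p / q)) = C * F"
        using 3 by (simp add: C_def powr_diff)
      finally show ?thesis using 3 c M by (simp add: ennreal_mult C_def)
    qed
  qed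
  moreover have "0 < C" using c M by (simp add: C_def)
  ultimately show ?thesis by blast
qed

section \<open>Functions of bounded mean oscillation\<close>

lemma Lp_loc_measurable: "f \<in> Lp_loc p \<Longrightarrow> f \<in> borel_measurable lebesgue"
  by (simp add: Lp_loc_def)

lemma set_integrable_hball:
  fixes b :: "'n::finite heis \<Rightarrow> real"
  assumes "b \<in> Lp_loc 1" shows "set_integrable lebesgue (hball g r) b"
proof -
  have [measurable]: "b \<in> borel_measurable lebesgue" using assms by (rule Lp_loc_measurable)
  have "set_integrable lebesgue (closure (hball g r)) (\<lambda>x. \<bar>b x\<bar> powr 1)"
    using assms by (simp add: Lp_loc_def)
  then have "set_integrable lebesgue (hball g r) (\<lambda>x. \<bar>b x\<bar> powr 1)"
    by (rule set_integrable_subset) (auto simp: hball_lebesgue closure_subset)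
  then have "set_integrable lebesgue (hball g r) (\<lambda>x. \<bar>b x\<bar>)"
    by simp
  then show ?thesis
    by (rule set_integrable_abs_iff[THEN iffD1, rotated]) (simp add: set_borel_measurable_def hball_lebesgue)
qed

definition bosc :: "('n::finite heis \<Rightarrow> real) \<Rightarrow> 'n heis \<Rightarrow> real \<Rightarrow> 'n heis \<Rightarrow> real" where
  "bosc b g r h = \<bar>b h - ball_avg b g r\<bar>"

lemma bosc_nonneg [simp]: "0 \<le> bosc b g r h"
  by (simp add: bosc_def)

lemma bosc_measurable [measurable]:
  "b \<in> borel_measurable lebesgue \<Longrightarrow> bosc b g r \<in> borel_measurable lebesgue"
  unfolding bosc_def[abs_def] by (intro borel_measurable_abs borel_measurable_diff) simp_all

lemma set_nn_integral_eq_set_integral: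
  fixes f :: "'a \<Rightarrow> real"
  assumes "set_integrable M A f" "\<And>x. 0 \<le> f x"
  shows "(\<integral>\<^sup>+x. ennreal (f x) * indicator A x \<partial>M) = ennreal (LINT x:A|M. f x)"
proof -
  have "(\<integral>\<^sup>+x. ennreal (f x) * indicator A x \<partial>M) = (\<integral>\<^sup>+x. ennreal (indicator A x *\<^sub>R f x) \<partial>M)"
    by (intro nn_integral_cong) (auto simp: indicator_def)
  also have "\<dots> = ennreal (LINT x:A|M. f x)"
    using assms unfolding set_integrable_def set_lebesgue_integral_def
    by (intro nn_integral_eq_integral) auto
  finally show ?thesis .
qed

lemma set_integrable_hball_const: "set_integrable lebesgue (hball g r) (\<lambda>x. c :: real)"
  using emeasure_hball_finite[of g r]
  by (simp add: set_integrable_def hball_lebesgue integrable_mult_left_iff less_top[symmetric]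
      del: emeasure_hball_finite)

lemma ennreal_le_suminf: "F j \<le> (\<Sum>j. F j :: ennreal)"
  using sum_le_suminf[of F "{j}"] by simp

text \<open>\<open>N\<close> is any positive bound for the BMO norm. The stopping level in the
  John-Nirenberg argument is a multiple of \<open>N\<close> and is divided by, so it must not
  vanish.\<close>

context
  fixes b :: "'n::finite heis \<Rightarrow> real" and N :: real
  assumes b: "b \<in> Lp_loc 1" and bN: "bmo_norm b \<le> ennreal N" and N: "0 < N"
begin

lemma b_measurable: "b \<in> borel_measurable lebesgue"
  using b by (rule Lp_loc_measurable)

lemma bmo_nn_integral_le:
  assumes r: "0 < r"
  shows "(\<integral>\<^sup>+h. ennreal (bosc b g r h) * indicator (hball g r) h \<partial>lebesgue) \<le> ennreal (N * vol TYPE('n) r)"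
proof -
  let ?I = "LINT h:hball g r|lebesgue. bosc b g r h" and ?v = "vol TYPE('n) r"
  have v: "0 < ?v" using r by simp
  have i: "set_integrable lebesgue (hball g r) (bosc b g r)"
    unfolding bosc_def
    by (intro set_integrable_abs set_integral_diff(1) set_integrable_hball b set_integrable_hball_const)
  have "ennreal (1 / measure lebesgue (hball g r) * ?I) \<le> bmo_norm b"
    unfolding bmo_norm_def bosc_def using r by (intro SUP_upper2[of g] SUP_upper2[of r]) auto
  with bN have "ennreal (1 / ?v * ?I) \<le> ennreal N"
    by (simp add: measure_hball_vol[OF r])
  then have "1 / ?v * ?I \<le> N" using N by (simp add: ennreal_le_iff)
  then have "?I \<le> N * ?v" using v by (simp add: field_simps)
  then show ?thesis
    using i by (subst set_nn_integral_eq_set_integral) (auto intro: ennreal_leI)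
qed

lemma ball_avg_diff_le:
  assumes r: "0 < r"
  shows "ennreal (\<bar>ball_avg b g r - c\<bar> * vol TYPE('n) r) \<le> (\<integral>\<^sup>+h. ennreal \<bar>b h - c\<bar> * indicator (hball g r) h \<partial>lebesgue)"
proof -
  let ?v = "vol TYPE('n) r"
  have v: "0 < ?v" using r by simp
  have bi: "set_integrable lebesgue (hball g r) b" and ci: "set_integrable lebesgue (hball g r) (\<lambda>h. c)"
    by (rule set_integrable_hball[OF b], rule set_integrable_hball_const)
  have "(LINT h:hball g r|lebesgue. c) = c * ?v"
    using measure_hball_vol[OF r, of g] emeasure_hball_finite[of g r]
    by (simp add: set_integral_const hball_lebesgue less_top[symmetric] mult.commute del: emeasure_hball_finite)
  then have "ball_avg b g r - c = 1 / ?v * (LINT h:hball g r|lebesgue. b h - c)"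
    using v set_integral_diff(2)[OF bi ci]
    by (simp add: ball_avg_def measure_hball_vol[OF r] field_simps)
  then have "\<bar>ball_avg b g r - c\<bar> * ?v = \<bar>LINT h:hball g r|lebesgue. b h - c\<bar>"
    using v by (simp add: abs_mult)
  also have "\<dots> \<le> (LINT h:hball g r|lebesgue. \<bar>b h - c\<bar>)"
    using set_integral_norm_bound[OF set_integral_diff(1)[OF bi ci]] by simp
  finally show ?thesis
    using set_integral_diff(1)[OF bi ci]
    by (subst set_nn_integral_eq_set_integral) (auto intro!: ennreal_leI set_integrable_abs)
qed

text \<open>The two averages differ by at most the mean over the small ball of the oscillation on
  the large one; enlarging the domain of integration costs the ratio of the volumes.\<close>

lemma ball_avg_nested:
  assumes r: "0 < r'" "0 < r" and sub: "hball g' r' \<subseteq> hball g r"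
  shows "\<bar>ball_avg b g' r' - ball_avg b g r\<bar> \<le> (r / r') powr hdim TYPE('n) * N"
proof -
  have v: "0 < vol TYPE('n) r'" using r by simp
  have "ennreal (\<bar>ball_avg b g' r' - ball_avg b g r\<bar> * vol TYPE('n) r')
      \<le> (\<integral>\<^sup>+h. ennreal (bosc b g r h) * indicator (hball g' r') h \<partial>lebesgue)"
    unfolding bosc_def by (rule ball_avg_diff_le[OF r(1)])
  also have "\<dots> \<le> (\<integral>\<^sup>+h. ennreal (bosc b g r h) * indicator (hball g r) h \<partial>lebesgue)"
    using sub by (intro nn_integral_mono mult_left_mono) (auto simp: indicator_def)
  also have "\<dots> \<le> ennreal (N * vol TYPE('n) r)" by (rule bmo_nn_integral_le[OF r(2)])
  finally have "\<bar>ball_avg b g' r' - ball_avg b g r\<bar> * vol TYPE('n) r' \<le> N * vol TYPE('n) r"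
    using N r by (simp add: ennreal_le_iff less_imp_le)
  also have "vol TYPE('n) r = (r / r') powr hdim TYPE('n) * vol TYPE('n) r'"
    using vol_mult[of "r / r'" r', where 'n='n] r by simp
  finally show ?thesis using v by (simp add: mult.assoc[symmetric] mult.commute[of N])
qed

text \<open>Around almost every point of the superlevel set some ball \<open>B(x, 3^-j r)\<close> carries a large average of
  \<open>\<bar>b - b_B\<bar>\<close>, by density. Taking the largest such ball keeps the average over its triple small, so the
  assumed bound for all balls applies to the triples, whose total volume the Vitali covering makes small.\<close>

lemma John_Nirenberg_step:
  assumes t: "0 \<le> t" and \<theta>: "0 \<le> \<theta>"
    and IH: "\<And>g r. 0 < r \<Longrightarrow> emeasure lebesgue {x \<in> hball g r. t < bosc b g r x} \<le> ennreal (\<theta> * vol TYPE('n) r)"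
    and r: "0 < r"
  shows "emeasure lebesgue {x \<in> hball g r. t + 8 * 6 powr hdim TYPE('n) * (1 + 2 powr hdim TYPE('n)) * N < bosc b g r x}
     \<le> ennreal (\<theta> / 2 * vol TYPE('n) r)"
proof -
  note b_measurable [measurable]
  let ?Q = "hdim TYPE('n)"
  \<comment> \<open>The stopping level. It exceeds (1 + 2^Q) 2^Q N, the bound on the integral of
    \<open>f\<close> divided by the volume of a ball of radius r. The factor 2 * 6^Q = 2 * 3^Q * 2^Q
    makes the final proportion exactly 1/2 after the loss 3^Q of the covering.\<close>
  define \<kappa> where "\<kappa> = 2 * 6 powr ?Q * (1 + 2 powr ?Q) * N"
  have \<kappa>: "0 < \<kappa>" unfolding \<kappa>_def using N by (intro mult_pos_pos) (auto intro: add_pos_pos)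
  \<comment> \<open>Four multiples of the level: density above 1/2 still leaves averages above 2
    \<kappa>, and replacing the average over B(g, r) by the one over a triple costs one
    \<kappa>.\<close>
  define E where "E = {x \<in> hball g r. t + 4 * \<kappa> < bosc b g r x}"
  have E_meas [measurable]: "E \<in> sets lebesgue"
    unfolding E_def by (rule Collect_lebesgue) (use hball_lebesgue[of g r] in measurable)
  \<comment> \<open>Every ball of radius at most r about a point of B(g, r) lies in B(g,
    2r).\<close>
  define f where "f h = ennreal (bosc b g r h) * indicator (hball g (2 * r)) h" for h
  have f_meas [measurable]: "f \<in> borel_measurable lebesgue"
    unfolding f_def using hball_lebesgue[of g "2 * r"] by measurable
  have f_int: "(\<integral>\<^sup>+h. f h \<partial>lebesgue) \<le> ennreal ((1 + 2 powr ?Q) * N * 2 powr ?Q * vol TYPE('n) r)"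
  proof -
    have d: "\<bar>ball_avg b g r - ball_avg b g (2 * r)\<bar> \<le> 2 powr ?Q * N"
      using ball_avg_nested[of r "2 * r" g g] r hball_mono[of g g r "2 * r"] by simp
    have "(\<integral>\<^sup>+h. f h \<partial>lebesgue)
        \<le> (\<integral>\<^sup>+h. ennreal (bosc b g (2 * r) h) * indicator (hball g (2 * r)) h
            + ennreal (2 powr ?Q * N) * indicator (hball g (2 * r)) h \<partial>lebesgue)"
    proof (intro nn_integral_mono)
      fix h
      have "bosc b g r h \<le> bosc b g (2 * r) h + 2 powr ?Q * N"
        using d unfolding bosc_def by linarith
      then have "ennreal (bosc b g r h) \<le> ennreal (bosc b g (2 * r) h) + ennreal (2 powr ?Q * N)"
        using N by (simp add: ennreal_plus[symmetric] ennreal_leI del: ennreal_plus)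
      then show "f h \<le> ennreal (bosc b g (2 * r) h) * indicator (hball g (2 * r)) h
            + ennreal (2 powr ?Q * N) * indicator (hball g (2 * r)) h"
        unfolding f_def by (auto simp: indicator_def)
    qed
    also have "\<dots> = (\<integral>\<^sup>+h. ennreal (bosc b g (2 * r) h) * indicator (hball g (2 * r)) h \<partial>lebesgue)
        + ennreal (2 powr ?Q * N) * emeasure lebesgue (hball g (2 * r))"
      using hball_lebesgue[of g "2 * r"] by (subst nn_integral_add) (auto simp: nn_integral_cmult_indicator)
    also have "\<dots> \<le> ennreal (N * vol TYPE('n) (2 * r)) + ennreal (2 powr ?Q * N) * ennreal (vol TYPE('n) (2 * r))"
      using r by (intro add_mono bmo_nn_integral_le) (auto simp: emeasure_hball_vol)
    also have "\<dots> = ennreal (N * vol TYPE('n) (2 * r) + 2 powr ?Q * N * vol TYPE('n) (2 * r))"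
      using N r by (simp add: ennreal_mult[symmetric] ennreal_plus[symmetric] less_imp_le del: ennreal_plus)
    also have "N * vol TYPE('n) (2 * r) + 2 powr ?Q * N * vol TYPE('n) (2 * r)
       = (1 + 2 powr ?Q) * N * 2 powr ?Q * vol TYPE('n) r"
      using vol_mult[of 2 r, where 'n='n] r by (simp add: algebra_simps)
    finally show ?thesis .
  qed
  define P where "P x j \<longleftrightarrow> ennreal (\<kappa> * vol TYPE('n) (r / 3 ^ j)) < (\<integral>\<^sup>+h. ennreal (bosc b g r h) * indicator (hball x (r / 3 ^ j)) h \<partial>lebesgue)"
    for x and j :: nat
  have "AE x in lebesgue. x \<in> E \<longrightarrow> (\<exists>j\<ge>1. P x j)"
    using density_point[OF E_meas r]
  proof (eventually_elim, intro impI)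
    fix x assume "x \<in> E \<longrightarrow> (\<exists>j\<ge>1. ennreal (vol TYPE('n) (r / 3 ^ j)) < 2 * emeasure lebesgue (E \<inter> hball x (r / 3 ^ j)))" "x \<in> E"
    then obtain j where j: "j \<ge> 1" "ennreal (vol TYPE('n) (r / 3 ^ j)) < 2 * emeasure lebesgue (E \<inter> hball x (r / 3 ^ j))" by blast
    let ?B = "hball x (r / 3 ^ j)" and ?v = "vol TYPE('n) (r / 3 ^ j)"
    have v: "0 < ?v" using r by simp
    have "ennreal (\<kappa> * ?v) < ennreal (2 * \<kappa> * ?v)"
      using \<kappa> v by (simp add: ennreal_less_iff)
    also have "\<dots> = ennreal (2 * \<kappa>) * ennreal ?v" using \<kappa> v by (simp add: ennreal_mult less_imp_le)
    also have "\<dots> \<le> ennreal (2 * \<kappa>) * (2 * emeasure lebesgue (E \<inter> ?B))"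
      using j by (intro mult_left_mono) auto
    also have "\<dots> = ennreal (4 * \<kappa>) * emeasure lebesgue (E \<inter> ?B)"
    proof -
      have "ennreal (2 * \<kappa>) * 2 = ennreal (4 * \<kappa>)"
        using \<kappa> ennreal_mult[of "2 * \<kappa>" 2] by simp
      then show ?thesis by (simp add: mult.assoc[symmetric])
    qed
    also have "\<dots> = (\<integral>\<^sup>+h. ennreal (4 * \<kappa>) * indicator (E \<inter> ?B) h \<partial>lebesgue)"
      using hball_lebesgue[of x "r / 3 ^ j"] E_meas by (subst nn_integral_cmult_indicator) auto
    also have "\<dots> \<le> (\<integral>\<^sup>+h. ennreal (bosc b g r h) * indicator ?B h \<partial>lebesgue)"
      using t by (intro nn_integral_mono) (auto simp: E_def indicator_def intro!: ennreal_leI)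
    finally show "\<exists>j\<ge>1. P x j" using j(1) unfolding P_def by blast
  qed
  then obtain N0 where N0: "{x \<in> space lebesgue. \<not> (x \<in> E \<longrightarrow> (\<exists>j\<ge>1. P x j))} \<subseteq> N0" "emeasure lebesgue N0 = 0" "N0 \<in> sets lebesgue"
    by (rule AE_E)
  have "emeasure lebesgue E = emeasure lebesgue (E - N0)"
    by (rule emeasure_Diff_null_set[symmetric]) (use N0 in \<open>auto simp: null_sets_def\<close>)
  also have "\<dots> \<le> ennreal (\<theta> * 3 powr ?Q / \<kappa>) * (\<integral>\<^sup>+h. f h \<partial>lebesgue)"
  proof (rule emeasure_le_compact)
    show "E - N0 \<in> sets lebesgue" using N0 E_meas by (intro sets.Diff)
    fix K assume K: "compact K" "K \<subseteq> E - N0"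
    define J where "J x = (LEAST j. 1 \<le> j \<and> P x j)" for x
    have J: "1 \<le> J x" "P x (J x)" if "x \<in> K" for x
    proof -
      have "\<exists>j. 1 \<le> j \<and> P x j" using that K N0 by auto
      then have "1 \<le> J x \<and> P x (J x)" unfolding J_def by (rule LeastI_ex)
      then show "1 \<le> J x" "P x (J x)" by auto
    qed
    define \<rho> where "\<rho> x = r / 3 ^ J x" for x
    have \<rho>: "0 < \<rho> x" for x using r by (simp add: \<rho>_def)
    show "emeasure lebesgue K \<le> ennreal (\<theta> * 3 powr ?Q / \<kappa>) * (\<integral>\<^sup>+h. f h \<partial>lebesgue)"
    proof (rule Vitali_estimate[OF K(1) \<rho> f_meas])
      fix x assume x: "x \<in> K"
      have xg: "hdist g x < r" using x K by (auto simp: E_def)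
      obtain i where i: "J x = Suc i" using J(1)[OF x] by (cases "J x") auto
      have \<rho>3: "3 * \<rho> x = r / 3 ^ i" by (simp add: \<rho>_def i)
      have "(\<integral>\<^sup>+h. ennreal (bosc b g r h) * indicator (hball x (3 * \<rho> x)) h \<partial>lebesgue) \<le> ennreal (\<kappa> * vol TYPE('n) (3 * \<rho> x))"
      \<comment> \<open>For \<open>i = 0\<close> the triple has radius r, which lies outside the
        range of the minimality of \<open>J x\<close>; there the bound \<open>f_int\<close> on the
        total mass takes its place.\<close>
      proof (cases "i = 0")
        case True
        have "hball x r \<subseteq> hball g (2 * r)" using xg by (intro hball_mono) simp
        then have "(\<integral>\<^sup>+h. ennreal (bosc b g r h) * indicator (hball x (3 * \<rho> x)) h \<partial>lebesgue) \<le> (\<integral>\<^sup>+h. f h \<partial>lebesgue)"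
          using True unfolding f_def \<rho>3 by (intro nn_integral_mono mult_left_mono) (auto simp: indicator_def)
        also note f_int
        also have "ennreal ((1 + 2 powr ?Q) * N * 2 powr ?Q * vol TYPE('n) r) \<le> ennreal (\<kappa> * vol TYPE('n) (3 * \<rho> x))"
        proof (intro ennreal_leI)
          have "2 powr ?Q \<le> 6 powr ?Q" using hdim_pos[where 'n='n] by (intro powr_mono2) (simp_all add: less_imp_le)
          then have "2 powr ?Q \<le> 2 * 6 powr ?Q" by (smt (verit) powr_ge_zero)
          then have "(1 + 2 powr ?Q) * N * 2 powr ?Q \<le> (1 + 2 powr ?Q) * N * (2 * 6 powr ?Q)"
            using N by (intro mult_left_mono) auto
          also have "\<dots> = \<kappa>" by (simp add: \<kappa>_def mult_ac)
          finally show "(1 + 2 powr ?Q) * N * 2 powr ?Q * vol TYPE('n) r \<le> \<kappa> * vol TYPE('n) (3 * \<rho> x)"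
            using True r mult_right_mono[OF _ less_imp_le[OF vol_pos[OF r]]] unfolding \<rho>3 by simp
        qed
        finally show ?thesis .
      next
        case False
        then have "\<not> P x i"
          using not_less_Least[of i "\<lambda>j. 1 \<le> j \<and> P x j"] i unfolding J_def by auto
        then show ?thesis unfolding P_def \<rho>3 by simp
      qed
      from order.trans[OF ball_avg_diff_le[of "3 * \<rho> x" x "ball_avg b g r"] this[unfolded bosc_def]]
      have "ennreal (\<bar>ball_avg b x (3 * \<rho> x) - ball_avg b g r\<bar> * vol TYPE('n) (3 * \<rho> x)) \<le> ennreal (\<kappa> * vol TYPE('n) (3 * \<rho> x))"
        using \<rho>[of x] by simp
      moreover have v3: "0 < vol TYPE('n) (3 * \<rho> x)" and v: "0 < vol TYPE('n) (\<rho> x)" using \<rho>[of x] by simp_all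
      ultimately have d: "\<bar>ball_avg b x (3 * \<rho> x) - ball_avg b g r\<bar> \<le> \<kappa>"
        using \<kappa> by (simp add: ennreal_le_iff less_imp_le)
      \<comment> \<open>On the triple the average has moved by at most \<kappa>, so points of
        \<open>K\<close> still oscillate by more than t relative to the triple, and the assumed
        distribution bound applies there.\<close>
      have "emeasure lebesgue (K \<inter> hball x (3 * \<rho> x)) \<le> emeasure lebesgue {y \<in> hball x (3 * \<rho> x). t < bosc b x (3 * \<rho> x) y}"
      proof (rule emeasure_mono)
        show "K \<inter> hball x (3 * \<rho> x) \<subseteq> {y \<in> hball x (3 * \<rho> x). t < bosc b x (3 * \<rho> x) y}"
        proof
          fix y assume y: "y \<in> K \<inter> hball x (3 * \<rho> x)"
          then have "t + 4 * \<kappa> < bosc b g r y" using K by (auto simp: E_def)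
          then have "t < bosc b x (3 * \<rho> x) y" using d \<kappa> unfolding bosc_def by linarith
          then show "y \<in> {y \<in> hball x (3 * \<rho> x). t < bosc b x (3 * \<rho> x) y}" using y by simp
        qed
        show "{y \<in> hball x (3 * \<rho> x). t < bosc b x (3 * \<rho> x) y} \<in> sets lebesgue"
          by (rule Collect_lebesgue) (use hball_lebesgue[of x "3 * \<rho> x"] in measurable)
      qed
      also have "\<dots> \<le> ennreal (\<theta> * vol TYPE('n) (3 * \<rho> x))" using \<rho>[of x] by (intro IH) simp
      also have "\<dots> = ennreal (\<theta> * 3 powr ?Q / \<kappa>) * ennreal (\<kappa> * vol TYPE('n) (\<rho> x))"
        using \<kappa> \<theta> v \<rho>[of x] vol_mult[of 3 "\<rho> x", where 'n='n]
        by (subst ennreal_mult[symmetric]) (simp_all add: less_imp_le)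
      also have "\<dots> \<le> ennreal (\<theta> * 3 powr ?Q / \<kappa>) * (\<integral>\<^sup>+h. ennreal (bosc b g r h) * indicator (hball x (\<rho> x)) h \<partial>lebesgue)"
        using J(2)[OF x] unfolding P_def \<rho>_def by (intro mult_left_mono) auto
      also have "\<dots> \<le> ennreal (\<theta> * 3 powr ?Q / \<kappa>) * (\<integral>\<^sup>+h. f h * indicator (hball x (\<rho> x)) h \<partial>lebesgue)"
      proof -
        have "\<rho> x \<le> r" using r by (simp add: \<rho>_def divide_le_eq)
        then have "hball x (\<rho> x) \<subseteq> hball g (2 * r)" using xg by (intro hball_mono) simp
        then show ?thesis unfolding f_def by (intro mult_left_mono nn_integral_mono) (auto simp: indicator_def)
      qed
      finally show "emeasure lebesgue (K \<inter> hball x (3 * \<rho> x))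
        \<le> ennreal (\<theta> * 3 powr ?Q / \<kappa>) * (\<integral>\<^sup>+h. f h * indicator (hball x (\<rho> x)) h \<partial>lebesgue)" .
    qed
  qed
  also have "\<dots> \<le> ennreal (\<theta> * 3 powr ?Q / \<kappa>) * ennreal ((1 + 2 powr ?Q) * N * 2 powr ?Q * vol TYPE('n) r)"
    by (intro mult_left_mono f_int) simp
  also have "\<dots> = ennreal (\<theta> * 3 powr ?Q / \<kappa> * ((1 + 2 powr ?Q) * N * 2 powr ?Q * vol TYPE('n) r))"
    using \<theta> \<kappa> N r by (intro ennreal_mult[symmetric]) (auto simp: less_imp_le)
  also have "\<theta> * 3 powr ?Q / \<kappa> * ((1 + 2 powr ?Q) * N * 2 powr ?Q * vol TYPE('n) r) = \<theta> / 2 * vol TYPE('n) r"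
  proof -
    have "3 powr ?Q * 2 powr ?Q = 6 powr ?Q" using powr_mult[of 3 2 ?Q] by simp
    then have "3 powr ?Q * ((1 + 2 powr ?Q) * N * 2 powr ?Q) = \<kappa> / 2"
      by (simp add: \<kappa>_def mult_ac)
    then have "3 powr ?Q / \<kappa> * ((1 + 2 powr ?Q) * N * 2 powr ?Q) = 1 / 2" using \<kappa> by (simp add: field_simps)
    then have "\<theta> * (3 powr ?Q / \<kappa> * ((1 + 2 powr ?Q) * N * 2 powr ?Q)) * vol TYPE('n) r = \<theta> * (1 / 2) * vol TYPE('n) r" by (simp only:)
    then show ?thesis by (simp add: mult_ac)
  qed
  finally show ?thesis unfolding E_def \<kappa>_def by (simp add: mult.assoc)
qed

text \<open>Each application of the step raises the level by a fixed multiple of \<open>N\<close>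
  and halves the proportion, starting from the whole ball: exponential decay of the distribution
  function.\<close>

lemma John_Nirenberg:
  assumes "0 < r"
  shows "emeasure lebesgue {x \<in> hball g r. real j * (8 * 6 powr hdim TYPE('n) * (1 + 2 powr hdim TYPE('n)) * N) < bosc b g r x}
    \<le> ennreal ((1 / 2) ^ j * vol TYPE('n) r)"
  using assms
proof (induction j arbitrary: g r)
  case 0
  have "emeasure lebesgue {x \<in> hball g r. 0 < bosc b g r x} \<le> emeasure lebesgue (hball g r)"
    by (intro emeasure_mono) (auto simp: hball_lebesgue)
  then show ?case using 0 by (simp add: emeasure_hball_vol)
next
  case (Suc j)
  let ?L = "8 * 6 powr hdim TYPE('n) * (1 + 2 powr hdim TYPE('n)) * N"
  have "0 \<le> ?L" using N by simp
  then have "0 \<le> real j * ?L" by (intro mult_nonneg_nonneg[OF of_nat_0_le_iff])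
  from John_Nirenberg_step[OF this _ Suc.IH Suc.prems, of g]
  show ?case by (simp add: algebra_simps)
qed

text \<open>The ball is cut along the levels j * lam: where the oscillation lies between j * lam and
  (j + 1) * lam, its s-th power is at most the j-th summand. The decay 2^(-j) of the level sets
  turns the total into a convergent series.\<close>

lemma BMO_moment:
  assumes s: "0 < s" and r: "0 < r"
  shows "(\<integral>\<^sup>+h. epowr (ennreal (bosc b g r h)) s * indicator (hball g r) h \<partial>lebesgue)
    \<le> ennreal ((8 * 6 powr hdim TYPE('n) * (1 + 2 powr hdim TYPE('n)) * N) powr s * vol TYPE('n) r)
       * (\<Sum>j. ennreal ((real j + 1) powr s * (1 / 2) ^ j))"
proof -
  note b_measurable [measurable]
  define lam where "lam = 8 * 6 powr hdim TYPE('n) * (1 + 2 powr hdim TYPE('n)) * N"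
  have lam: "0 < lam" unfolding lam_def using N by (intro mult_pos_pos) (auto intro: add_pos_pos)
  define A where "A j = {x \<in> hball g r. real j * lam < bosc b g r x}" for j :: nat
  have A [measurable]: "A j \<in> sets lebesgue" for j
    unfolding A_def by (rule Collect_lebesgue) (use hball_lebesgue[of g r] in measurable)
  have "(\<integral>\<^sup>+h. epowr (ennreal (bosc b g r h)) s * indicator (hball g r) h \<partial>lebesgue)
      \<le> (\<integral>\<^sup>+h. (\<Sum>j. ennreal (((real j + 1) * lam) powr s) * indicator (A j) h) \<partial>lebesgue)"
  proof (intro nn_integral_mono)
    fix h
    let ?y = "bosc b g r h"
    show "epowr (ennreal ?y) s * indicator (hball g r) h \<le> (\<Sum>j. ennreal (((real j + 1) * lam) powr s) * indicator (A j) h)"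
    proof (cases "h \<in> hball g r \<and> ?y \<noteq> 0")
      case True
      then have y: "0 < ?y" using bosc_nonneg[of b g r h] by linarith
      define j where "j = nat (\<lceil>?y / lam\<rceil> - 1)"
      have "1 \<le> \<lceil>?y / lam\<rceil>" using y lam by (simp add: le_ceiling_iff)
      then have "real j = of_int \<lceil>?y / lam\<rceil> - 1" unfolding j_def by simp
      then have "real j < ?y / lam" "?y / lam \<le> real j + 1" by linarith+
      then have j: "real j * lam < ?y" "?y \<le> (real j + 1) * lam" using lam by (auto simp: field_simps)
      have "epowr (ennreal ?y) s * indicator (hball g r) h \<le> ennreal (((real j + 1) * lam) powr s) * indicator (A j) h"
        using True j s y by (auto simp: A_def intro!: ennreal_leI powr_mono2)
      also have "\<dots> \<le> (\<Sum>j. ennreal (((real j + 1) * lam) powr s) * indicator (A j) h)"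
        by (rule ennreal_le_suminf)
      finally show ?thesis .
    qed (auto simp: indicator_def)
  qed
  also have "\<dots> = (\<Sum>j. \<integral>\<^sup>+h. ennreal (((real j + 1) * lam) powr s) * indicator (A j) h \<partial>lebesgue)"
    by (rule nn_integral_suminf) measurable
  also have "\<dots> \<le> (\<Sum>j. ennreal (lam powr s * vol TYPE('n) r) * ennreal ((real j + 1) powr s * (1 / 2) ^ j))"
  proof (intro suminf_le)
    fix j
    have "(\<integral>\<^sup>+h. ennreal (((real j + 1) * lam) powr s) * indicator (A j) h \<partial>lebesgue)
       = ennreal (((real j + 1) * lam) powr s) * emeasure lebesgue (A j)"
      by (rule nn_integral_cmult_indicator) measurable
    also have "\<dots> \<le> ennreal (((real j + 1) * lam) powr s) * ennreal ((1 / 2) ^ j * vol TYPE('n) r)"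
      unfolding A_def lam_def by (intro mult_left_mono John_Nirenberg r) simp
    also have "\<dots> = ennreal (lam powr s * vol TYPE('n) r) * ennreal ((real j + 1) powr s * (1 / 2) ^ j)"
      using lam r by (simp add: ennreal_mult[symmetric] powr_mult mult_ac less_imp_le)
    finally show "(\<integral>\<^sup>+h. ennreal (((real j + 1) * lam) powr s) * indicator (A j) h \<partial>lebesgue)
       \<le> ennreal (lam powr s * vol TYPE('n) r) * ennreal ((real j + 1) powr s * (1 / 2) ^ j)" .
  qed auto
  finally show ?thesis unfolding lam_def by simp
qed

end

lemma suminf_powr_geometric_finite: "(\<Sum>j. ennreal ((real j + 1) powr s * (1 / 2) ^ j)) < top"
  if "0 < s"
proof -
  \<comment> \<open>Half of the decay rate, so that (1/2)^j = exp(-2 c j). One half absorbs the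
    power of j + 1, by ln y \<le> y at y = (j + 1) c / s; the other half remains as a convergent
    geometric series.\<close>
  define c where "c = ln 2 / (2::real)"
  have c: "0 < c" by (simp add: c_def)
  have bd: "(real j + 1) powr s * (1 / 2) ^ j \<le> exp (s * ln (s / c)) * exp c * (exp (- c)) ^ j" for j
  proof -
    let ?x = "real j + 1"
    have "ln (?x * (c / s)) \<le> ?x * (c / s)"
      using ln_le_minus_one[of "?x * (c / s)"] c that by simp
    then have "ln ?x + ln (c / s) \<le> ?x * (c / s)" using c that by (subst ln_mult_pos[symmetric]) auto
    then have "s * (ln ?x + ln (c / s)) \<le> s * (?x * (c / s))" using that by (intro mult_left_mono) auto
    moreover have "ln (c / s) = - ln (s / c)" using c that by (simp add: ln_div)
    ultimately have "s * ln ?x \<le> s * ln (s / c) + c * ?x" using that by (simp add: algebra_simps)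
    then have "?x powr s \<le> exp (s * ln (s / c) + c * ?x)" by (simp add: powr_def)
    then have le: "?x powr s * exp (real j * - (2 * c)) \<le> exp (s * ln (s / c) + c * ?x) * exp (real j * - (2 * c))"
      by (intro mult_right_mono) auto
    also have "\<dots> = exp (s * ln (s / c)) * exp c * exp (real j * - c)"
      unfolding exp_add[symmetric] by (rule arg_cong[where f=exp]) (simp add: algebra_simps)
    finally have "?x powr s * exp (- (2 * c)) ^ j \<le> exp (s * ln (s / c)) * exp c * exp (- c) ^ j"
      unfolding exp_of_nat_mult .
    moreover have "2 * c = ln 2" by (simp add: c_def)
    then have "exp (- (2 * c)) = (1 / 2 :: real)" unfolding exp_minus by (simp add: inverse_eq_divide)
    ultimately show ?thesis by (simp only:)
  qed
  have "(\<lambda>j. exp (s * ln (s / c)) * exp c * (exp (- c)) ^ j) sums (exp (s * ln (s / c)) * exp c * (1 / (1 - exp (- c))))"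
    using c by (intro sums_mult geometric_sums) simp
  then have eq: "(\<Sum>j. ennreal (exp (s * ln (s / c)) * exp c * (exp (- c)) ^ j)) = ennreal (exp (s * ln (s / c)) * exp c * (1 / (1 - exp (- c))))"
    by (intro suminf_ennreal_eq) auto
  have "(\<Sum>j. ennreal ((real j + 1) powr s * (1 / 2) ^ j)) \<le> (\<Sum>j. ennreal (exp (s * ln (s / c)) * exp c * (exp (- c)) ^ j))"
    by (intro suminf_le ennreal_leI bd) simp_all
  then show ?thesis unfolding eq by (rule le_less_trans) simp
qed

text \<open>The additive term \<open>a * N\<close> accommodates the drift between averages of
  \<open>b\<close> over different balls: \<open>a\<close> is a fixed constant in the global bound
  and grows with the scale in the local one. The constant depends on neither \<open>b\<close> nor
  the ball.\<close>

lemma BMO_oscillation_norm: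
  assumes s: "1 < s"
  shows "\<exists>C>0. \<forall>(b :: 'n::finite heis \<Rightarrow> real) N g r a. b \<in> Lp_loc 1 \<longrightarrow> bmo_norm b \<le> ennreal N \<longrightarrow> 0 < N \<longrightarrow> 0 < r \<longrightarrow> 0 \<le> a \<longrightarrow>
    eLp s lebesgue (\<lambda>h. ennreal (bosc b g r h + a * N) * indicator (hball g r) h)
      \<le> ennreal (C * (1 + a) * N * vol TYPE('n) r powr (1 / s))"
proof -
  obtain S where S: "(\<Sum>j. ennreal ((real j + 1) powr s * (1 / 2) ^ j)) = ennreal S" "0 \<le> S"
    using suminf_powr_geometric_finite[OF less_trans[OF zero_less_one s]] unfolding less_top_ennreal by blast
  define L where "L = 8 * 6 powr hdim TYPE('n) * (1 + 2 powr hdim TYPE('n))"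
  have L: "0 < L" unfolding L_def by (intro mult_pos_pos) (auto intro: add_pos_pos)
  define C where "C = 4 * (L * S powr (1 / s) + 1)"
  have C: "0 < C" using L S by (auto simp: C_def intro: add_nonneg_pos)
  have "eLp s lebesgue (\<lambda>h. ennreal (bosc b g r h + a * N) * indicator (hball g r) h)
      \<le> ennreal (C * (1 + a) * N * vol TYPE('n) r powr (1 / s))"
    if b: "b \<in> Lp_loc 1" and bN: "bmo_norm b \<le> ennreal N" "0 < N" and r: "0 < r" and a: "0 \<le> a" for b :: "'n heis \<Rightarrow> real" and N g r a
  proof -
    have [measurable]: "b \<in> borel_measurable lebesgue" using b by (rule Lp_loc_measurable)
    let ?v = "vol TYPE('n) r"
    have v: "0 < ?v" using r by simp
    let ?I = "indicator (hball g r) :: _ \<Rightarrow> ennreal"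
    have [measurable]: "?I \<in> borel_measurable lebesgue" using hball_lebesgue[of g r] by simp
    have "eLp s lebesgue (\<lambda>h. ennreal (bosc b g r h + a * N) * ?I h)
       = eLp s lebesgue (\<lambda>h. ennreal (bosc b g r h) * ?I h + ennreal (a * N) * ?I h)"
      using a bN by (simp add: distrib_right)
    also have "\<dots> \<le> 4 * (eLp s lebesgue (\<lambda>h. ennreal (bosc b g r h) * ?I h) + eLp s lebesgue (\<lambda>h. ennreal (a * N) * ?I h))"
      using s by (intro eLp_add_le) auto
    also have "eLp s lebesgue (\<lambda>h. ennreal (a * N) * ?I h) = ennreal (a * N * ?v powr (1 / s))"
    proof -
      have "(\<integral>\<^sup>+h. epowr (?I h) s \<partial>lebesgue) = (\<integral>\<^sup>+h. ?I h \<partial>lebesgue)"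
        by (intro nn_integral_cong) (auto simp: indicator_def)
      also have "\<dots> = ennreal ?v"
        using emeasure_hball_vol[OF r, of g] hball_lebesgue[of g r] by simp
      finally have "eLp s lebesgue ?I = ennreal (?v powr (1 / s))"
        unfolding eLp_def using v by (simp add: less_imp_le del: vol_pos)
      then show ?thesis using s a bN by (subst eLp_cmult) (auto simp: ennreal_mult)
    qed
    also have "eLp s lebesgue (\<lambda>h. ennreal (bosc b g r h) * ?I h) \<le> ennreal (L * N * S powr (1 / s) * ?v powr (1 / s))"
    proof -
      have "(\<integral>\<^sup>+h. epowr (ennreal (bosc b g r h) * ?I h) s \<partial>lebesgue)
          = (\<integral>\<^sup>+h. epowr (ennreal (bosc b g r h)) s * ?I h \<partial>lebesgue)"
        by (intro nn_integral_cong) (auto simp: indicator_def)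
      also have "\<dots> \<le> ennreal ((L * N) powr s * ?v) * ennreal S"
        using BMO_moment[OF b bN, of s r g] s r unfolding L_def S by simp
      also have "\<dots> = ennreal ((L * N) powr s * ?v * S)"
        using S v by (intro ennreal_mult[symmetric]) auto
      finally have "eLp s lebesgue (\<lambda>h. ennreal (bosc b g r h) * ?I h) \<le> epowr (ennreal ((L * N) powr s * ?v * S)) (1 / s)"
        unfolding eLp_def using s by (intro epowr_mono) auto
      also have "\<dots> = ennreal (((L * N) powr s * ?v * S) powr (1 / s))"
        using S v by (intro epowr_ennreal) auto
      also have "((L * N) powr s * ?v * S) powr (1 / s) = L * N * S powr (1 / s) * ?v powr (1 / s)"
        using S v L bN s by (simp add: powr_mult powr_powr)
      finally show ?thesis .
    qed
    also have "4 * (ennreal (L * N * S powr (1 / s) * ?v powr (1 / s)) + ennreal (a * N * ?v powr (1 / s)))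
        = ennreal (4 * (L * N * S powr (1 / s) * ?v powr (1 / s) + a * N * ?v powr (1 / s)))" (is "4 * (ennreal ?X + ennreal ?Y) = _")
    proof -
      have "0 \<le> ?X" "0 \<le> ?Y" using L bN a by simp_all
      then have "ennreal (4 * (?X + ?Y)) = ennreal 4 * (ennreal ?X + ennreal ?Y)"
        by (subst ennreal_mult) simp_all
      then show ?thesis by simp
    qed
    also have "\<dots> \<le> ennreal (C * (1 + a) * N * ?v powr (1 / s))"
    proof (intro ennreal_leI)
      let ?w = "N * ?v powr (1 / s)"
      have "L * S powr (1 / s) + a \<le> (L * S powr (1 / s) + 1) * (1 + a)"
        using L a by (simp add: algebra_simps)
      then have "4 * (L * S powr (1 / s) + a) \<le> C * (1 + a)"
        unfolding C_def mult.assoc by (intro mult_left_mono) auto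
      then have "4 * (L * S powr (1 / s) + a) * ?w \<le> C * (1 + a) * ?w"
        using bN by (intro mult_right_mono) auto
      then show "4 * (L * N * S powr (1 / s) * ?v powr (1 / s) + a * N * ?v powr (1 / s)) \<le> C * (1 + a) * N * ?v powr (1 / s)"
        by (simp add: algebra_simps)
    qed
    finally show ?thesis by (simp add: mult_left_mono add_mono)
  qed
  with C show ?thesis by blast
qed

section \<open>The positive commutator of the fractional integral\<close>

text \<open>The converse of Hoelder's inequality. The test function is the power q - 1 of
  \<open>G k\<close>, a truncation of \<open>F\<close> in height and in space. Truncation makes the
  integral finite, so that it can be divided out; monotone convergence then recovers
  \<open>F\<close>.\<close>

lemma eLp_le_by_duality:
  fixes F :: "'a::euclidean_space \<Rightarrow> ennreal"
  assumes [measurable]: "F \<in> borel_measurable lebesgue" and q: "1 < q" "1 / q + 1 / q' = 1"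
    and le: "\<And>u. u \<in> borel_measurable lebesgue \<Longrightarrow> (\<integral>\<^sup>+x. u x * F x \<partial>lebesgue) \<le> A * eLp q' lebesgue u"
  shows "eLp q lebesgue F \<le> A"
proof -
  have q': "1 / q' = 1 - 1 / q" using q by simp
  have q'0: "0 < q'" "(q - 1) * q' = q"
  proof -
    have "0 < 1 / q'" unfolding q' using q by simp
    then show "0 < q'" by simp
    then show "(q - 1) * q' = q" using q by (simp add: field_simps)
  qed
  define G where "G k x = min (F x) (of_nat k) * indicator (cball 0 (real k)) x" for k :: nat and x
  have cb [measurable]: "cball (0::'a) r \<in> sets lebesgue" for r by (simp add: borel_closed)
  have G [measurable]: "G k \<in> borel_measurable lebesgue" for k unfolding G_def by measurable
  define I where "I k = (\<integral>\<^sup>+x. epowr (G k x) q \<partial>lebesgue)" for k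
  have "I k < top" for k
  proof -
    have "I k \<le> (\<integral>\<^sup>+x. epowr (of_nat k) q * indicator (cball 0 (real k)) x \<partial>(lebesgue :: 'a measure))"
      unfolding I_def G_def using q by (intro nn_integral_mono) (auto simp: indicator_def intro!: epowr_mono)
    also have "\<dots> = epowr (of_nat k) q * emeasure lebesgue (cball (0::'a) (real k))"
      by (rule nn_integral_cmult_indicator) measurable
    also have "\<dots> < top"
      using emeasure_bounded_finite[of "cball (0::'a) (real k)"]
      by (simp add: emeasure_lebesgue_eq ennreal_mult_eq_top_iff ennreal_of_nat_eq_real_of_nat less_top[symmetric])
    finally show ?thesis .
  qed
  have I_le: "I k \<le> epowr A q" for k
  proof (cases "I k = 0")
    case False
    then obtain y where y: "I k = ennreal y" "0 < y"
      using \<open>I k < top\<close> unfolding less_top_ennreal by (auto simp: less_le)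
    have "I k = (\<integral>\<^sup>+x. epowr (G k x) (q - 1) * G k x \<partial>lebesgue)"
      unfolding I_def using epowr_add[of "q - 1" 1] q by (intro nn_integral_cong) simp
    also have "\<dots> \<le> (\<integral>\<^sup>+x. epowr (G k x) (q - 1) * F x \<partial>lebesgue)"
      by (intro nn_integral_mono mult_left_mono) (auto simp: G_def indicator_def)
    also have "\<dots> \<le> A * eLp q' lebesgue (\<lambda>x. epowr (G k x) (q - 1))"
      by (rule le) measurable
    also have "eLp q' lebesgue (\<lambda>x. epowr (G k x) (q - 1)) = epowr (I k) (1 / q')"
      unfolding eLp_def I_def epowr_epowr q'0 ..
    finally have "ennreal (y powr (1 / q)) * ennreal (y powr (1 / q')) \<le> A * ennreal (y powr (1 / q'))"
      using y q by (simp add: ennreal_mult[symmetric] powr_add[symmetric])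
    then have "ennreal (y powr (1 / q)) * ennreal (y powr (1 / q')) * ennreal (1 / y powr (1 / q'))
        \<le> A * ennreal (y powr (1 / q')) * ennreal (1 / y powr (1 / q'))"
      by (rule mult_right_mono) simp
    then have "ennreal (y powr (1 / q)) \<le> A"
      using y by (simp add: mult.assoc ennreal_mult[symmetric])
    then have "epowr (ennreal (y powr (1 / q))) q \<le> epowr A q" using q by (intro epowr_mono) auto
    then show ?thesis using y q by (simp add: powr_powr)
  qed simp
  have sup: "(SUP k. epowr (G k x) q) = epowr (F x) q" for x
  proof (rule antisym)
    show "(SUP k. epowr (G k x) q) \<le> epowr (F x) q"
      using q by (intro SUP_least epowr_mono) (auto simp: G_def indicator_def)
    obtain n where n: "norm x \<le> real n" using real_arch_simple by blast
    show "epowr (F x) q \<le> (SUP k. epowr (G k x) q)"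
    proof (cases "F x" rule: ennreal_cases)
      case (real r)
      obtain m where m: "r \<le> real m" using real_arch_simple by blast
      then have "F x \<le> of_nat (max n m)"
        using real by (simp add: ennreal_of_nat_eq_real_of_nat ennreal_leI)
      then have "G (max n m) x = F x" using n by (simp add: G_def min_def)
      then show ?thesis by (intro SUP_upper2[of "max n m"]) auto
    next
      case top
      have "(of_nat j :: ennreal) \<le> (SUP k. epowr (G k x) q)" for j
      proof -
        define k where "k = max (max n j) 1"
        have "G k x = of_nat k" using n top by (simp add: G_def k_def)
        moreover have "real k \<le> real k powr q"
          using powr_mono[of 1 q "real k"] q by (simp add: k_def)
        ultimately have "(of_nat j :: ennreal) \<le> epowr (G k x) q"
          by (simp add: ennreal_of_nat_eq_real_of_nat k_def)
        then show ?thesis by (intro SUP_upper2[of k]) auto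
      qed
      then have "(SUP j. of_nat j :: ennreal) \<le> (SUP k. epowr (G k x) q)" by (intro SUP_least)
      then have "(SUP k. epowr (G k x) q) = top" unfolding ennreal_SUP_of_nat_eq_top top_unique .
      then show ?thesis by (simp only: top_greatest)
    qed
  qed
  have "(\<integral>\<^sup>+x. epowr (F x) q \<partial>lebesgue) = (\<integral>\<^sup>+x. (SUP k. epowr (G k x) q) \<partial>lebesgue)"
    by (simp add: sup)
  also have "\<dots> = (SUP k. I k)"
    unfolding I_def
  proof (rule nn_integral_monotone_convergence_SUP)
    show "incseq (\<lambda>k x. epowr (G k x) q)"
    proof (intro monoI le_funI epowr_mono)
      fix k l :: nat and x assume "k \<le> l"
      then show "G k x \<le> G l x"
        unfolding G_def by (intro mult_mono min.mono) (auto simp: indicator_def)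
    qed (use q in auto)
  qed measurable
  also have "\<dots> \<le> epowr A q" by (intro SUP_least I_le)
  finally have "eLp q lebesgue F \<le> epowr (epowr A q) (1 / q)"
    unfolding eLp_def using q by (intro epowr_mono) auto
  then show ?thesis using q by (simp add: epowr_cancel)
qed

text \<open>The junk value \<open>riesz \<alpha> g g = 1 / 0 = 0\<close> is harmless, as \<open>\<bar>b g - b h\<bar>\<close> vanishes there.\<close>

definition riesz :: "real \<Rightarrow> 'n::finite heis \<Rightarrow> 'n heis \<Rightarrow> real" where
  "riesz \<alpha> g h = 1 / hdist g h powr (hdim TYPE('n) - \<alpha>)"

definition comm :: "real \<Rightarrow> ('n::finite heis \<Rightarrow> real) \<Rightarrow> ('n heis \<Rightarrow> ennreal) \<Rightarrow> 'n heis \<Rightarrow> ennreal" where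
  "comm \<alpha> b f g = (\<integral>\<^sup>+h. ennreal (\<bar>b g - b h\<bar> * riesz \<alpha> g h) * f h \<partial>lebesgue)"

lemma riesz_nonneg [simp]: "0 \<le> riesz \<alpha> g h"
  by (simp add: riesz_def)

lemma riesz_measurable [measurable]:
  "(\<lambda>z :: 'n::finite heis \<times> 'n heis. riesz \<alpha> (fst z) (snd z)) \<in> borel_measurable (lebesgue \<Otimes>\<^sub>M lebesgue)"
  unfolding riesz_def by measurable

lemma comm_measurable [measurable]:
  assumes [measurable]: "b \<in> borel_measurable lebesgue" "f \<in> borel_measurable lebesgue"
  shows "comm \<alpha> b f \<in> borel_measurable lebesgue"
  unfolding comm_def[abs_def]
  by (rule leb.borel_measurable_nn_integral) (simp only: case_prod_unfold, measurable)

lemma indicator_hball_measurable [measurable]: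
  "(\<lambda>z :: 'n::finite heis \<times> 'n heis. indicator (hball (fst z) r) (snd z) :: 'b::{real_normed_algebra_1, second_countable_topology}) \<in> borel_measurable (lebesgue \<Otimes>\<^sub>M lebesgue)"
proof -
  have "(\<lambda>z :: 'n heis \<times> 'n heis. indicator {z. hdist (fst z) (snd z) < r} z :: 'b) \<in> borel_measurable (lebesgue \<Otimes>\<^sub>M lebesgue)"
    by measurable
  then show ?thesis by (rule measurable_cong[THEN iffD1, rotated]) (auto simp: indicator_def)
qed

lemma eindicator_hball_measurable [measurable]:
  "(\<lambda>z :: 'n::finite heis \<times> 'n heis. indicator (hball (fst z) r) (snd z) :: ennreal) \<in> borel_measurable (lebesgue \<Otimes>\<^sub>M lebesgue)"
proof -
  have "(\<lambda>z :: 'n heis \<times> 'n heis. indicator {z. hdist (fst z) (snd z) < r} z :: ennreal) \<in> borel_measurable (lebesgue \<Otimes>\<^sub>M lebesgue)"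
    by measurable
  then show ?thesis by (rule measurable_cong[THEN iffD1, rotated]) (auto simp: indicator_def)
qed

lemma ball_avg_measurable [measurable]:
  fixes b :: "'n::finite heis \<Rightarrow> real"
  assumes [measurable]: "b \<in> borel_measurable lebesgue" and r: "0 < r"
  shows "(\<lambda>g. ball_avg b g r) \<in> borel_measurable lebesgue"
proof -
  have "(\<lambda>g. LINT h|lebesgue. indicator (hball g r) h *\<^sub>R b h) \<in> borel_measurable lebesgue"
    by (rule leb.borel_measurable_lebesgue_integral) (simp only: case_prod_unfold, measurable)
  then show ?thesis
    unfolding ball_avg_def measure_hball_vol[OF r] set_lebesgue_integral_def by measurable
qed

text \<open>Not symmetric: the ball is centred at the first point and the oscillation is evaluated
  at the second. The constant 2^Q N is half of the admissible difference between the averages over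
  the balls about the two points.\<close>

definition comm_weight :: "('n::finite heis \<Rightarrow> real) \<Rightarrow> real \<Rightarrow> int \<Rightarrow> 'n heis \<Rightarrow> 'n heis \<Rightarrow> ennreal" where
  "comm_weight b N k g h = ennreal (bosc b g (2 powr k) h + 2 powr hdim TYPE('n) * N) * indicator (hball g (2 powr k)) h"

lemma comm_weight_measurable_pair [measurable]:
  fixes b :: "'n::finite heis \<Rightarrow> real"
  assumes [measurable]: "b \<in> borel_measurable lebesgue"
  shows "(\<lambda>z. comm_weight b N k (fst z) (snd z)) \<in> borel_measurable (lebesgue \<Otimes>\<^sub>M lebesgue)"
    and "(\<lambda>z. comm_weight b N k (snd z) (fst z)) \<in> borel_measurable (lebesgue \<Otimes>\<^sub>M lebesgue)"
proof -
  have [measurable]: "(\<lambda>g. ball_avg b g (2 powr k)) \<in> borel_measurable lebesgue"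
    by (rule ball_avg_measurable) auto
  show 1: "(\<lambda>z. comm_weight b N k (fst z) (snd z)) \<in> borel_measurable (lebesgue \<Otimes>\<^sub>M lebesgue)"
    unfolding comm_weight_def bosc_def by measurable
  have "(\<lambda>z. (snd z, fst z)) \<in> lebesgue \<Otimes>\<^sub>M lebesgue \<rightarrow>\<^sub>M lebesgue \<Otimes>\<^sub>M (lebesgue :: 'n heis measure)"
    by (rule measurable_Pair) simp_all
  from measurable_compose[OF this 1]
  show "(\<lambda>z. comm_weight b N k (snd z) (fst z)) \<in> borel_measurable (lebesgue \<Otimes>\<^sub>M lebesgue)" by simp
qed

definition comm_half :: "real \<Rightarrow> ('n::finite heis \<Rightarrow> real) \<Rightarrow> real \<Rightarrow> ('n heis \<Rightarrow> ennreal) \<Rightarrow> 'n heis \<Rightarrow> ennreal" where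
  "comm_half \<alpha> b N f g = isum (\<lambda>k::int. ennreal (2 powr ((\<alpha> - hdim TYPE('n)) * k)) * (\<integral>\<^sup>+h. comm_weight b N k g h * f h \<partial>lebesgue))"

text \<open>The transposed kernel. The oscillation is evaluated at g, over balls about the
  integration variable, so no power mean of \<open>f\<close> bounds this pointwise. It is controlled
  only through its adjoint \<open>comm_half\<close>.\<close>

definition comm_half_adj :: "real \<Rightarrow> ('n::finite heis \<Rightarrow> real) \<Rightarrow> real \<Rightarrow> ('n heis \<Rightarrow> ennreal) \<Rightarrow> 'n heis \<Rightarrow> ennreal" where
  "comm_half_adj \<alpha> b N f g = isum (\<lambda>k::int. ennreal (2 powr ((\<alpha> - hdim TYPE('n)) * k)) * (\<integral>\<^sup>+h. comm_weight b N k h g * f h \<partial>lebesgue))"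

lemma comm_weight_integral_measurable [measurable]:
  fixes b :: "'n::finite heis \<Rightarrow> real"
  assumes [measurable]: "b \<in> borel_measurable lebesgue" "f \<in> borel_measurable lebesgue"
  shows "(\<lambda>g. \<integral>\<^sup>+h. comm_weight b N k g h * f h \<partial>lebesgue) \<in> borel_measurable lebesgue"
    and "(\<lambda>g. \<integral>\<^sup>+h. comm_weight b N k h g * f h \<partial>lebesgue) \<in> borel_measurable lebesgue"
  by (rule leb.borel_measurable_nn_integral, simp only: case_prod_unfold, measurable)+

lemma comm_weight_measurable [measurable]:
  fixes b :: "'n::finite heis \<Rightarrow> real"
  assumes [measurable]: "b \<in> borel_measurable lebesgue"
  shows "(\<lambda>h. comm_weight b N k g h) \<in> borel_measurable lebesgue"
    and "(\<lambda>h. comm_weight b N k h g) \<in> borel_measurable lebesgue"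
  using measurable_compose[OF measurable_Pair1' comm_weight_measurable_pair(1)[OF assms]]
    measurable_compose[OF measurable_Pair1' comm_weight_measurable_pair(2)[OF assms]] by simp_all

lemma comm_half_measurable [measurable]:
  assumes [measurable]: "b \<in> borel_measurable lebesgue" "f \<in> borel_measurable lebesgue"
  shows "comm_half \<alpha> b N f \<in> borel_measurable lebesgue" "comm_half_adj \<alpha> b N f \<in> borel_measurable lebesgue"
  unfolding comm_half_def[abs_def] comm_half_adj_def[abs_def] by measurable

text \<open>Tonelli's theorem at every scale, since the two kernels are transposes of each
  other.\<close>

lemma comm_half_adjoint:
  fixes b :: "'n::finite heis \<Rightarrow> real"
  assumes [measurable]: "b \<in> borel_measurable lebesgue" "f \<in> borel_measurable lebesgue" "u \<in> borel_measurable lebesgue"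
  shows "(\<integral>\<^sup>+g. u g * comm_half_adj \<alpha> b N f g \<partial>lebesgue) = (\<integral>\<^sup>+g. f g * comm_half \<alpha> b N u g \<partial>lebesgue)"
proof -
  let ?c = "\<lambda>k::int. ennreal (2 powr ((\<alpha> - hdim TYPE('n)) * k))"
  have "(\<integral>\<^sup>+g. u g * comm_half_adj \<alpha> b N f g \<partial>lebesgue)
     = (\<integral>\<^sup>+g. isum (\<lambda>k. u g * (?c k * (\<integral>\<^sup>+h. comm_weight b N k h g * f h \<partial>lebesgue))) \<partial>lebesgue)"
    unfolding comm_half_adj_def by (intro nn_integral_cong nn_integral_cmult[symmetric]) simp
  also have "\<dots> = isum (\<lambda>k. \<integral>\<^sup>+g. u g * (?c k * (\<integral>\<^sup>+h. comm_weight b N k h g * f h \<partial>lebesgue)) \<partial>lebesgue)"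
    by (rule nn_integral_isum) measurable
  also have "\<dots> = isum (\<lambda>k. \<integral>\<^sup>+g. f g * (?c k * (\<integral>\<^sup>+h. comm_weight b N k g h * u h \<partial>lebesgue)) \<partial>lebesgue)"
  proof (rule nn_integral_cong)
    fix k :: int
    have "(\<integral>\<^sup>+g. u g * (?c k * (\<integral>\<^sup>+h. comm_weight b N k h g * f h \<partial>lebesgue)) \<partial>lebesgue)
      = (\<integral>\<^sup>+g. (\<integral>\<^sup>+h. ?c k * (comm_weight b N k h g * f h * u g) \<partial>lebesgue) \<partial>lebesgue)"
    proof (intro nn_integral_cong)
      fix g
      have "(\<integral>\<^sup>+h. ?c k * (comm_weight b N k h g * f h * u g) \<partial>lebesgue)
        = (\<integral>\<^sup>+h. (u g * ?c k) * (comm_weight b N k h g * f h) \<partial>lebesgue)"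
        by (intro nn_integral_cong) (simp add: mult_ac)
      also have "\<dots> = (u g * ?c k) * (\<integral>\<^sup>+h. comm_weight b N k h g * f h \<partial>lebesgue)"
        by (rule nn_integral_cmult) measurable
      finally show "u g * (?c k * (\<integral>\<^sup>+h. comm_weight b N k h g * f h \<partial>lebesgue))
        = (\<integral>\<^sup>+h. ?c k * (comm_weight b N k h g * f h * u g) \<partial>lebesgue)" by (simp add: mult.assoc)
    qed
    also have "\<dots> = (\<integral>\<^sup>+h. (\<integral>\<^sup>+g. ?c k * (comm_weight b N k h g * f h * u g) \<partial>lebesgue) \<partial>lebesgue)"
      by (rule leb_pair.Fubini') (simp only: case_prod_unfold, measurable)
    also have "\<dots> = (\<integral>\<^sup>+h. f h * (?c k * (\<integral>\<^sup>+g. comm_weight b N k h g * u g \<partial>lebesgue)) \<partial>lebesgue)"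
    proof (intro nn_integral_cong)
      fix h
      have "(\<integral>\<^sup>+g. ?c k * (comm_weight b N k h g * f h * u g) \<partial>lebesgue)
        = (\<integral>\<^sup>+g. (f h * ?c k) * (comm_weight b N k h g * u g) \<partial>lebesgue)"
        by (intro nn_integral_cong) (simp add: mult_ac)
      also have "\<dots> = (f h * ?c k) * (\<integral>\<^sup>+g. comm_weight b N k h g * u g \<partial>lebesgue)"
        by (rule nn_integral_cmult) measurable
      finally show "(\<integral>\<^sup>+g. ?c k * (comm_weight b N k h g * f h * u g) \<partial>lebesgue)
        = f h * (?c k * (\<integral>\<^sup>+g. comm_weight b N k h g * u g \<partial>lebesgue))" by (simp add: mult.assoc)
    qed
    finally show "(\<integral>\<^sup>+g. u g * (?c k * (\<integral>\<^sup>+h. comm_weight b N k h g * f h \<partial>lebesgue)) \<partial>lebesgue)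
      = (\<integral>\<^sup>+g. f g * (?c k * (\<integral>\<^sup>+h. comm_weight b N k g h * u h \<partial>lebesgue)) \<partial>lebesgue)" .
  qed
  also have "\<dots> = (\<integral>\<^sup>+g. isum (\<lambda>k. f g * (?c k * (\<integral>\<^sup>+h. comm_weight b N k g h * u h \<partial>lebesgue))) \<partial>lebesgue)"
    by (rule nn_integral_isum[symmetric]) measurable
  also have "\<dots> = (\<integral>\<^sup>+g. f g * comm_half \<alpha> b N u g \<partial>lebesgue)"
    unfolding comm_half_def by (intro nn_integral_cong nn_integral_cmult) simp
  finally show ?thesis .
qed

lemma ennreal_sum_mult:
  "0 \<le> a \<Longrightarrow> 0 \<le> a' \<Longrightarrow> 0 \<le> c \<Longrightarrow> 0 \<le> d \<Longrightarrow>
    ennreal ((a + a') * (c * d)) = ennreal c * ennreal d * (ennreal a + ennreal a')"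
  by (simp add: ennreal_mult mult_ac)

text \<open>At distance \<open>d(g, h)\<close> in \<open>[2^(k-1), 2^k)\<close> the averages of \<open>b\<close> over the balls of radius \<open>2^k\<close>
  about \<open>g\<close> and \<open>h\<close> are comparable, which makes the splitting of \<open>\<bar>b g - b h\<bar>\<close> symmetric.\<close>

lemma comm_le_halves:
  fixes b :: "'n::finite heis \<Rightarrow> real"
  assumes b: "b \<in> Lp_loc 1" "bmo_norm b \<le> ennreal N" "0 < N" and \<alpha>: "\<alpha> < hdim TYPE('n)"
    and f [measurable]: "f \<in> borel_measurable lebesgue"
  shows "comm \<alpha> b f g \<le> ennreal (2 powr (hdim TYPE('n) - \<alpha>)) * (comm_half \<alpha> b N f g + comm_half_adj \<alpha> b N f g)"
proof -
  let ?Q = "hdim TYPE('n)"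
  let ?C = "2 powr (?Q - \<alpha>)"
  let ?c = "\<lambda>k::int. ennreal (2 powr ((\<alpha> - ?Q) * k))"
  let ?w = "comm_weight b N"
  have bm [measurable]: "b \<in> borel_measurable lebesgue" using b(1) by (rule Lp_loc_measurable)
  have "ennreal (\<bar>b g - b h\<bar> * riesz \<alpha> g h) \<le> isum (\<lambda>k. ennreal ?C * ?c k * (?w k g h + ?w k h g))" for h
  proof (cases "hdist g h = 0")
    case True
    then show ?thesis by (simp add: riesz_def)
  next
    case False
    then have d: "0 < hdist g h" using hdist_nonneg[of g h] by linarith
    define k where "k = \<lfloor>log 2 (hdist g h)\<rfloor> + 1"
    have "of_int k - 1 \<le> log 2 (hdist g h)" "log 2 (hdist g h) < of_int k" unfolding k_def by linarith+
    then have k: "2 powr (of_int k - 1) \<le> hdist g h" "hdist g h < 2 powr of_int k"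
      using d by (auto simp: le_log_iff log_less_iff)
    let ?r = "2 powr real_of_int k"
    \<comment> \<open>Both balls of radius \<open>?r\<close> lie in the ball of twice that radius
      about g, which serves as a common reference; each comparison costs 2^Q N and is charged to one
      of the two weights.\<close>
    have "\<bar>ball_avg b g ?r - ball_avg b g (2 * ?r)\<bar> \<le> 2 powr ?Q * N"
      using ball_avg_nested[OF b, of ?r "2 * ?r" g g] hball_mono[of g g ?r "2 * ?r"] by simp
    moreover have "\<bar>ball_avg b h ?r - ball_avg b g (2 * ?r)\<bar> \<le> 2 powr ?Q * N"
      using ball_avg_nested[OF b, of ?r "2 * ?r" h g] hball_mono[of g h ?r "2 * ?r"] k by simp
    ultimately have "\<bar>b g - b h\<bar> \<le> (bosc b g ?r h + 2 powr ?Q * N) + (bosc b h ?r g + 2 powr ?Q * N)"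
      unfolding bosc_def by linarith
    moreover have "riesz \<alpha> g h \<le> ?C * 2 powr ((\<alpha> - ?Q) * k)"
    proof -
      have "riesz \<alpha> g h = hdist g h powr (\<alpha> - ?Q)"
        unfolding riesz_def using powr_minus[of "hdist g h" "?Q - \<alpha>"] by (simp add: inverse_eq_divide)
      also have "\<dots> \<le> (2 powr (of_int k - 1)) powr (\<alpha> - ?Q)"
        using k \<alpha> d by (intro powr_mono2') auto
      also have "\<dots> = ?C * 2 powr ((\<alpha> - ?Q) * k)"
        by (simp add: powr_powr powr_add[symmetric] algebra_simps)
      finally show ?thesis .
    qed
    ultimately have "\<bar>b g - b h\<bar> * riesz \<alpha> g h
       \<le> ((bosc b g ?r h + 2 powr ?Q * N) + (bosc b h ?r g + 2 powr ?Q * N)) * (?C * 2 powr ((\<alpha> - ?Q) * k))"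
      using b(3) by (intro mult_mono) auto
    then have "ennreal (\<bar>b g - b h\<bar> * riesz \<alpha> g h)
       \<le> ennreal (((bosc b g ?r h + 2 powr ?Q * N) + (bosc b h ?r g + 2 powr ?Q * N)) * (?C * 2 powr ((\<alpha> - ?Q) * k)))"
      by (rule ennreal_leI)
    also have "\<dots> = ennreal ?C * ?c k * (ennreal (bosc b g ?r h + 2 powr ?Q * N) + ennreal (bosc b h ?r g + 2 powr ?Q * N))"
      using b(3) by (intro ennreal_sum_mult) auto
    also have "\<dots> = ennreal ?C * ?c k * (?w k g h + ?w k h g)"
      using k hdist_commute[of g h] by (simp add: comm_weight_def)
    also have "\<dots> \<le> isum (\<lambda>k. ennreal ?C * ?c k * (?w k g h + ?w k h g))"
      using nn_integral_ge_point[of k UNIV "\<lambda>k. ennreal ?C * ?c k * (?w k g h + ?w k h g)"] by simp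
    finally show ?thesis .
  qed
  then have "comm \<alpha> b f g \<le> (\<integral>\<^sup>+h. isum (\<lambda>k. ennreal ?C * ?c k * (?w k g h + ?w k h g)) * f h \<partial>lebesgue)"
    unfolding comm_def by (intro nn_integral_mono mult_right_mono) auto
  also have "\<dots> = (\<integral>\<^sup>+h. isum (\<lambda>k. ennreal ?C * (?c k * (?w k g h * f h) + ?c k * (?w k h g * f h))) \<partial>lebesgue)"
    by (intro nn_integral_cong, subst nn_integral_multc[symmetric])
       (simp_all add: distrib_left distrib_right mult_ac)
  also have "\<dots> = isum (\<lambda>k. \<integral>\<^sup>+h. ennreal ?C * (?c k * (?w k g h * f h) + ?c k * (?w k h g * f h)) \<partial>lebesgue)"
    by (rule nn_integral_isum) measurable
  also have "\<dots> = isum (\<lambda>k. ennreal ?C * (?c k * (\<integral>\<^sup>+h. ?w k g h * f h \<partial>lebesgue) + ?c k * (\<integral>\<^sup>+h. ?w k h g * f h \<partial>lebesgue)))"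
  proof (intro nn_integral_cong)
    fix k :: int
    have "(\<integral>\<^sup>+h. ennreal ?C * (?c k * (?w k g h * f h) + ?c k * (?w k h g * f h)) \<partial>lebesgue)
      = ennreal ?C * (\<integral>\<^sup>+h. ?c k * (?w k g h * f h) + ?c k * (?w k h g * f h) \<partial>lebesgue)"
      by (rule nn_integral_cmult) measurable
    also have "(\<integral>\<^sup>+h. ?c k * (?w k g h * f h) + ?c k * (?w k h g * f h) \<partial>lebesgue)
      = (\<integral>\<^sup>+h. ?c k * (?w k g h * f h) \<partial>lebesgue) + (\<integral>\<^sup>+h. ?c k * (?w k h g * f h) \<partial>lebesgue)"
      by (rule nn_integral_add) measurable
    also have "(\<integral>\<^sup>+h. ?c k * (?w k g h * f h) \<partial>lebesgue) = ?c k * (\<integral>\<^sup>+h. ?w k g h * f h \<partial>lebesgue)"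
      by (rule nn_integral_cmult) measurable
    also have "(\<integral>\<^sup>+h. ?c k * (?w k h g * f h) \<partial>lebesgue) = ?c k * (\<integral>\<^sup>+h. ?w k h g * f h \<partial>lebesgue)"
      by (rule nn_integral_cmult) measurable
    finally show "(\<integral>\<^sup>+h. ennreal ?C * (?c k * (?w k g h * f h) + ?c k * (?w k h g * f h)) \<partial>lebesgue)
      = ennreal ?C * (?c k * (\<integral>\<^sup>+h. ?w k g h * f h \<partial>lebesgue) + ?c k * (\<integral>\<^sup>+h. ?w k h g * f h \<partial>lebesgue))" .
  qed
  also have "\<dots> = ennreal ?C * (comm_half \<alpha> b N f g + comm_half_adj \<alpha> b N f g)"
    unfolding comm_half_def comm_half_adj_def by (simp add: nn_integral_cmult nn_integral_add)
  finally show ?thesis .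
qed

text \<open>Hoelder at each scale with exponents s' and s. The oscillation gives N times the power
  1/s' of the volume, and \<open>f\<close> gives its power mean times the power 1/s of the volume.
  Together they produce 2^(k Q), which cancels the factor 2^(-k Q) of the kernel.\<close>

lemma comm_half_le_hed:
  assumes s: "1 < s"
  shows "\<exists>C>0. \<forall>(b :: 'n::finite heis \<Rightarrow> real) N f \<alpha> g. b \<in> Lp_loc 1 \<longrightarrow> bmo_norm b \<le> ennreal N \<longrightarrow> 0 < N \<longrightarrow> f \<in> borel_measurable lebesgue \<longrightarrow>
    comm_half \<alpha> b N f g \<le> ennreal (C * N) * hed \<alpha> s f g"
proof -
  let ?Q = "hdim TYPE('n)"
  define s' where "s' = s / (s - 1)"
  have s': "1 < s'" "1 / s' + 1 / s = 1" using s by (auto simp: s'_def field_simps)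
  obtain M where M: "0 < M" "\<And>(b :: 'n heis \<Rightarrow> real) N g r a. b \<in> Lp_loc 1 \<Longrightarrow> bmo_norm b \<le> ennreal N \<Longrightarrow> 0 < N \<Longrightarrow> 0 < r \<Longrightarrow> 0 \<le> a \<Longrightarrow>
    eLp s' lebesgue (\<lambda>h. ennreal (bosc b g r h + a * N) * indicator (hball g r) h)
      \<le> ennreal (M * (1 + a) * N * vol TYPE('n) r powr (1 / s'))"
    using BMO_oscillation_norm[OF s'(1), where 'n='n] by blast
  define C where "C = M * (1 + 2 powr ?Q) * unit_vol TYPE('n)"
  have C: "0 < C" using M unfolding C_def by (intro mult_pos_pos) (auto intro: add_pos_pos)
  have "comm_half \<alpha> b N f g \<le> ennreal (C * N) * hed \<alpha> s f g"
    if b: "b \<in> Lp_loc 1" "bmo_norm b \<le> ennreal N" "0 < N" and f [measurable]: "f \<in> borel_measurable lebesgue"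
    for b :: "'n heis \<Rightarrow> real" and N f \<alpha> g
  proof -
    have bm [measurable]: "b \<in> borel_measurable lebesgue" using b(1) by (rule Lp_loc_measurable)
    have "comm_half \<alpha> b N f g \<le> isum (\<lambda>k::int. ennreal (C * N) * (ennreal (2 powr (\<alpha> * k)) * epowr (havg (\<lambda>h. epowr (f h) s) g (2 powr k)) (1 / s)))"
      unfolding comm_half_def
    proof (intro nn_integral_mono)
      fix k :: int
      let ?r = "2 powr real_of_int k" and ?B = "indicator (hball g (2 powr real_of_int k)) :: 'n heis \<Rightarrow> ennreal"
      let ?v = "vol TYPE('n) ?r"
      have v: "0 < ?v" by simp
      have [measurable]: "?B \<in> borel_measurable lebesgue" using hball_lebesgue[of g ?r] by simp
      have "(\<integral>\<^sup>+h. comm_weight b N k g h * f h \<partial>lebesgue) = (\<integral>\<^sup>+h. comm_weight b N k g h * (f h * ?B h) \<partial>lebesgue)"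
        by (intro nn_integral_cong) (auto simp: comm_weight_def indicator_def)
      also have "\<dots> \<le> eLp s' lebesgue (comm_weight b N k g) * eLp s lebesgue (\<lambda>h. f h * ?B h)"
        by (rule Hoelder_eLp) (measurable, use s s' in auto)
      also have "\<dots> \<le> ennreal (M * (1 + 2 powr ?Q) * N * ?v powr (1 / s')) * (epowr (ennreal ?v) (1 / s) * epowr (havg (\<lambda>h. epowr (f h) s) g ?r) (1 / s))"
      proof (intro mult_mono)
        show "eLp s' lebesgue (comm_weight b N k g) \<le> ennreal (M * (1 + 2 powr ?Q) * N * ?v powr (1 / s'))"
          unfolding comm_weight_def[abs_def] using M(2)[OF b, of ?r "2 powr ?Q" g] by simp
        have "(\<integral>\<^sup>+h. epowr (f h * ?B h) s \<partial>lebesgue) = (\<integral>\<^sup>+h. epowr (f h) s * ?B h \<partial>lebesgue)"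
          by (intro nn_integral_cong) (auto simp: indicator_def)
        then show "eLp s lebesgue (\<lambda>h. f h * ?B h) \<le> epowr (ennreal ?v) (1 / s) * epowr (havg (\<lambda>h. epowr (f h) s) g ?r) (1 / s)"
          unfolding eLp_def epowr_mult[symmetric] by (simp add: nn_integral_hball_eq_havg)
      qed auto
      also have "\<dots> = ennreal (M * (1 + 2 powr ?Q) * N * ?v) * epowr (havg (\<lambda>h. epowr (f h) s) g ?r) (1 / s)"
      proof -
        have "?v powr (1 / s') * ?v powr (1 / s) = ?v"
          unfolding powr_add[symmetric] s'(2) using v by (simp add: abs_of_pos del: vol_pos)
        then have "M * (1 + 2 powr ?Q) * N * ?v powr (1 / s') * ?v powr (1 / s) = M * (1 + 2 powr ?Q) * N * ?v"
          by simp
        moreover have "ennreal (M * (1 + 2 powr ?Q) * N * ?v powr (1 / s')) * epowr (ennreal ?v) (1 / s)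
           = ennreal (M * (1 + 2 powr ?Q) * N * ?v powr (1 / s') * ?v powr (1 / s))"
          using M b(3) v by (subst ennreal_mult) (auto simp: less_imp_le)
        ultimately show ?thesis by (simp only: mult.assoc[symmetric])
      qed
      finally have "ennreal (2 powr ((\<alpha> - ?Q) * k)) * (\<integral>\<^sup>+h. comm_weight b N k g h * f h \<partial>lebesgue)
        \<le> ennreal (2 powr ((\<alpha> - ?Q) * k)) * (ennreal (M * (1 + 2 powr ?Q) * N * ?v) * epowr (havg (\<lambda>h. epowr (f h) s) g ?r) (1 / s))"
        by (rule mult_left_mono) simp
      also have "\<dots> = ennreal (2 powr ((\<alpha> - ?Q) * k) * (M * (1 + 2 powr ?Q) * N * ?v)) * epowr (havg (\<lambda>h. epowr (f h) s) g ?r) (1 / s)"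
        using M b(3) v by (subst ennreal_mult) (auto simp: less_imp_le mult.assoc)
      also have "2 powr ((\<alpha> - ?Q) * k) * (M * (1 + 2 powr ?Q) * N * ?v) = C * N * 2 powr (\<alpha> * k)"
      proof -
        have "?v = unit_vol TYPE('n) * 2 powr (?Q * k)" by (simp add: vol_def powr_powr mult.commute)
        moreover have "2 powr ((\<alpha> - ?Q) * k) * 2 powr (?Q * k) = 2 powr (\<alpha> * k)"
          by (simp add: powr_add[symmetric] algebra_simps)
        ultimately show ?thesis unfolding C_def by (simp add: mult_ac)
      qed
      finally show "ennreal (2 powr ((\<alpha> - ?Q) * k)) * (\<integral>\<^sup>+h. comm_weight b N k g h * f h \<partial>lebesgue)
        \<le> ennreal (C * N) * (ennreal (2 powr (\<alpha> * k)) * epowr (havg (\<lambda>h. epowr (f h) s) g ?r) (1 / s))"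
        using C b(3) by (simp add: ennreal_mult mult.assoc)
    qed
    also have "\<dots> = ennreal (C * N) * hed \<alpha> s f g"
      unfolding hed_def by (rule nn_integral_cmult) simp
    finally show ?thesis .
  qed
  with C show ?thesis by blast
qed

lemma comm_half_bounded:
  assumes p: "1 < p" and \<alpha>: "0 < \<alpha>" "\<alpha> < hdim TYPE('n::finite) / p" and q: "1 / q = 1 / p - \<alpha> / hdim TYPE('n)"
  shows "\<exists>C>0. \<forall>(b :: 'n heis \<Rightarrow> real) N f. b \<in> Lp_loc 1 \<longrightarrow> bmo_norm b \<le> ennreal N \<longrightarrow> 0 < N \<longrightarrow> f \<in> borel_measurable lebesgue \<longrightarrow>
    eLp q lebesgue (comm_half \<alpha> b N f) \<le> ennreal (C * N) * eLp p lebesgue f"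
proof -
  have "\<alpha> / hdim TYPE('n) < 1 / p" using \<alpha> p hdim_pos[where 'n='n] by (simp add: field_simps)
  then have q0: "0 < q" using q zero_less_divide_1_iff[of q] by simp
  \<comment> \<open>Any exponent strictly between 1 and p would do: \<open>s > 1\<close> makes the
    conjugate exponent finite for the oscillation estimate, \<open>s < p\<close> is required by the
    maximal theorem.\<close>
  define s where "s = (1 + p) / 2"
  have s: "1 < s" "s < p" using p by (auto simp: s_def)
  obtain C1 where C1: "0 < C1" "\<And>(b :: 'n heis \<Rightarrow> real) N f \<alpha> g. b \<in> Lp_loc 1 \<Longrightarrow> bmo_norm b \<le> ennreal N \<Longrightarrow> 0 < N \<Longrightarrow> f \<in> borel_measurable lebesgue \<Longrightarrow>
    comm_half \<alpha> b N f g \<le> ennreal (C1 * N) * hed \<alpha> s f g"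
    using comm_half_le_hed[OF s(1), where 'n='n] by blast
  obtain C2 where C2: "0 < C2" "\<And>f. f \<in> borel_measurable (lebesgue :: 'n heis measure) \<Longrightarrow>
    eLp q lebesgue (hed \<alpha> s f) \<le> ennreal C2 * eLp p lebesgue f"
    using hed_bounded[OF less_imp_le[OF s(1)] s(2) \<alpha> q] by blast
  have "eLp q lebesgue (comm_half \<alpha> b N f) \<le> ennreal (C1 * C2 * N) * eLp p lebesgue f"
    if b: "b \<in> Lp_loc 1" "bmo_norm b \<le> ennreal N" "0 < N" and f [measurable]: "f \<in> borel_measurable lebesgue"
    for b :: "'n heis \<Rightarrow> real" and N f
  proof -
    have "eLp q lebesgue (comm_half \<alpha> b N f) \<le> eLp q lebesgue (\<lambda>g. ennreal (C1 * N) * hed \<alpha> s f g)"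
      by (intro eLp_mono q0 C1 b f)
    also have "\<dots> = ennreal (C1 * N) * eLp q lebesgue (hed \<alpha> s f)"
      by (intro eLp_cmult q0) measurable
    also have "\<dots> \<le> ennreal (C1 * N) * (ennreal C2 * eLp p lebesgue f)"
      by (intro mult_left_mono C2 f) simp
    also have "\<dots> = ennreal (C1 * C2 * N) * eLp p lebesgue f"
      using C1 C2 b(3) by (simp add: ennreal_mult mult_ac)
    finally show ?thesis .
  qed
  moreover have "0 < C1 * C2" using C1 C2 by simp
  ultimately show ?thesis by blast
qed

lemma comm_bounded:
  assumes p: "1 < p" and \<alpha>: "0 < \<alpha>" "\<alpha> < hdim TYPE('n::finite) / p" and q: "1 / q = 1 / p - \<alpha> / hdim TYPE('n)"
  shows "\<exists>C>0. \<forall>(b :: 'n heis \<Rightarrow> real) N f. b \<in> Lp_loc 1 \<longrightarrow> bmo_norm b \<le> ennreal N \<longrightarrow> 0 < N \<longrightarrow> f \<in> borel_measurable lebesgue \<longrightarrow>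
    eLp q lebesgue (comm \<alpha> b f) \<le> ennreal (C * N) * eLp p lebesgue f"
proof -
  let ?Q = "hdim TYPE('n)"
  have Q: "0 < ?Q" by simp
  define p' q' where "p' = p / (p - 1)" and "q' = q / (q - 1)"
  have "\<alpha> / ?Q < 1 / p" using \<alpha> p Q by (simp add: field_simps)
  then have q0: "0 < q" "p < q"
  proof -
    show "0 < q" using \<open>\<alpha> / ?Q < 1 / p\<close> q zero_less_divide_1_iff[of q] by simp
    moreover have "1 / q < 1 / p" using q \<alpha> Q by simp
    ultimately show "p < q" using p by (simp add: field_simps)
  qed
  have q1: "1 < q" using q0 p by simp
  have p': "1 < p'" "1 / p + 1 / p' = 1" using p by (auto simp: p'_def field_simps)
  have q': "1 < q'" "1 / q + 1 / q' = 1" using q1 by (auto simp: q'_def field_simps)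
  \<comment> \<open>The dual exponents satisfy the same relation, with q' as source and p' as
    target. The bound for \<open>comm_half\<close> therefore applies a second time, now to the test
    function \<open>u\<close>.\<close>
  have eq': "1 / p' = 1 / q' - \<alpha> / ?Q" using p' q' q by linarith
  have "0 < 1 / p'" using p' by simp
  then have "\<alpha> / ?Q < 1 / q'" using eq' by linarith
  then have \<alpha>': "\<alpha> < ?Q / q'" using Q q' by (simp add: field_simps)
  obtain C1 where C1: "0 < C1" "\<And>(b :: 'n heis \<Rightarrow> real) N f. b \<in> Lp_loc 1 \<Longrightarrow> bmo_norm b \<le> ennreal N \<Longrightarrow> 0 < N \<Longrightarrow> f \<in> borel_measurable lebesgue \<Longrightarrow>
    eLp q lebesgue (comm_half \<alpha> b N f) \<le> ennreal (C1 * N) * eLp p lebesgue f"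
    using comm_half_bounded[OF p \<alpha> q] by blast
  obtain C2 where C2: "0 < C2" "\<And>(b :: 'n heis \<Rightarrow> real) N f. b \<in> Lp_loc 1 \<Longrightarrow> bmo_norm b \<le> ennreal N \<Longrightarrow> 0 < N \<Longrightarrow> f \<in> borel_measurable lebesgue \<Longrightarrow>
    eLp p' lebesgue (comm_half \<alpha> b N f) \<le> ennreal (C2 * N) * eLp q' lebesgue f"
    using comm_half_bounded[OF q'(1) \<alpha>(1) \<alpha>' eq'] by blast
  let ?D = "2 powr (?Q - \<alpha>)"
  have \<alpha>Q: "\<alpha> < ?Q"
  proof -
    have "?Q / p \<le> ?Q" using p Q by (simp add: field_simps)
    then show ?thesis using \<alpha> by linarith
  qed
  define C where "C = ?D * (C1 + C2)"
  have "eLp q lebesgue (comm \<alpha> b f) \<le> ennreal (C * N) * eLp p lebesgue f"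
    if b: "b \<in> Lp_loc 1" "bmo_norm b \<le> ennreal N" "0 < N" and f [measurable]: "f \<in> borel_measurable lebesgue"
    for b :: "'n heis \<Rightarrow> real" and N f
  proof -
    have bm [measurable]: "b \<in> borel_measurable lebesgue" using b(1) by (rule Lp_loc_measurable)
    show ?thesis
    proof (rule eLp_le_by_duality[OF _ q1 q'(2)])
      fix u :: "'n heis \<Rightarrow> ennreal" assume u [measurable]: "u \<in> borel_measurable lebesgue"
      have "(\<integral>\<^sup>+g. u g * comm \<alpha> b f g \<partial>lebesgue)
        \<le> (\<integral>\<^sup>+g. ennreal ?D * (comm_half \<alpha> b N f g * u g + u g * comm_half_adj \<alpha> b N f g) \<partial>lebesgue)"
      proof (intro nn_integral_mono)
        fix g
        have "u g * comm \<alpha> b f g \<le> u g * (ennreal ?D * (comm_half \<alpha> b N f g + comm_half_adj \<alpha> b N f g))"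
          by (intro mult_left_mono comm_le_halves b \<alpha>Q f) simp
        then show "u g * comm \<alpha> b f g \<le> ennreal ?D * (comm_half \<alpha> b N f g * u g + u g * comm_half_adj \<alpha> b N f g)"
          by (simp add: distrib_left mult_ac)
      qed
      also have "\<dots> = ennreal ?D * (\<integral>\<^sup>+g. comm_half \<alpha> b N f g * u g + u g * comm_half_adj \<alpha> b N f g \<partial>lebesgue)"
        by (rule nn_integral_cmult) measurable
      also have "(\<integral>\<^sup>+g. comm_half \<alpha> b N f g * u g + u g * comm_half_adj \<alpha> b N f g \<partial>lebesgue)
        = (\<integral>\<^sup>+g. comm_half \<alpha> b N f g * u g \<partial>lebesgue) + (\<integral>\<^sup>+g. u g * comm_half_adj \<alpha> b N f g \<partial>lebesgue)"
        by (rule nn_integral_add) measurable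
      also have "(\<integral>\<^sup>+g. u g * comm_half_adj \<alpha> b N f g \<partial>lebesgue) = (\<integral>\<^sup>+g. f g * comm_half \<alpha> b N u g \<partial>lebesgue)"
        by (rule comm_half_adjoint) measurable
      also have "(\<integral>\<^sup>+g. comm_half \<alpha> b N f g * u g \<partial>lebesgue) + (\<integral>\<^sup>+g. f g * comm_half \<alpha> b N u g \<partial>lebesgue)
        \<le> eLp q lebesgue (comm_half \<alpha> b N f) * eLp q' lebesgue u + eLp p lebesgue f * eLp p' lebesgue (comm_half \<alpha> b N u)"
        using p p' q1 q' by (intro add_mono Hoelder_eLp comm_half_measurable bm f u) auto
      also have "\<dots> \<le> (ennreal (C1 * N) * eLp p lebesgue f) * eLp q' lebesgue u
         + eLp p lebesgue f * (ennreal (C2 * N) * eLp q' lebesgue u)"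
        by (intro add_mono mult_left_mono mult_right_mono C1 C2 b f u) simp_all
      also have "ennreal ?D * \<dots> = ennreal (C * N) * eLp p lebesgue f * eLp q' lebesgue u"
      proof -
        have "ennreal (C * N) = ennreal ?D * (ennreal (C1 * N) + ennreal (C2 * N))"
        proof -
          have "C * N = ?D * (C1 * N + C2 * N)" by (simp add: C_def algebra_simps)
          then show ?thesis using C1 C2 b(3) by (simp only:) (subst ennreal_mult, simp_all)
        qed
        then show ?thesis by (simp add: distrib_left distrib_right mult_ac)
      qed
      finally show "(\<integral>\<^sup>+g. u g * comm \<alpha> b f g \<partial>lebesgue) \<le> ennreal (C * N) * eLp p lebesgue f * eLp q' lebesgue u"
        by (simp add: mult_left_mono)
    qed measurable
  qed
  moreover have "0 < C" using C1 C2 by (simp add: C_def)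
  ultimately show ?thesis by blast
qed

section \<open>Pointwise domination of the operator by the positive commutator\<close>

text \<open>Used both for truncation in height and for truncation in space. Finiteness of the
  integral is what makes the remainder small.\<close>

lemma nn_integral_tail:
  assumes F: "F \<in> borel_measurable M" "(\<integral>\<^sup>+x. F x \<partial>M) < top"
    and G: "\<And>n. G n \<in> borel_measurable M" "incseq G" "\<And>x. (SUP n. G n x) = F x" and e: "0 < e"
  shows "\<exists>n::nat. (\<integral>\<^sup>+x. F x - G n x \<partial>M) \<le> ennreal e"
proof (cases "(\<integral>\<^sup>+x. F x \<partial>M) = 0")
  case True
  have "(\<integral>\<^sup>+x. F x - G 0 x \<partial>M) \<le> (\<integral>\<^sup>+x. F x \<partial>M)"
    by (intro nn_integral_mono) (simp add: diff_le_self_ennreal)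
  then show ?thesis using True by (intro exI[of _ 0]) simp
next
  case False
  have le: "G n x \<le> F x" for n x
    unfolding G(3)[of x, symmetric] by (rule SUP_upper) simp
  have "(\<integral>\<^sup>+x. F x \<partial>M) - ennreal e < (\<integral>\<^sup>+x. F x \<partial>M)"
    using False F e by (intro ennreal_between) (auto simp: zero_less_iff_neq_zero)
  also have "\<dots> = (SUP n. \<integral>\<^sup>+x. G n x \<partial>M)"
    unfolding G(3)[symmetric] by (rule nn_integral_monotone_convergence_SUP[OF G(2,1)])
  finally obtain n where n: "(\<integral>\<^sup>+x. F x \<partial>M) - ennreal e < (\<integral>\<^sup>+x. G n x \<partial>M)"
    by (auto simp: less_SUP_iff)
  have Gfin: "(\<integral>\<^sup>+x. G n x \<partial>M) \<noteq> \<infinity>"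
    using F(2) nn_integral_mono[of M "G n" F] le by (metis infinity_ennreal_def le_less_trans order_less_irrefl)
  have "(\<integral>\<^sup>+x. F x - G n x \<partial>M) = (\<integral>\<^sup>+x. F x \<partial>M) - (\<integral>\<^sup>+x. G n x \<partial>M)"
    by (rule nn_integral_diff[OF F(1) G(1) Gfin]) (simp add: le)
  also have "\<dots> \<le> ennreal e"
    using less_imp_le[OF n] Gfin by (simp add: ennreal_minus_le_iff add.commute)
  finally show ?thesis by blast
qed

lemma ennreal_eq_0_if_small:
  assumes \<gamma>: "0 < \<gamma>" and small: "\<And>\<delta>. 0 < \<delta> \<Longrightarrow> x \<le> ennreal B * epowr (ennreal \<delta>) \<gamma>"
  shows "x = 0"
proof -
  have "x \<le> 0"
  proof (rule ennreal_le_epsilon)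
    fix e :: real assume e: "0 < e"
    define \<delta> where "\<delta> = (e / (\<bar>B\<bar> + 1)) powr (1 / \<gamma>)"
    have \<delta>: "0 < \<delta>" "\<delta> powr \<gamma> = e / (\<bar>B\<bar> + 1)" using e \<gamma> by (auto simp: \<delta>_def powr_powr)
    have "x \<le> ennreal B * ennreal (e / (\<bar>B\<bar> + 1))" using small[OF \<delta>(1)] \<delta> by simp
    also have "\<dots> \<le> ennreal \<bar>B\<bar> * ennreal (e / (\<bar>B\<bar> + 1))" by (intro mult_right_mono ennreal_leI) auto
    also have "\<dots> = ennreal (\<bar>B\<bar> * (e / (\<bar>B\<bar> + 1)))" using e by (intro ennreal_mult[symmetric]) auto
    also have "\<dots> \<le> ennreal e" using e by (intro ennreal_leI) (simp add: field_simps)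
    finally show "x \<le> 0 + ennreal e" by simp
  qed
  then show ?thesis by simp
qed

section \<open>The spaces L_p and the hypotheses on the operator in terms of
  \<open>eLp\<close>\<close>

lemma Lp_space_iff:
  assumes "0 < p"
  shows "f \<in> Lp_space p \<longleftrightarrow> f \<in> borel_measurable lebesgue \<and> (\<integral>\<^sup>+x. epowr (ennreal \<bar>f x\<bar>) p \<partial>lebesgue) < top"
  using assms unfolding Lp_space_def by (auto simp: integrable_iff_bounded measurable_abs_powr)

lemma eLp_eq_Lp_norm:
  assumes "0 < p" "f \<in> Lp_space p"
  shows "eLp p lebesgue (\<lambda>x. ennreal \<bar>f x\<bar>) = ennreal (Lp_norm p UNIV f)"
proof -
  have "(\<integral>\<^sup>+x. epowr (ennreal \<bar>f x\<bar>) p \<partial>lebesgue) = ennreal (LINT x|lebesgue. \<bar>f x\<bar> powr p)"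
    using assms by (simp add: Lp_space_def nn_integral_eq_integral)
  then show ?thesis
    by (simp add: eLp_def Lp_norm_def set_lebesgue_integral_def integral_nonneg_AE)
qed

lemma bounded_LpD:
  assumes pq: "0 < p" "0 < q" and "bounded_Lp p q T"
  shows "\<exists>K\<ge>0. \<forall>f\<in>Lp_space p. T f \<in> Lp_space q \<and>
    eLp q lebesgue (\<lambda>x. ennreal \<bar>T f x\<bar>) \<le> ennreal K * eLp p lebesgue (\<lambda>x. ennreal \<bar>f x\<bar>)"
proof -
  obtain K where K: "\<And>f. f \<in> Lp_space p \<Longrightarrow> T f \<in> Lp_space q \<and> ennreal (Lp_norm q UNIV (T f)) \<le> ennreal K * ennreal (Lp_norm p UNIV f)"
    using assms(3) unfolding bounded_between_def by blast
  have "T f \<in> Lp_space q \<and> eLp q lebesgue (\<lambda>x. ennreal \<bar>T f x\<bar>) \<le> ennreal (max K 0) * eLp p lebesgue (\<lambda>x. ennreal \<bar>f x\<bar>)"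
    if f: "f \<in> Lp_space p" for f
  proof -
    have Tq: "T f \<in> Lp_space q" using K[OF f] by blast
    have "ennreal (Lp_norm q UNIV (T f)) \<le> ennreal K * ennreal (Lp_norm p UNIV f)" using K[OF f] by blast
    also have "\<dots> \<le> ennreal (max K 0) * ennreal (Lp_norm p UNIV f)"
      by (intro mult_right_mono ennreal_leI) auto
    finally show ?thesis
      unfolding eLp_eq_Lp_norm[OF pq(1) f] eLp_eq_Lp_norm[OF pq(2) Tq] using Tq by blast
  qed
  then show ?thesis by (intro exI[of _ "max K 0"]) auto
qed

lemma Lp_space_indicator_mult:
  assumes p: "0 < p" and f: "f \<in> Lp_space p" and A: "A \<in> sets lebesgue"
  shows "(\<lambda>h. indicator A h * f h) \<in> Lp_space p"
proof -
  have "f \<in> borel_measurable lebesgue" and fin: "(\<integral>\<^sup>+x. epowr (ennreal \<bar>f x\<bar>) p \<partial>lebesgue) < top"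
    using f unfolding Lp_space_iff[OF p] by auto
  then have "(\<lambda>h. indicator A h * f h) \<in> borel_measurable lebesgue" using A by measurable
  moreover have "(\<integral>\<^sup>+x. epowr (ennreal \<bar>indicator A x * f x\<bar>) p \<partial>lebesgue) \<le> (\<integral>\<^sup>+x. epowr (ennreal \<bar>f x\<bar>) p \<partial>lebesgue)"
    by (intro nn_integral_mono) (auto simp: indicator_def)
  ultimately show ?thesis unfolding Lp_space_iff[OF p] using fin le_less_trans by blast
qed

lemma Lp_space_add:
  assumes p: "0 < p" and f: "f \<in> Lp_space p" and g: "g \<in> Lp_space p"
  shows "(\<lambda>h. f h + g h) \<in> Lp_space p"
proof -
  have [measurable]: "f \<in> borel_measurable lebesgue" "g \<in> borel_measurable lebesgue"
    and fin: "(\<integral>\<^sup>+x. epowr (ennreal \<bar>f x\<bar>) p \<partial>lebesgue) < top" "(\<integral>\<^sup>+x. epowr (ennreal \<bar>g x\<bar>) p \<partial>lebesgue) < top"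
    using f g unfolding Lp_space_iff[OF p] by auto
  have "(\<integral>\<^sup>+x. epowr (ennreal \<bar>f x + g x\<bar>) p \<partial>lebesgue)
      \<le> (\<integral>\<^sup>+x. ennreal (2 powr p) * (epowr (ennreal \<bar>f x\<bar>) p + epowr (ennreal \<bar>g x\<bar>) p) \<partial>lebesgue)"
  proof (intro nn_integral_mono)
    fix x
    have "ennreal \<bar>f x + g x\<bar> \<le> ennreal \<bar>f x\<bar> + ennreal \<bar>g x\<bar>"
      by (simp add: ennreal_plus[symmetric] ennreal_leI abs_triangle_ineq del: ennreal_plus)
    then have "epowr (ennreal \<bar>f x + g x\<bar>) p \<le> epowr (ennreal \<bar>f x\<bar> + ennreal \<bar>g x\<bar>) p"
      using p by (intro epowr_mono) auto
    also have "\<dots> \<le> ennreal (2 powr p) * (epowr (ennreal \<bar>f x\<bar>) p + epowr (ennreal \<bar>g x\<bar>) p)"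
      using p by (intro epowr_add_le) auto
    finally show "epowr (ennreal \<bar>f x + g x\<bar>) p \<le> ennreal (2 powr p) * (epowr (ennreal \<bar>f x\<bar>) p + epowr (ennreal \<bar>g x\<bar>) p)" .
  qed
  also have "\<dots> = ennreal (2 powr p) * ((\<integral>\<^sup>+x. epowr (ennreal \<bar>f x\<bar>) p \<partial>lebesgue) + (\<integral>\<^sup>+x. epowr (ennreal \<bar>g x\<bar>) p \<partial>lebesgue))"
    by (simp add: nn_integral_cmult nn_integral_add)
  also have "\<dots> < top"
    using fin by (simp add: ennreal_mult_less_top)
  finally show ?thesis unfolding Lp_space_iff[OF p] by simp
qed

lemma Lp_space_sum:
  assumes p: "0 < p" and "finite I" "I \<noteq> {}" "\<And>i. i \<in> I \<Longrightarrow> f i \<in> Lp_space p"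
  shows "(\<lambda>h. \<Sum>i\<in>I. f i h) \<in> Lp_space p"
  using assms(2-) by (induction rule: finite_ne_induct) (auto intro: Lp_space_add[OF p])

text \<open>The index set is nonempty because sublinearity alone gives no bound for the value of
  \<open>T\<close> at the zero function.\<close>

lemma sublinear_on_sum:
  assumes T: "sublinear_on (Lp_space p) T" and p: "0 < p"
    and "finite I" "I \<noteq> {}" "\<And>i. i \<in> I \<Longrightarrow> f i \<in> Lp_space p"
  shows "AE g in lebesgue. \<bar>T (\<lambda>h. \<Sum>i\<in>I. f i h) g\<bar> \<le> (\<Sum>i\<in>I. \<bar>T (f i) g\<bar>)"
  using assms(3-)
proof (induction rule: finite_ne_induct)
  case (insert i I)
  have "(\<lambda>h. \<Sum>i\<in>I. f i h) \<in> Lp_space p" using insert by (intro Lp_space_sum p) auto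
  then have "AE g in lebesgue. \<bar>T (\<lambda>h. f i h + (\<Sum>i\<in>I. f i h)) g\<bar> \<le> \<bar>T (f i) g\<bar> + \<bar>T (\<lambda>h. \<Sum>i\<in>I. f i h) g\<bar>"
    using T insert unfolding sublinear_on_def by auto
  moreover have "AE g in lebesgue. \<bar>T (\<lambda>h. \<Sum>i\<in>I. f i h) g\<bar> \<le> (\<Sum>i\<in>I. \<bar>T (f i) g\<bar>)"
    using insert by auto
  ultimately show ?case
  proof eventually_elim
    case (elim g)
    then show ?case using insert.hyps by simp
  qed
qed auto

lemma comm_mono: "(\<And>h. f h \<le> f' h) \<Longrightarrow> comm \<alpha> b f g \<le> comm \<alpha> b f' g"
  unfolding comm_def by (intro nn_integral_mono mult_left_mono) auto

lemma size_condition_comm: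
  fixes b :: "'n::finite heis \<Rightarrow> real"
  assumes "size_condition \<alpha> c0 b T" "f \<in> Lp_space 1" "compact (closure {h. f h \<noteq> 0})"
  shows "AE g in lebesgue. g \<notin> closure {h. f h \<noteq> 0} \<longrightarrow> ennreal \<bar>T f g\<bar> \<le> ennreal c0 * comm \<alpha> b (\<lambda>h. ennreal \<bar>f h\<bar>) g"
proof -
  have eq: "ennreal (\<bar>b g - b h\<bar> * (\<bar>f h\<bar> / hdist g h powr (hdim TYPE('n) - \<alpha>)))
     = ennreal (\<bar>b g - b h\<bar> * riesz \<alpha> g h) * ennreal \<bar>f h\<bar>" for g h
    by (subst ennreal_mult[symmetric]) (auto simp: riesz_def)
  show ?thesis using assms unfolding size_condition_def comm_def eq[symmetric] by blast
qed

text \<open>Slabs of thickness 1 / m in the central coordinate. They partition the group, their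
  faces are null sets, and their intersections with a fixed ball become uniformly small.\<close>

definition slab :: "nat \<Rightarrow> int \<Rightarrow> 'n::finite heis set" where
  "slab m i = {h. \<lfloor>real m * snd h\<rfloor> = i}"

lemma slab_borel: "slab m i \<in> sets borel"
proof -
  have "slab m i = (\<lambda>h. real m * snd h) -` {of_int i..<of_int i + 1} \<inter> space borel"
    by (auto simp: slab_def floor_eq_iff)
  also have "\<dots> \<in> sets borel"
    by (intro measurable_sets[of _ borel borel] borel_measurable_continuous_onI continuous_intros) auto
  finally show ?thesis .
qed

lemma slab_lebesgue [measurable]: "slab m i \<in> sets lebesgue"
  by (intro sets_completionI_sets) (simp add: slab_borel)

lemma slab_hball_emeasure_le:
  fixes R :: real
  assumes "0 < m" "0 < R"
  shows "emeasure lebesgue (slab m i \<inter> hball (0 :: 'n::finite heis) R)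
    \<le> emeasure lborel (cball (0 :: (real ^ 2) ^ 'n) R) * ennreal (1 / real m)"
proof -
  let ?J = "{of_int i / real m..(of_int i + 1) / real m}"
  have "emeasure lebesgue (slab m i \<inter> hball (0 :: 'n heis) R) \<le> emeasure lebesgue (cball (0 :: (real ^ 2) ^ 'n) R \<times> ?J)"
  proof (rule emeasure_mono)
    show "slab m i \<inter> hball 0 R \<subseteq> cball (0 :: (real ^ 2) ^ 'n) R \<times> ?J"
      using hball_0_subset[of R, where 'a='n] assms
      by (auto simp: slab_def floor_eq_iff field_simps mem_Times_iff)
    show "cball (0 :: (real ^ 2) ^ 'n) R \<times> ?J \<in> sets lebesgue"
      by (intro sets_completionI_sets) (simp add: borel_closed closed_Times)
  qed
  also have "\<dots> = emeasure lborel (cball (0 :: (real ^ 2) ^ 'n) R \<times> ?J)"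
    by (intro emeasure_lebesgue_eq) (simp add: borel_closed closed_Times)
  also have "\<dots> = emeasure lborel (cball (0 :: (real ^ 2) ^ 'n) R) * emeasure lborel ?J"
    unfolding lborel_prod[symmetric] by (rule lborel.emeasure_pair_measure_Times) auto
  also have "emeasure lborel ?J = ennreal (1 / real m)"
    using assms by (simp add: divide_right_mono diff_divide_distrib[symmetric])
  finally show ?thesis .
qed

text \<open>Absolute continuity of the integral, uniformly in the slab: the part of \<open>F\<close>
  above height n has small integral, and the rest contributes at most n times the volume of the slab
  inside the ball, which is of order 1 / m.\<close>

lemma small_slabs:
  fixes F :: "'n::finite heis \<Rightarrow> ennreal"
  assumes [measurable]: "F \<in> borel_measurable lebesgue" and fin: "(\<integral>\<^sup>+h. F h \<partial>lebesgue) < top" "\<And>h. F h < top"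
    and R: "0 < R" "\<And>h. h \<notin> hball 0 R \<Longrightarrow> F h = 0" and e: "0 < e"
  shows "\<exists>m>0. \<forall>i. (\<integral>\<^sup>+h. F h * indicator (slab m i) h \<partial>lebesgue) \<le> ennreal e"
proof -
  have "\<exists>n::nat. (\<integral>\<^sup>+h. F h - min (F h) (of_nat n) \<partial>lebesgue) \<le> ennreal (e / 2)"
  proof (rule nn_integral_tail)
    show "incseq (\<lambda>n h. min (F h) (of_nat n))"
      by (auto simp: incseq_def le_fun_def intro: min.coboundedI2)
    show "(SUP n. min (F h) (of_nat n)) = F h" for h
    proof (rule antisym)
      obtain r where r: "F h = ennreal r" "0 \<le> r" using fin(2)[of h] unfolding less_top_ennreal by blast
      obtain n where "r \<le> real n" using real_arch_simple by blast
      then have "min (F h) (of_nat n) = F h"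
        using r by (simp add: min_def ennreal_of_nat_eq_real_of_nat ennreal_leI)
      then show "F h \<le> (SUP n. min (F h) (of_nat n))" by (intro SUP_upper2[of n]) auto
    qed (auto intro: SUP_least)
  qed (use fin e in auto)
  then obtain n :: nat where n: "(\<integral>\<^sup>+h. F h - min (F h) (of_nat n) \<partial>lebesgue) \<le> ennreal (e / 2)" by blast
  obtain c where c: "emeasure lborel (cball (0 :: (real ^ 2) ^ 'n) R) = ennreal c" "0 \<le> c"
    using emeasure_bounded_finite[of "cball (0 :: (real ^ 2) ^ 'n) R"] unfolding infinity_ennreal_def less_top_ennreal by auto
  obtain m0 :: nat where m0: "real n * c * 2 / e \<le> real m0" using real_arch_simple by blast
  define m where "m = Suc m0"
  have m: "0 < m" "real n * (c * (1 / real m)) \<le> e / 2"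
    using m0 e by (auto simp: m_def field_simps)
  have "(\<integral>\<^sup>+h. F h * indicator (slab m i) h \<partial>lebesgue) \<le> ennreal e" for i
  proof -
    have "(\<integral>\<^sup>+h. F h * indicator (slab m i) h \<partial>lebesgue)
      \<le> (\<integral>\<^sup>+h. (F h - min (F h) (of_nat n)) + of_nat n * indicator (slab m i \<inter> hball (0 :: 'n heis) R) h \<partial>lebesgue)"
    proof (intro nn_integral_mono)
      fix h
      have "F h = (F h - min (F h) (of_nat n)) + min (F h) (of_nat n)"
        by (rule diff_add_cancel_ennreal[symmetric]) simp
      also have "\<dots> \<le> (F h - min (F h) (of_nat n)) + of_nat n" by (intro add_left_mono) simp
      finally show "F h * indicator (slab m i) h
        \<le> (F h - min (F h) (of_nat n)) + of_nat n * indicator (slab m i \<inter> hball (0 :: 'n heis) R) h"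
        using R(2)[of h] by (auto simp: indicator_def)
    qed
    also have "\<dots> = (\<integral>\<^sup>+h. F h - min (F h) (of_nat n) \<partial>lebesgue)
        + of_nat n * emeasure lebesgue (slab m i \<inter> hball (0 :: 'n heis) R)"
    proof -
      have S [measurable]: "slab m i \<inter> hball (0 :: 'n heis) R \<in> sets lebesgue" by (intro sets.Int slab_lebesgue hball_lebesgue)
      have "(\<integral>\<^sup>+h. (F h - min (F h) (of_nat n)) + of_nat n * indicator (slab m i \<inter> hball (0 :: 'n heis) R) h \<partial>lebesgue)
        = (\<integral>\<^sup>+h. F h - min (F h) (of_nat n) \<partial>lebesgue) + (\<integral>\<^sup>+h. of_nat n * indicator (slab m i \<inter> hball (0 :: 'n heis) R) h \<partial>lebesgue)"
        by (rule nn_integral_add) measurable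
      then show ?thesis by (simp only: nn_integral_cmult_indicator[OF S])
    qed
    also have "\<dots> \<le> ennreal (e / 2) + of_nat n * (ennreal c * ennreal (1 / real m))"
      using slab_hball_emeasure_le[OF m(1) R(1), of i, where 'n='n] unfolding c
      by (intro add_mono n mult_left_mono) auto
    also have "\<dots> = ennreal (e / 2 + real n * (c * (1 / real m)))"
    proof -
      have "of_nat n * (ennreal c * ennreal (1 / real m)) = ennreal (real n * (c * (1 / real m)))"
        using c by (simp add: ennreal_of_nat_eq_real_of_nat ennreal_mult[symmetric])
      moreover have "0 \<le> real n * (c * (1 / real m))" using c by simp
      ultimately show ?thesis using e by (simp only: ennreal_plus[symmetric] half_gt_zero less_imp_le)
    qed
    also have "\<dots> \<le> ennreal e" using m(2) by (intro ennreal_leI) linarith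
    finally show ?thesis .
  qed
  with m show ?thesis by blast
qed

context
  fixes p q \<alpha> c0 :: real and b :: "'n::finite heis \<Rightarrow> real" and T :: "('n heis \<Rightarrow> real) \<Rightarrow> 'n heis \<Rightarrow> real"
  assumes p: "1 \<le> p" and pq: "p < q" and b: "b \<in> borel_measurable lebesgue"
    and sub: "sublinear_on (Lp_space p) T" and size: "size_condition \<alpha> c0 b T" and bdd: "bounded_Lp p q T"
begin

text \<open>At almost every point g of slab j, all pieces of \<open>f\<close> except the j-th have g
  outside their closed supports. The size condition bounds these together by the commutator, and the
  excess of |T f| over it is at most |T| of the j-th piece. The q-norms of these pieces sum to an
  arbitrarily small quantity, so the excess vanishes almost everywhere.\<close>

lemma domination_bounded_support:
  assumes f: "f \<in> Lp_space p" and R: "0 < R" "\<And>h. h \<notin> hball 0 R \<Longrightarrow> f h = 0"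
  shows "AE g in lebesgue. ennreal \<bar>T f g\<bar> \<le> ennreal c0 * comm \<alpha> b (\<lambda>h. ennreal \<bar>f h\<bar>) g"
proof -
  note b [measurable]
  have p0: "0 < p" "0 < q" "0 < q / p - 1" using p pq by auto
  have fm [measurable]: "f \<in> borel_measurable lebesgue" and fin: "(\<integral>\<^sup>+x. epowr (ennreal \<bar>f x\<bar>) p \<partial>lebesgue) < top"
    using f unfolding Lp_space_iff[OF p0(1)] by auto
  obtain K where K: "0 \<le> K" "\<And>f. f \<in> Lp_space p \<Longrightarrow> T f \<in> Lp_space q"
     "\<And>f. f \<in> Lp_space p \<Longrightarrow> eLp q lebesgue (\<lambda>x. ennreal \<bar>T f x\<bar>) \<le> ennreal K * eLp p lebesgue (\<lambda>x. ennreal \<bar>f x\<bar>)"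
    using bounded_LpD[OF p0(1,2) bdd] by blast
  have Tm: "T f \<in> borel_measurable lebesgue" if "f \<in> Lp_space p" for f
    using K(2)[OF that] unfolding Lp_space_iff[OF p0(2)] by simp
  note Tfm [measurable] = Tm[OF f]
  define D where "D g = ennreal c0 * comm \<alpha> b (\<lambda>h. ennreal \<bar>f h\<bar>) g" for g
  have [measurable]: "D \<in> borel_measurable lebesgue" unfolding D_def by measurable
  \<comment> \<open>Truncated subtraction in \<open>ennreal\<close>: \<open>X g = 0\<close> says
    exactly that the domination holds at g, also where \<open>D g\<close> is infinite.\<close>
  define X where "X g = ennreal \<bar>T f g\<bar> - D g" for g
  have [measurable]: "X \<in> borel_measurable lebesgue" unfolding X_def by measurable
  define A where "A = (\<integral>\<^sup>+x. epowr (ennreal \<bar>f x\<bar>) p \<partial>lebesgue)"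
  have small: "(\<integral>\<^sup>+g. epowr (X g) q \<partial>lebesgue) \<le> epowr (ennreal K) q * (epowr (ennreal \<delta>) (q / p - 1) * A)"
    if \<delta>: "0 < \<delta>" for \<delta>
  proof -
    obtain m where m: "0 < m" "\<And>i. (\<integral>\<^sup>+h. epowr (ennreal \<bar>f h\<bar>) p * indicator (slab m i) h \<partial>lebesgue) \<le> ennreal \<delta>"
      using small_slabs[of "\<lambda>h. epowr (ennreal \<bar>f h\<bar>) p" R \<delta>] fin R \<delta> by (auto simp: less_top[symmetric])
    \<comment> \<open>On the ball of radius R the central coordinate is at most R^2 in absolute
      value, so these finitely many slabs carry all of \<open>f\<close>.\<close>
    define L where "L = \<lceil>real m * R\<^sup>2\<rceil> + 1"
    define I where "I = {- L..L}"
    define u where "u i h = indicator (slab m i) h * f h" for i :: int and h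
    have I: "finite I" "I \<noteq> {}"
    proof -
      have "0 \<le> real m * R\<^sup>2" by simp
      then have "0 \<le> L" unfolding L_def by linarith
      then show "finite I" "I \<noteq> {}" by (auto simp: I_def)
    qed
    have u: "u i \<in> Lp_space p" for i unfolding u_def by (intro Lp_space_indicator_mult p0 f slab_lebesgue)
    have um [measurable]: "u i \<in> borel_measurable lebesgue" for i using u[of i] unfolding Lp_space_iff[OF p0(1)] by simp
    have u_sum: "(\<lambda>h. \<Sum>i\<in>I. u i h) = f"
    proof
      fix h
      have "\<lfloor>real m * snd h\<rfloor> \<in> I" if "f h \<noteq> 0"
      proof -
        have "h \<in> hball 0 R" using R(2) that by blast
        then have "\<bar>snd h\<bar> \<le> R\<^sup>2" using hball_0_subset[of R, where 'a='n] R(1) by (force simp: mem_Times_iff)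
        then have "\<bar>real m * snd h\<bar> \<le> real m * R\<^sup>2" by (simp add: abs_mult mult_left_mono)
        then show ?thesis unfolding I_def L_def atLeastAtMost_iff by linarith
      qed
      moreover have "(\<Sum>i\<in>I. u i h) = (\<Sum>i\<in>I. if i = \<lfloor>real m * snd h\<rfloor> then f h else 0)"
        unfolding u_def by (intro sum.cong) (auto simp: slab_def indicator_def)
      ultimately show "(\<Sum>i\<in>I. u i h) = f h" using I by (auto simp: sum.delta)
    qed
    have u_supp: "{h. u i h \<noteq> 0} \<subseteq> hball 0 R" for i using R(2) by (force simp: u_def simp del: mem_hball)
    have u_slab: "closure {h. u i h \<noteq> 0} \<subseteq> {h. of_int i \<le> real m * snd h \<and> real m * snd h \<le> of_int i + 1}" for i
      by (rule closure_minimal)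
         (auto simp: u_def slab_def floor_eq_iff less_imp_le indicator_def split: if_splits intro!: closed_Collect_conj closed_Collect_le continuous_intros)
    \<comment> \<open>The size condition is available only for integrable functions of compact
      support. On the ball |f| is at most 1 + |f|^p, because \<open>p \<ge> 1\<close>.\<close>
    have u1: "u i \<in> Lp_space 1" for i
    proof -
      have "(\<integral>\<^sup>+x. epowr (ennreal \<bar>u i x\<bar>) 1 \<partial>lebesgue) \<le> (\<integral>\<^sup>+x. indicator (hball 0 R) x + epowr (ennreal \<bar>f x\<bar>) p \<partial>lebesgue)"
      proof (intro nn_integral_mono)
        fix x
        have "ennreal \<bar>f x\<bar> \<le> 1 + epowr (ennreal \<bar>f x\<bar>) p"
        proof (cases "\<bar>f x\<bar> \<le> 1")
          case True
          then have "ennreal \<bar>f x\<bar> \<le> 1" by simp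
          then show ?thesis by (simp add: add_increasing2)
        next
          case False
          then have "\<bar>f x\<bar> \<le> \<bar>f x\<bar> powr p" using powr_mono[of 1 p "\<bar>f x\<bar>"] p by simp
          then show ?thesis by (simp add: add_increasing ennreal_leI)
        qed
        moreover have "ennreal \<bar>u i x\<bar> \<le> ennreal \<bar>f x\<bar>" by (auto simp: u_def indicator_def)
        ultimately have "ennreal \<bar>u i x\<bar> \<le> 1 + epowr (ennreal \<bar>f x\<bar>) p" by (rule order.trans[rotated])
        then show "epowr (ennreal \<bar>u i x\<bar>) 1 \<le> indicator (hball 0 R) x + epowr (ennreal \<bar>f x\<bar>) p"
          unfolding epowr_1 using R(2)[of x] by (cases "x \<in> hball 0 R") (simp_all add: u_def del: epowr_ennreal)
      qed
      also have "\<dots> = emeasure lebesgue (hball (0 :: 'n heis) R) + A"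
        unfolding A_def using hball_lebesgue[of "0 :: 'n heis" R] by (subst nn_integral_add) auto
      also have "\<dots> < top" using fin emeasure_hball_finite[of "0 :: 'n heis" R] unfolding A_def by simp
      finally show ?thesis unfolding Lp_space_iff[OF zero_less_one] using um[of i] by blast
    qed
    have "AE g in lebesgue. \<forall>i. g \<notin> closure {h. u i h \<noteq> 0} \<longrightarrow> ennreal \<bar>T (u i) g\<bar> \<le> ennreal c0 * comm \<alpha> b (\<lambda>h. ennreal \<bar>u i h\<bar>) g"
    proof (subst AE_all_countable, intro allI size_condition_comm[OF size u1])
      show "compact (closure {h. u i h \<noteq> 0})" for i
        using bounded_subset[OF bounded_hball u_supp] by (simp add: compact_closure)
    qed
    \<comment> \<open>Away from the faces, a point of slab j lies in none of the other closed slabs,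
      hence outside the closed supports of all other pieces.\<close>
    moreover have "AE g :: 'n heis in lebesgue. \<forall>i::int. real m * snd g \<noteq> of_int i"
    proof (subst AE_all_countable, intro allI)
      fix i :: int
      have "{g :: 'n heis. \<not> real m * snd g \<noteq> of_int i} = {g. (0, 1) \<bullet> g = of_int i / real m}"
        using m by (auto simp: inner_prod_def field_simps)
      moreover have "negligible {g :: 'n heis. (0, 1) \<bullet> g = of_int i / real m}"
        by (rule negligible_hyperplane) (simp add: zero_prod_def)
      ultimately show "AE g :: 'n heis in lebesgue. real m * snd g \<noteq> of_int i"
        by (intro AE_I'[of "{g :: 'n heis. \<not> real m * snd g \<noteq> of_int i}"]) (auto simp: negligible_iff_null_sets)
    qed
    moreover have "AE g in lebesgue. \<bar>T f g\<bar> \<le> (\<Sum>i\<in>I. \<bar>T (u i) g\<bar>)"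
      using sublinear_on_sum[OF sub p0(1) I, of u] u unfolding u_sum by simp
    ultimately have "AE g in lebesgue. epowr (X g) q \<le> (\<Sum>i\<in>I. epowr (ennreal \<bar>T (u i) g\<bar>) q)"
    proof eventually_elim
      fix g
      assume sz: "\<forall>i. g \<notin> closure {h. u i h \<noteq> 0} \<longrightarrow> ennreal \<bar>T (u i) g\<bar> \<le> ennreal c0 * comm \<alpha> b (\<lambda>h. ennreal \<bar>u i h\<bar>) g"
        and ni: "\<forall>i. real m * snd g \<noteq> real_of_int i" and sm: "\<bar>T f g\<bar> \<le> (\<Sum>i\<in>I. \<bar>T (u i) g\<bar>)"
      define j where "j = \<lfloor>real m * snd g\<rfloor>"
      have j: "of_int j < real m * snd g" "real m * snd g < of_int j + 1"
        using ni[rule_format, of j] unfolding j_def by linarith+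
      have "ennreal \<bar>T (u i) g\<bar> \<le> ennreal c0 * comm \<alpha> b (\<lambda>h. ennreal \<bar>u i h\<bar>) g" if "i \<noteq> j" for i
      proof -
        have "\<not> (of_int i \<le> real m * snd g \<and> real m * snd g \<le> of_int i + 1)"
          using j that by linarith
        then have "g \<notin> closure {h. u i h \<noteq> 0}" using u_slab[of i] by blast
        then show ?thesis using sz by blast
      qed
      then have "(\<Sum>i\<in>I - {j}. ennreal \<bar>T (u i) g\<bar>) \<le> (\<Sum>i\<in>I - {j}. ennreal c0 * comm \<alpha> b (\<lambda>h. ennreal \<bar>u i h\<bar>) g)"
        by (intro sum_mono) auto
      also have "\<dots> = ennreal c0 * comm \<alpha> b (\<lambda>h. \<Sum>i\<in>I - {j}. ennreal \<bar>u i h\<bar>) g"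
      proof -
        have "(\<Sum>i\<in>I - {j}. comm \<alpha> b (\<lambda>h. ennreal \<bar>u i h\<bar>) g)
          = (\<integral>\<^sup>+h. (\<Sum>i\<in>I - {j}. ennreal (\<bar>b g - b h\<bar> * riesz \<alpha> g h) * ennreal \<bar>u i h\<bar>) \<partial>lebesgue)"
          unfolding comm_def
        proof (rule nn_integral_sum[symmetric])
          fix i
          have "(\<lambda>h. riesz \<alpha> g h) \<in> borel_measurable lebesgue"
            using measurable_compose[OF measurable_Pair1' riesz_measurable[of \<alpha>], of g] by simp
          then show "(\<lambda>h. ennreal (\<bar>b g - b h\<bar> * riesz \<alpha> g h) * ennreal \<bar>u i h\<bar>) \<in> borel_measurable lebesgue"
            using um[of i] by measurable
        qed
        then show ?thesis unfolding sum_distrib_left[symmetric] by (simp only: comm_def)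
      qed
      also have "\<dots> \<le> D g"
        unfolding D_def
      proof (intro mult_left_mono comm_mono)
        fix h
        have "(\<Sum>i\<in>I - {j}. ennreal \<bar>u i h\<bar>) \<le> (\<Sum>i\<in>I. ennreal \<bar>u i h\<bar>)" using I by (intro sum_mono2) auto
        also have "\<dots> = (\<Sum>i\<in>I. if i = \<lfloor>real m * snd h\<rfloor> then ennreal \<bar>f h\<bar> else 0)"
          unfolding u_def by (intro sum.cong) (auto simp: slab_def indicator_def)
        also have "\<dots> \<le> ennreal \<bar>f h\<bar>" using I by (simp add: sum.delta)
        finally show "(\<Sum>i\<in>I - {j}. ennreal \<bar>u i h\<bar>) \<le> ennreal \<bar>f h\<bar>" .
      qed simp
      finally have rest: "(\<Sum>i\<in>I - {j}. ennreal \<bar>T (u i) g\<bar>) \<le> D g" .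
      have "ennreal \<bar>T f g\<bar> \<le> (\<Sum>i\<in>I. ennreal \<bar>T (u i) g\<bar>)"
        using sm by (simp add: sum_ennreal ennreal_leI)
      show "epowr (X g) q \<le> (\<Sum>i\<in>I. epowr (ennreal \<bar>T (u i) g\<bar>) q)"
      proof (cases "j \<in> I")
        case True
        then have "ennreal \<bar>T f g\<bar> \<le> ennreal \<bar>T (u j) g\<bar> + D g"
          using \<open>ennreal \<bar>T f g\<bar> \<le> _\<close> rest I by (simp add: sum.remove[OF I(1) True]) (meson add_left_mono order.trans)
        then have "X g \<le> ennreal \<bar>T (u j) g\<bar>"
          unfolding X_def by (cases "D g = top") (auto simp: ennreal_minus_le_iff add.commute)
        then have "epowr (X g) q \<le> epowr (ennreal \<bar>T (u j) g\<bar>) q" using p0 by (intro epowr_mono) auto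
        also have "\<dots> \<le> (\<Sum>i\<in>I. epowr (ennreal \<bar>T (u i) g\<bar>) q)"
          using I True by (intro member_le_sum) auto
        finally show ?thesis .
      next
        \<comment> \<open>The point lies in a slab carrying none of \<open>f\<close>; every piece is
          then off-diagonal and there is no excess at all.\<close>
        case False
        then have "I - {j} = I" by auto
        then have "ennreal \<bar>T f g\<bar> \<le> D g"
          using \<open>ennreal \<bar>T f g\<bar> \<le> _\<close> rest by (metis order.trans)
        then have "X g = 0" unfolding X_def by (simp add: diff_eq_0_iff_ennreal)
        then show ?thesis by simp
      qed
    qed
    then have "(\<integral>\<^sup>+g. epowr (X g) q \<partial>lebesgue) \<le> (\<integral>\<^sup>+g. (\<Sum>i\<in>I. epowr (ennreal \<bar>T (u i) g\<bar>) q) \<partial>lebesgue)"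
      by (rule nn_integral_mono_AE)
    also have "\<dots> = (\<Sum>i\<in>I. \<integral>\<^sup>+g. epowr (ennreal \<bar>T (u i) g\<bar>) q \<partial>lebesgue)"
      using Tm[OF u] by (intro nn_integral_sum) measurable
    also have "\<dots> = (\<Sum>i\<in>I. epowr (eLp q lebesgue (\<lambda>g. ennreal \<bar>T (u i) g\<bar>)) q)"
      using p0 by (simp add: epowr_eLp)
    also have "\<dots> \<le> (\<Sum>i\<in>I. epowr (ennreal K) q * (epowr (ennreal \<delta>) (q / p - 1) * (\<integral>\<^sup>+h. epowr (ennreal \<bar>u i h\<bar>) p \<partial>lebesgue)))"
    proof (intro sum_mono)
      fix i
      let ?a = "\<integral>\<^sup>+h. epowr (ennreal \<bar>u i h\<bar>) p \<partial>lebesgue"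
      have "?a = (\<integral>\<^sup>+h. epowr (ennreal \<bar>f h\<bar>) p * indicator (slab m i) h \<partial>lebesgue)"
        unfolding u_def by (intro nn_integral_cong) (auto simp: indicator_def)
      then have a: "?a \<le> ennreal \<delta>" using m(2)[of i] by simp
      have "epowr (eLp q lebesgue (\<lambda>g. ennreal \<bar>T (u i) g\<bar>)) q \<le> epowr (ennreal K * eLp p lebesgue (\<lambda>h. ennreal \<bar>u i h\<bar>)) q"
        using p0 by (intro epowr_mono K(3) u) auto
      also have "\<dots> = epowr (ennreal K) q * epowr ?a (q / p)"
        by (simp add: epowr_mult eLp_def epowr_epowr)
      \<comment> \<open>Here q > p enters: the factor with exponent q/p - 1 > 0 is bounded by the
        thinness of the slab, and the remaining first power sums to \<open>A\<close> over all
        slabs.\<close>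
      also have "epowr ?a (q / p) = epowr ?a (q / p - 1) * ?a"
        using epowr_add[of "q / p - 1" 1 ?a] p0 by simp
      also have "\<dots> \<le> epowr (ennreal \<delta>) (q / p - 1) * ?a"
        using p0 by (intro mult_right_mono epowr_mono a) auto
      finally show "epowr (eLp q lebesgue (\<lambda>g. ennreal \<bar>T (u i) g\<bar>)) q
        \<le> epowr (ennreal K) q * (epowr (ennreal \<delta>) (q / p - 1) * ?a)" by (simp add: mult_left_mono)
    qed
    also have "\<dots> = epowr (ennreal K) q * (epowr (ennreal \<delta>) (q / p - 1) * (\<Sum>i\<in>I. \<integral>\<^sup>+h. epowr (ennreal \<bar>u i h\<bar>) p \<partial>lebesgue))"
      by (simp add: sum_distrib_left)
    also have "(\<Sum>i\<in>I. \<integral>\<^sup>+h. epowr (ennreal \<bar>u i h\<bar>) p \<partial>lebesgue) = (\<integral>\<^sup>+h. (\<Sum>i\<in>I. epowr (ennreal \<bar>u i h\<bar>) p) \<partial>lebesgue)"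
      by (rule nn_integral_sum[symmetric]) measurable
    also have "\<dots> \<le> A"
      unfolding A_def
    proof (intro nn_integral_mono)
      fix h
      have "(\<Sum>i\<in>I. epowr (ennreal \<bar>u i h\<bar>) p) = (\<Sum>i\<in>I. if i = \<lfloor>real m * snd h\<rfloor> then epowr (ennreal \<bar>f h\<bar>) p else 0)"
        unfolding u_def by (intro sum.cong) (auto simp: slab_def indicator_def)
      also have "\<dots> \<le> epowr (ennreal \<bar>f h\<bar>) p" using I by (simp add: sum.delta)
      finally show "(\<Sum>i\<in>I. epowr (ennreal \<bar>u i h\<bar>) p) \<le> epowr (ennreal \<bar>f h\<bar>) p" .
    qed
    finally show ?thesis by (simp add: mult_left_mono)
  qed
  obtain a where a: "A = ennreal a" "0 \<le> a" using fin unfolding A_def less_top_ennreal by blast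
  have "(\<integral>\<^sup>+g. epowr (X g) q \<partial>lebesgue) = 0"
  proof (rule ennreal_eq_0_if_small)
    fix \<delta> :: real assume "0 < \<delta>"
    from small[OF this]
    show "(\<integral>\<^sup>+g. epowr (X g) q \<partial>lebesgue) \<le> ennreal (K powr q * a) * epowr (ennreal \<delta>) (q / p - 1)"
      using K(1) a by (simp add: ennreal_mult mult_ac del: epowr_ennreal) (simp add: mult_ac)
  qed (use p0 in auto)
  then have "AE g in lebesgue. X g = 0" by (simp add: nn_integral_0_iff_AE)
  then show ?thesis unfolding X_def D_def by eventually_elim (simp add: diff_eq_0_iff_ennreal)
qed

text \<open>Split \<open>f\<close> at a large ball. The inner part obeys the previous lemma, so the
  excess is at most |T v| for the tail \<open>v\<close>, whose q-norm is at most K times the small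
  p-norm of \<open>v\<close>.\<close>

lemma domination_Lp:
  assumes f: "f \<in> Lp_space p"
  shows "AE g in lebesgue. ennreal \<bar>T f g\<bar> \<le> ennreal c0 * comm \<alpha> b (\<lambda>h. ennreal \<bar>f h\<bar>) g"
proof -
  note b [measurable]
  have p0: "0 < p" "0 < q" using p pq by auto
  have fm [measurable]: "f \<in> borel_measurable lebesgue" and fin: "(\<integral>\<^sup>+x. epowr (ennreal \<bar>f x\<bar>) p \<partial>lebesgue) < top"
    using f unfolding Lp_space_iff[OF p0(1)] by auto
  obtain K where K: "0 \<le> K" "\<And>f. f \<in> Lp_space p \<Longrightarrow> T f \<in> Lp_space q"
     "\<And>f. f \<in> Lp_space p \<Longrightarrow> eLp q lebesgue (\<lambda>x. ennreal \<bar>T f x\<bar>) \<le> ennreal K * eLp p lebesgue (\<lambda>x. ennreal \<bar>f x\<bar>)"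
    using bounded_LpD[OF p0 bdd] by blast
  have Tfm [measurable]: "T f \<in> borel_measurable lebesgue"
    using K(2)[OF f] unfolding Lp_space_iff[OF p0(2)] by simp
  define D where "D g = ennreal c0 * comm \<alpha> b (\<lambda>h. ennreal \<bar>f h\<bar>) g" for g
  have [measurable]: "D \<in> borel_measurable lebesgue" unfolding D_def by measurable
  define X where "X g = ennreal \<bar>T f g\<bar> - D g" for g
  have [measurable]: "X \<in> borel_measurable lebesgue" unfolding X_def by measurable
  have "(\<integral>\<^sup>+g. epowr (X g) q \<partial>lebesgue) = 0"
  proof (rule ennreal_eq_0_if_small)
    fix \<delta> :: real assume \<delta>: "0 < \<delta>"
    let ?F = "\<lambda>h. epowr (ennreal \<bar>f h\<bar>) p"
    have "\<exists>n::nat. (\<integral>\<^sup>+h. ?F h - ?F h * indicator (hball 0 (real n)) h \<partial>lebesgue) \<le> ennreal \<delta>"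
    proof (rule nn_integral_tail[OF _ fin _ _ _ \<delta>])
      show "(\<lambda>h. ?F h * indicator (hball 0 (real n)) h) \<in> borel_measurable lebesgue" for n
        using hball_lebesgue[of "0 :: 'n heis" "real n"] by measurable
      show "incseq (\<lambda>n h. ?F h * indicator (hball 0 (real n)) h)"
        by (auto simp: incseq_def le_fun_def indicator_def)
      show "(SUP n. ?F h * indicator (hball 0 (real n)) h) = ?F h" for h
      proof (rule antisym)
        obtain n :: nat where "hnorm h < real n" using reals_Archimedean2 by blast
        then show "?F h \<le> (SUP n. ?F h * indicator (hball 0 (real n)) h)"
          by (intro SUP_upper2[of n]) (auto simp: indicator_def)
      qed (auto intro!: SUP_least simp: indicator_def)
    qed measurable
    then obtain n :: nat where n: "(\<integral>\<^sup>+h. ?F h - ?F h * indicator (hball 0 (real n)) h \<partial>lebesgue) \<le> ennreal \<delta>" by blast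
    define u v where "u h = indicator (hball 0 (real n)) h * f h" and "v h = indicator (- hball 0 (real n)) h * f h" for h
    have u: "u \<in> Lp_space p" and v: "v \<in> Lp_space p"
      unfolding u_def v_def using hball_lebesgue[of "0 :: 'n heis" "real n"]
      by (auto intro!: Lp_space_indicator_mult p0 f)
    have uv: "(\<lambda>h. u h + v h) = f" by (auto simp: u_def v_def indicator_def)
    have "AE g in lebesgue. ennreal \<bar>T u g\<bar> \<le> ennreal c0 * comm \<alpha> b (\<lambda>h. ennreal \<bar>u h\<bar>) g"
    proof (rule domination_bounded_support[OF u])
      \<comment> \<open>The successor is taken because \<open>n\<close> may be 0, while the radius
        has to be positive.\<close>
      show "0 < real (Suc n)" by simp
      show "u h = 0" if "h \<notin> hball 0 (real (Suc n))" for h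
        using that by (auto simp: u_def indicator_def)
    qed
    moreover have "AE g in lebesgue. \<bar>T f g\<bar> \<le> \<bar>T u g\<bar> + \<bar>T v g\<bar>"
      using sub u v unfolding sublinear_on_def uv[symmetric] by blast
    ultimately have "AE g in lebesgue. epowr (X g) q \<le> epowr (ennreal \<bar>T v g\<bar>) q"
    proof eventually_elim
      case (elim g)
      have "comm \<alpha> b (\<lambda>h. ennreal \<bar>u h\<bar>) g \<le> comm \<alpha> b (\<lambda>h. ennreal \<bar>f h\<bar>) g"
        by (intro comm_mono) (auto simp: u_def indicator_def)
      then have 1: "ennreal \<bar>T u g\<bar> \<le> D g"
        using elim(1) unfolding D_def by (meson mult_left_mono order.trans zero_le)
      have "ennreal \<bar>T f g\<bar> \<le> ennreal \<bar>T v g\<bar> + ennreal \<bar>T u g\<bar>"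
        using elim(2) by (simp add: ennreal_plus[symmetric] ennreal_leI del: ennreal_plus)
      also have "\<dots> \<le> ennreal \<bar>T v g\<bar> + D g" by (intro add_left_mono 1)
      finally have "X g \<le> ennreal \<bar>T v g\<bar>"
        unfolding X_def by (cases "D g = top") (auto simp: ennreal_minus_le_iff add.commute)
      then show ?case using p0 by (intro epowr_mono) auto
    qed
    then have "(\<integral>\<^sup>+g. epowr (X g) q \<partial>lebesgue) \<le> epowr (eLp q lebesgue (\<lambda>g. ennreal \<bar>T v g\<bar>)) q"
      unfolding epowr_eLp[OF p0(2)] by (rule nn_integral_mono_AE)
    also have "\<dots> \<le> epowr (ennreal K * eLp p lebesgue (\<lambda>h. ennreal \<bar>v h\<bar>)) q"
      using p0 by (intro epowr_mono K(3) v) auto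
    also have "\<dots> = epowr (ennreal K) q * epowr (\<integral>\<^sup>+h. epowr (ennreal \<bar>v h\<bar>) p \<partial>lebesgue) (q / p)"
      by (simp add: epowr_mult eLp_def epowr_epowr)
    also have "(\<integral>\<^sup>+h. epowr (ennreal \<bar>v h\<bar>) p \<partial>lebesgue) \<le> (\<integral>\<^sup>+h. ?F h - ?F h * indicator (hball 0 (real n)) h \<partial>lebesgue)"
      by (intro nn_integral_mono) (auto simp: v_def indicator_def)
    also note n
    finally show "(\<integral>\<^sup>+g. epowr (X g) q \<partial>lebesgue) \<le> ennreal (K powr q) * epowr (ennreal \<delta>) (q / p)"
      using p0 K(1) by (simp add: epowr_mono mult_left_mono del: epowr_ennreal) simp
  qed (use p0 in auto)
  then have "AE g in lebesgue. X g = 0" by (simp add: nn_integral_0_iff_AE)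
  then show ?thesis unfolding X_def D_def by eventually_elim (simp add: diff_eq_0_iff_ennreal)
qed

text \<open>The truncations of a locally p-integrable function lie in L_p, and their commutators are
  all bounded by that of \<open>f\<close>. This common bound passes to the limit superior.\<close>

lemma domination_truncations:
  assumes f: "f \<in> Lp_loc p"
    and limsup: "AE g in lebesgue. ennreal \<bar>T f g\<bar> \<le> limsup (\<lambda>k::nat. ennreal \<bar>T (\<lambda>h. indicator (hball 0 (real k)) h * f h) g\<bar>)"
  shows "AE g in lebesgue. ennreal \<bar>T f g\<bar> \<le> ennreal c0 * comm \<alpha> b (\<lambda>h. ennreal \<bar>f h\<bar>) g"
proof -
  have [measurable]: "f \<in> borel_measurable lebesgue" using f by (rule Lp_loc_measurable)
  have u: "(\<lambda>h. indicator (hball 0 (real k)) h * f h) \<in> Lp_space p" for k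
  proof -
    have "set_integrable lebesgue (closure (hball 0 (real k))) (\<lambda>x. \<bar>f x\<bar> powr p)"
      using f by (simp add: Lp_loc_def)
    then have "set_integrable lebesgue (hball 0 (real k)) (\<lambda>x. \<bar>f x\<bar> powr p)"
      by (rule set_integrable_subset) (auto simp: hball_lebesgue closure_subset)
    then have "integrable lebesgue (\<lambda>x. indicator (hball 0 (real k)) x *\<^sub>R \<bar>f x\<bar> powr p)"
      unfolding set_integrable_def .
    also have "(\<lambda>x. indicator (hball 0 (real k)) x *\<^sub>R \<bar>f x\<bar> powr p) = (\<lambda>x. \<bar>indicator (hball 0 (real k)) x * f x\<bar> powr p)"
      by (auto simp: indicator_def)
    finally show ?thesis
      unfolding Lp_space_def using hball_lebesgue[of "0 :: 'n heis" "real k"] by simp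
  qed
  have "AE g in lebesgue. \<forall>k::nat. ennreal \<bar>T (\<lambda>h. indicator (hball 0 (real k)) h * f h) g\<bar>
     \<le> ennreal c0 * comm \<alpha> b (\<lambda>h. ennreal \<bar>indicator (hball 0 (real k)) h * f h\<bar>) g"
    by (subst AE_all_countable) (intro allI domination_Lp u)
  with limsup show ?thesis
  proof eventually_elim
    case (elim g)
    have "limsup (\<lambda>k::nat. ennreal \<bar>T (\<lambda>h. indicator (hball 0 (real k)) h * f h) g\<bar>)
      \<le> ennreal c0 * comm \<alpha> b (\<lambda>h. ennreal \<bar>f h\<bar>) g"
    proof (rule Limsup_bounded, rule always_eventually, rule allI)
      fix k
      have "ennreal c0 * comm \<alpha> b (\<lambda>h. ennreal \<bar>indicator (hball 0 (real k)) h * f h\<bar>) g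
        \<le> ennreal c0 * comm \<alpha> b (\<lambda>h. ennreal \<bar>f h\<bar>) g"
        by (intro mult_left_mono comm_mono) (auto simp: indicator_def)
      with elim(2) show "ennreal \<bar>T (\<lambda>h. indicator (hball 0 (real k)) h * f h) g\<bar> \<le> ennreal c0 * comm \<alpha> b (\<lambda>h. ennreal \<bar>f h\<bar>) g"
        using order.trans by blast
    qed
    with elim(1) show ?case by (rule order.trans)
  qed
qed

end

section \<open>Local estimates and Morrey norms\<close>

text \<open>The dyadic counterpart of the integral over \<tau> > r of (1 + ln(\<tau>/r))
  \<tau>^(-Q/q - 1) times the L_p norm of \<open>F\<close> on B(g, \<tau>), with the factor k + 1 in
  place of the logarithm.\<close>

definition local_sum :: "real \<Rightarrow> real \<Rightarrow> ('n::finite heis \<Rightarrow> ennreal) \<Rightarrow> 'n heis \<Rightarrow> real \<Rightarrow> ennreal" where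
  "local_sum p q F g r = (\<Sum>k::nat. ennreal ((real k + 1) * (2 ^ k * r) powr - (hdim TYPE('n) / q)) *
     eLp p lebesgue (\<lambda>h. F h * indicator (hball g (2 * (2 ^ k * r))) h))"

lemma ball_avg_chain:
  fixes b :: "'n::finite heis \<Rightarrow> real"
  assumes b: "b \<in> Lp_loc 1" "bmo_norm b \<le> ennreal N" "0 < N" and r: "0 < r"
  shows "\<bar>ball_avg b g (2 ^ j * r) - ball_avg b g r\<bar> \<le> real j * (2 powr hdim TYPE('n) * N)"
proof (induction j)
  case (Suc j)
  have "\<bar>ball_avg b g (2 ^ j * r) - ball_avg b g (2 * (2 ^ j * r))\<bar> \<le> 2 powr hdim TYPE('n) * N"
    using ball_avg_nested[OF b, of "2 ^ j * r" "2 * (2 ^ j * r)" g g] hball_mono[of g g "2 ^ j * r" "2 * (2 ^ j * r)"] r by simp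
  with Suc show ?case unfolding power_Suc mult.assoc by (simp add: algebra_simps)
qed simp

text \<open>For x in B(g, r) and h in the shell, d(x, h) is at least half the inner radius, and
  |b(x) - b(h)| splits into the oscillation at x, the oscillation at h over the large ball, and the
  drift of the averages. The first leaves the integral; Hoelder treats the rest. All three are
  finally bounded by a multiple of (j + 1)(\<open>bosc b g r x + N\<close>).\<close>

lemma comm_shell_le:
  fixes b :: "'n::finite heis \<Rightarrow> real" and F :: "'n heis \<Rightarrow> ennreal"
  assumes p: "1 < p" and q: "1 / q = 1 / p - \<alpha> / hdim TYPE('n)" and \<alpha>: "\<alpha> < hdim TYPE('n)"
    and b: "b \<in> Lp_loc 1" "bmo_norm b \<le> ennreal N" "0 < N" and F [measurable]: "F \<in> borel_measurable lebesgue"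
    and r: "0 < r" and j: "1 \<le> j" and x: "x \<in> hball g r" and M: "0 < M"
    and osc: "\<And>a g r. 0 < r \<Longrightarrow> 0 \<le> a \<Longrightarrow> eLp (p / (p - 1)) lebesgue (\<lambda>h. ennreal (bosc b g r h + a * N) * indicator (hball g r) h)
      \<le> ennreal (M * (1 + a) * N * vol TYPE('n) r powr (1 / (p / (p - 1))))"
  shows "(\<integral>\<^sup>+h. ennreal (\<bar>b x - b h\<bar> * riesz \<alpha> x h) * (F h * indicator (hball g (2 * (2 ^ j * r)) - hball g (2 ^ j * r)) h) \<partial>lebesgue)
    \<le> ennreal (2 powr (hdim TYPE('n) - \<alpha>) * vol TYPE('n) 2 powr (1 - 1 / p) * (1 + M * (1 + 2 powr hdim TYPE('n))) * (bosc b g r x + N))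
      * (ennreal ((real j + 1) * (2 ^ j * r) powr - (hdim TYPE('n) / q)) * eLp p lebesgue (\<lambda>h. F h * indicator (hball g (2 * (2 ^ j * r))) h))"
proof -
  let ?Q = "hdim TYPE('n)"
  have bm [measurable]: "b \<in> borel_measurable lebesgue" using b(1) by (rule Lp_loc_measurable)
  define \<sigma> where "\<sigma> = 2 ^ j * r"
  define B where "B = hball g (2 * \<sigma>)"
  \<comment> \<open>Passing from radius r to 2 \<sigma> = 2^(j+1) r takes j + 1 doublings, each
    costing 2^Q N.\<close>
  define a where "a = (real j + 1) * 2 powr ?Q"
  define v where "v = vol TYPE('n) (2 * \<sigma>)"
  define \<Phi> where "\<Phi> = eLp p lebesgue (\<lambda>h. F h * indicator B h)"
  define W where "W h = ennreal (bosc b g (2 * \<sigma>) h + a * N) * indicator B h" for h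
  \<comment> \<open>The bound 2 r \<le> \<sigma>, and with it j \<ge> 1, keeps points of B(g, r) at
    distance at least \<sigma>/2 from the shell.\<close>
  have \<sigma>: "0 < \<sigma>" "2 * r \<le> \<sigma>"
  proof -
    show "0 < \<sigma>" using r by (simp add: \<sigma>_def)
    have "(2::real) ^ 1 \<le> 2 ^ j" using j by (intro power_increasing) auto
    then show "2 * r \<le> \<sigma>" using r by (simp add: \<sigma>_def)
  qed
  have v: "0 < v" using \<sigma> by (simp add: v_def)
  have a: "0 \<le> a" by (simp add: a_def)
  have [measurable]: "B \<in> sets lebesgue" unfolding B_def by (rule hball_lebesgue)
  have [measurable]: "W \<in> borel_measurable lebesgue" unfolding W_def by measurable
  have "(\<integral>\<^sup>+h. ennreal (\<bar>b x - b h\<bar> * riesz \<alpha> x h) * (F h * indicator (B - hball g \<sigma>) h) \<partial>lebesgue)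
    \<le> (\<integral>\<^sup>+h. ennreal ((\<sigma> / 2) powr (\<alpha> - ?Q)) * (ennreal (bosc b g r x) * (F h * indicator B h) + W h * (F h * indicator B h)) \<partial>lebesgue)"
  proof (intro nn_integral_mono)
    fix h
    show "ennreal (\<bar>b x - b h\<bar> * riesz \<alpha> x h) * (F h * indicator (B - hball g \<sigma>) h)
      \<le> ennreal ((\<sigma> / 2) powr (\<alpha> - ?Q)) * (ennreal (bosc b g r x) * (F h * indicator B h) + W h * (F h * indicator B h))"
    proof (cases "h \<in> B - hball g \<sigma>")
      case True
      then have h: "h \<in> B" "\<sigma> \<le> hdist g h" by auto
      have "hdist g h \<le> hdist g x + hdist x h" by (rule hdist_triangle)
      then have d: "\<sigma> / 2 \<le> hdist x h" using h x \<sigma> by simp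
      have 1: "riesz \<alpha> x h \<le> (\<sigma> / 2) powr (\<alpha> - ?Q)"
      proof -
        have "riesz \<alpha> x h = hdist x h powr (\<alpha> - ?Q)"
          unfolding riesz_def using powr_minus[of "hdist x h" "?Q - \<alpha>"] by (simp add: inverse_eq_divide)
        also have "\<dots> \<le> (\<sigma> / 2) powr (\<alpha> - ?Q)" using d \<sigma> \<alpha> by (intro powr_mono2') auto
        finally show ?thesis .
      qed
      have "\<bar>ball_avg b g (2 * \<sigma>) - ball_avg b g r\<bar> \<le> real (Suc j) * (2 powr ?Q * N)"
        using ball_avg_chain[OF b r, of g "Suc j"] by (simp add: \<sigma>_def mult.assoc)
      then have 2: "\<bar>b x - b h\<bar> \<le> bosc b g r x + (bosc b g (2 * \<sigma>) h + a * N)"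
        unfolding bosc_def a_def by (simp add: algebra_simps)
      have "ennreal (\<bar>b x - b h\<bar> * riesz \<alpha> x h) \<le> ennreal ((bosc b g r x + (bosc b g (2 * \<sigma>) h + a * N)) * (\<sigma> / 2) powr (\<alpha> - ?Q))"
        using 1 2 a b(3) by (intro ennreal_leI mult_mono) auto
      also have "\<dots> = ennreal ((\<sigma> / 2) powr (\<alpha> - ?Q)) * (ennreal (bosc b g r x) + W h)"
        using h a b(3) by (simp add: W_def ennreal_mult mult_ac)
      finally have "ennreal (\<bar>b x - b h\<bar> * riesz \<alpha> x h) * F h
         \<le> ennreal ((\<sigma> / 2) powr (\<alpha> - ?Q)) * (ennreal (bosc b g r x) + W h) * F h"
        by (rule mult_right_mono) simp
      then show ?thesis using True by (simp add: distrib_left distrib_right mult_ac)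
    qed simp
  qed
  also have "\<dots> = ennreal ((\<sigma> / 2) powr (\<alpha> - ?Q)) *
      (ennreal (bosc b g r x) * (\<integral>\<^sup>+h. F h * indicator B h \<partial>lebesgue) + (\<integral>\<^sup>+h. W h * (F h * indicator B h) \<partial>lebesgue))"
    by (simp add: nn_integral_cmult nn_integral_add)
  also have "\<dots> \<le> ennreal ((\<sigma> / 2) powr (\<alpha> - ?Q)) *
      (ennreal (bosc b g r x) * (\<Phi> * ennreal (v powr (1 - 1 / p))) + ennreal (M * (1 + a) * N * v powr (1 - 1 / p)) * \<Phi>)"
  proof (intro mult_left_mono add_mono)
    have "epowr (\<integral>\<^sup>+h. epowr (F h) p * indicator B h \<partial>lebesgue) (1 / p) = \<Phi>"
      unfolding \<Phi>_def eLp_def by (intro arg_cong[where f="\<lambda>x. epowr x (1 / p)"] nn_integral_cong) (auto simp: indicator_def)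
    then show "(\<integral>\<^sup>+h. F h * indicator B h \<partial>lebesgue) \<le> \<Phi> * ennreal (v powr (1 - 1 / p))"
      using nn_integral_hball_Hoelder[OF F p, of "2 * \<sigma>" g] \<sigma> unfolding B_def v_def by simp
    have p': "1 / (p / (p - 1)) = 1 - 1 / p" "1 < p / (p - 1)" using p by (auto simp: field_simps)
    have "(\<integral>\<^sup>+h. W h * (F h * indicator B h) \<partial>lebesgue) \<le> eLp (p / (p - 1)) lebesgue W * \<Phi>"
      unfolding \<Phi>_def using p p' by (intro Hoelder_eLp) auto
    also have "eLp (p / (p - 1)) lebesgue W \<le> ennreal (M * (1 + a) * N * v powr (1 - 1 / p))"
      using osc[of "2 * \<sigma>" a g] \<sigma> a unfolding W_def B_def v_def p' by simp
    finally show "(\<integral>\<^sup>+h. W h * (F h * indicator B h) \<partial>lebesgue) \<le> ennreal (M * (1 + a) * N * v powr (1 - 1 / p)) * \<Phi>"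
      by (simp add: mult_right_mono)
  qed auto
  also have "\<dots> = ennreal ((\<sigma> / 2) powr (\<alpha> - ?Q) * v powr (1 - 1 / p) * (bosc b g r x + M * (1 + a) * N)) * \<Phi>"
    using M a b(3) by (simp add: ennreal_mult ennreal_plus distrib_left distrib_right mult_ac)
  also have "\<dots> \<le> ennreal ((2 powr (?Q - \<alpha>) * vol TYPE('n) 2 powr (1 - 1 / p) * (1 + M * (1 + 2 powr ?Q)) * (bosc b g r x + N))
      * ((real j + 1) * \<sigma> powr - (?Q / q))) * \<Phi>"
  proof (intro mult_right_mono ennreal_leI)
    have v_eq: "v = vol TYPE('n) 2 * \<sigma> powr ?Q"
      using vol_mult[of \<sigma> 2, where 'n='n] \<sigma> by (simp add: v_def mult.commute)
    have "(\<sigma> / 2) powr (\<alpha> - ?Q) * v powr (1 - 1 / p)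
        = 2 powr (?Q - \<alpha>) * vol TYPE('n) 2 powr (1 - 1 / p) * (\<sigma> powr (\<alpha> - ?Q) * \<sigma> powr (?Q * (1 - 1 / p)))"
      using \<sigma> unfolding v_eq
      by (simp add: powr_divide powr_mult powr_powr less_imp_le powr_minus_divide[of 2 "?Q - \<alpha>", simplified])
    \<comment> \<open>The kernel contributes \<alpha> - Q and Hoelder's inequality Q (1 - 1/p); by
      the relation between p and q they add up to -Q/q.\<close>
    also have "\<sigma> powr (\<alpha> - ?Q) * \<sigma> powr (?Q * (1 - 1 / p)) = \<sigma> powr - (?Q / q)"
    proof -
      have "?Q / q = ?Q * (1 / q)" by simp
      also have "\<dots> = ?Q / p - \<alpha>" unfolding q by (simp add: right_diff_distrib less_imp_neq[OF hdim_pos, symmetric])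
      finally have "- (?Q / q) = (\<alpha> - ?Q) + ?Q * (1 - 1 / p)" by (simp add: right_diff_distrib)
      then show ?thesis by (simp only: powr_add)
    qed
    finally have e: "(\<sigma> / 2) powr (\<alpha> - ?Q) * v powr (1 - 1 / p)
        = 2 powr (?Q - \<alpha>) * vol TYPE('n) 2 powr (1 - 1 / p) * \<sigma> powr - (?Q / q)" .
    have "bosc b g r x + M * (1 + a) * N \<le> (1 + M * (1 + 2 powr ?Q)) * (bosc b g r x + N) * (real j + 1)"
    proof -
      define M' y where "M' = M * (1 + 2 powr ?Q)" and "y = bosc b g r x"
      have M': "0 \<le> M'" "0 \<le> y" using M by (simp_all add: M'_def y_def)
      have "1 + a \<le> (1 + 2 powr ?Q) * (real j + 1)" by (simp add: a_def algebra_simps)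
      then have "M * (1 + a) * N \<le> M * ((1 + 2 powr ?Q) * (real j + 1)) * N"
        using M b(3) by (intro mult_left_mono mult_right_mono) auto
      also have "\<dots> = M' * N * (real j + 1)" by (simp add: M'_def mult_ac)
      finally have "M * (1 + a) * N \<le> M' * N * (real j + 1)" .
      moreover have "y \<le> y * (real j + 1)" using M' by (simp add: algebra_simps)
      moreover have "0 \<le> M' * y * (real j + 1)" "0 \<le> N * (real j + 1)"
        using M' b(3) by (simp_all)
      moreover have "(1 + M') * (y + N) * (real j + 1) = y * (real j + 1) + N * (real j + 1) + M' * y * (real j + 1) + M' * N * (real j + 1)"
        by (simp add: algebra_simps)
      ultimately show ?thesis unfolding M'_def[symmetric] y_def[symmetric] by linarith
    qed
    then have "(2 powr (?Q - \<alpha>) * vol TYPE('n) 2 powr (1 - 1 / p) * \<sigma> powr - (?Q / q)) * (bosc b g r x + M * (1 + a) * N)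
      \<le> (2 powr (?Q - \<alpha>) * vol TYPE('n) 2 powr (1 - 1 / p) * \<sigma> powr - (?Q / q)) * ((1 + M * (1 + 2 powr ?Q)) * (bosc b g r x + N) * (real j + 1))"
      by (intro mult_left_mono) auto
    then show "(\<sigma> / 2) powr (\<alpha> - ?Q) * v powr (1 - 1 / p) * (bosc b g r x + M * (1 + a) * N)
      \<le> (2 powr (?Q - \<alpha>) * vol TYPE('n) 2 powr (1 - 1 / p) * (1 + M * (1 + 2 powr ?Q)) * (bosc b g r x + N))
      * ((real j + 1) * \<sigma> powr - (?Q / q))"
      unfolding e by (simp only: mult_ac)
  qed simp
  also have "\<dots> = ennreal (2 powr (?Q - \<alpha>) * vol TYPE('n) 2 powr (1 - 1 / p) * (1 + M * (1 + 2 powr ?Q)) * (bosc b g r x + N))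
      * (ennreal ((real j + 1) * \<sigma> powr - (?Q / q)) * \<Phi>)"
    using M b(3) by (subst ennreal_mult) (auto simp: mult.assoc intro!: mult_nonneg_nonneg add_nonneg_nonneg)
  finally show ?thesis unfolding \<Phi>_def B_def \<sigma>_def .
qed

text \<open>The near part of \<open>F\<close> is left inside the commutator. For the far part, the
  dependence on x reduces to the single factor \<open>bosc b g r x + N\<close>, whose L_q norm on
  the ball is known.\<close>

lemma comm_pointwise_local:
  fixes b :: "'n::finite heis \<Rightarrow> real" and F :: "'n heis \<Rightarrow> ennreal"
  assumes p: "1 < p" and q: "1 / q = 1 / p - \<alpha> / hdim TYPE('n)" and \<alpha>: "\<alpha> < hdim TYPE('n)"
    and b: "b \<in> Lp_loc 1" "bmo_norm b \<le> ennreal N" "0 < N" and F [measurable]: "F \<in> borel_measurable lebesgue"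
    and r: "0 < r" and x: "x \<in> hball g r" and M: "0 < M"
    and osc: "\<And>a g r. 0 < r \<Longrightarrow> 0 \<le> a \<Longrightarrow> eLp (p / (p - 1)) lebesgue (\<lambda>h. ennreal (bosc b g r h + a * N) * indicator (hball g r) h)
      \<le> ennreal (M * (1 + a) * N * vol TYPE('n) r powr (1 / (p / (p - 1))))"
  shows "comm \<alpha> b F x \<le> comm \<alpha> b (\<lambda>h. F h * indicator (hball g (2 * r)) h) x
    + ennreal (2 powr (hdim TYPE('n) - \<alpha>) * vol TYPE('n) 2 powr (1 - 1 / p) * (1 + M * (1 + 2 powr hdim TYPE('n))) * (bosc b g r x + N))
      * local_sum p q F g r"
proof -
  have bm [measurable]: "b \<in> borel_measurable lebesgue" using b(1) by (rule Lp_loc_measurable)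
  let ?k = "\<lambda>h. ennreal (\<bar>b x - b h\<bar> * riesz \<alpha> x h)"
  have rm: "(\<lambda>h. riesz \<alpha> x h) \<in> borel_measurable lebesgue"
    using measurable_compose[OF measurable_Pair1' riesz_measurable[of \<alpha>], of x] by simp
  have km [measurable]: "?k \<in> borel_measurable lebesgue"
    using rm by measurable
  \<comment> \<open>The shell with index 0 would lie between the radii r and 2r, which already
    belong to the near part; it is made empty so that the sum starts at \<open>j = 0\<close> like
    \<open>local_sum\<close>.\<close>
  define S where "S j = (if j = 0 then {} else hball g (2 * (2 ^ j * r)) - hball g (2 ^ j * r))" for j :: nat
  have Sm [measurable]: "S j \<in> sets lebesgue" for j
    unfolding S_def using hball_lebesgue[of g "2 * (2 ^ j * r)"] hball_lebesgue[of g "2 ^ j * r"] by auto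
  have Bm [measurable]: "hball g (2 * r) \<in> sets lebesgue" by (rule hball_lebesgue)
  have split: "F h \<le> F h * indicator (hball g (2 * r)) h + (\<Sum>j. F h * indicator (S j) h)" for h
  proof (cases "h \<in> hball g (2 * r)")
    case False
    obtain n where "hdist g h / r < 2 ^ n" using real_arch_pow[of 2 "hdist g h / r"] by auto
    then have n: "hdist g h < 2 ^ n * r" using r by (simp add: field_simps)
    define m where "m = (LEAST n. hdist g h < 2 ^ n * r)"
    have m: "hdist g h < 2 ^ m * r" unfolding m_def using n by (rule LeastI)
    have "m \<noteq> 0" "m \<noteq> 1"
    proof -
      show "m \<noteq> 0" using m False r by (intro notI) (simp add: not_less)
      show "m \<noteq> 1" using m False r by (intro notI) (simp add: not_less)
    qed
    then obtain j where j: "m = Suc j" "j \<noteq> 0" by (cases m) auto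
    have "\<not> hdist g h < 2 ^ j * r"
      using not_less_Least[of j "\<lambda>n. hdist g h < 2 ^ n * r"] j unfolding m_def by simp
    then have "h \<in> S j" using m j by (simp add: S_def mult.assoc)
    then show ?thesis
      using ennreal_le_suminf[of "\<lambda>j. F h * indicator (S j) h" j] by (simp add: add_increasing)
  qed simp
  have "comm \<alpha> b F x \<le> (\<integral>\<^sup>+h. ?k h * (F h * indicator (hball g (2 * r)) h) + (\<Sum>j. ?k h * (F h * indicator (S j) h)) \<partial>lebesgue)"
    unfolding comm_def
  proof (intro nn_integral_mono)
    fix h
    have "?k h * F h \<le> ?k h * (F h * indicator (hball g (2 * r)) h + (\<Sum>j. F h * indicator (S j) h))"
      by (intro mult_left_mono split) simp
    then show "?k h * F h \<le> ?k h * (F h * indicator (hball g (2 * r)) h) + (\<Sum>j. ?k h * (F h * indicator (S j) h))"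
      by (simp add: distrib_left)
  qed
  also have "\<dots> = comm \<alpha> b (\<lambda>h. F h * indicator (hball g (2 * r)) h) x
      + (\<integral>\<^sup>+h. (\<Sum>j. ?k h * (F h * indicator (S j) h)) \<partial>lebesgue)"
    unfolding comm_def by (rule nn_integral_add) measurable
  also have "(\<integral>\<^sup>+h. (\<Sum>j. ?k h * (F h * indicator (S j) h)) \<partial>lebesgue) = (\<Sum>j. \<integral>\<^sup>+h. ?k h * (F h * indicator (S j) h) \<partial>lebesgue)"
    by (rule nn_integral_suminf) measurable
  also have "\<dots> \<le> (\<Sum>j. ennreal (2 powr (hdim TYPE('n) - \<alpha>) * vol TYPE('n) 2 powr (1 - 1 / p) * (1 + M * (1 + 2 powr hdim TYPE('n))) * (bosc b g r x + N))
      * (ennreal ((real j + 1) * (2 ^ j * r) powr - (hdim TYPE('n) / q)) * eLp p lebesgue (\<lambda>h. F h * indicator (hball g (2 * (2 ^ j * r))) h)))"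
  proof (rule suminf_le)
    fix j :: nat
    show "(\<integral>\<^sup>+h. ?k h * (F h * indicator (S j) h) \<partial>lebesgue)
      \<le> ennreal (2 powr (hdim TYPE('n) - \<alpha>) * vol TYPE('n) 2 powr (1 - 1 / p) * (1 + M * (1 + 2 powr hdim TYPE('n))) * (bosc b g r x + N))
      * (ennreal ((real j + 1) * (2 ^ j * r) powr - (hdim TYPE('n) / q)) * eLp p lebesgue (\<lambda>h. F h * indicator (hball g (2 * (2 ^ j * r))) h))"
    proof (cases "j = 0")
      case True
      then show ?thesis by (simp add: S_def)
    next
      case False
      then have j: "1 \<le> j" by simp
      show ?thesis
        using comm_shell_le[OF p q \<alpha> b F r j x M osc] False unfolding S_def by simp
    qed
  qed auto
  finally show ?thesis unfolding local_sum_def by simp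
qed

text \<open>The near part obeys the global bound for \<open>comm\<close>. In the far part the
  oscillation factor has L_q norm of order N r^(Q/q) on the ball, which is the power of r in the
  estimate.\<close>

lemma comm_local_estimate:
  assumes p: "1 < p" and \<alpha>: "0 < \<alpha>" "\<alpha> < hdim TYPE('n::finite) / p" and q: "1 / q = 1 / p - \<alpha> / hdim TYPE('n)"
  shows "\<exists>C>0. \<forall>(b :: 'n heis \<Rightarrow> real) N F g r. b \<in> Lp_loc 1 \<longrightarrow> bmo_norm b \<le> ennreal N \<longrightarrow> 0 < N \<longrightarrow> F \<in> borel_measurable lebesgue \<longrightarrow> 0 < r \<longrightarrow>
    eLp q lebesgue (\<lambda>x. comm \<alpha> b F x * indicator (hball g r) x) \<le> ennreal (C * N * r powr (hdim TYPE('n) / q)) * local_sum p q F g r"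
proof -
  let ?Q = "hdim TYPE('n)"
  have Q: "0 < ?Q" by simp
  have "\<alpha> / ?Q < 1 / p" using \<alpha> p Q by (simp add: field_simps)
  then have q0: "0 < q" using q zero_less_divide_1_iff[of q] by simp
  have "1 / q < 1 / p" using q \<alpha> Q by simp
  then have q1: "1 < q" using p q0 by (simp add: field_simps)
  have \<alpha>Q: "\<alpha> < ?Q"
  proof -
    have "?Q / p \<le> ?Q" using p Q by (simp add: field_simps)
    then show ?thesis using \<alpha> by linarith
  qed
  have p': "1 < p / (p - 1)" using p by simp
  obtain C1 where C1: "0 < C1" "\<And>(b :: 'n heis \<Rightarrow> real) N f. b \<in> Lp_loc 1 \<Longrightarrow> bmo_norm b \<le> ennreal N \<Longrightarrow> 0 < N \<Longrightarrow> f \<in> borel_measurable lebesgue \<Longrightarrow>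
    eLp q lebesgue (comm \<alpha> b f) \<le> ennreal (C1 * N) * eLp p lebesgue f"
    using comm_bounded[OF p \<alpha> q] by blast
  obtain M where M: "0 < M" "\<And>(b :: 'n heis \<Rightarrow> real) N g r a. b \<in> Lp_loc 1 \<Longrightarrow> bmo_norm b \<le> ennreal N \<Longrightarrow> 0 < N \<Longrightarrow> 0 < r \<Longrightarrow> 0 \<le> a \<Longrightarrow>
    eLp (p / (p - 1)) lebesgue (\<lambda>h. ennreal (bosc b g r h + a * N) * indicator (hball g r) h)
      \<le> ennreal (M * (1 + a) * N * vol TYPE('n) r powr (1 / (p / (p - 1))))"
    using BMO_oscillation_norm[OF p', where 'n='n] by blast
  obtain M2 where M2: "0 < M2" "\<And>(b :: 'n heis \<Rightarrow> real) N g r a. b \<in> Lp_loc 1 \<Longrightarrow> bmo_norm b \<le> ennreal N \<Longrightarrow> 0 < N \<Longrightarrow> 0 < r \<Longrightarrow> 0 \<le> a \<Longrightarrow>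
    eLp q lebesgue (\<lambda>h. ennreal (bosc b g r h + a * N) * indicator (hball g r) h)
      \<le> ennreal (M2 * (1 + a) * N * vol TYPE('n) r powr (1 / q))"
    using BMO_oscillation_norm[OF q1, where 'n='n] by blast
  define c where "c = 2 powr (?Q - \<alpha>) * vol TYPE('n) 2 powr (1 - 1 / p) * (1 + M * (1 + 2 powr ?Q))"
  have c: "0 \<le> c" unfolding c_def using M by (intro mult_nonneg_nonneg add_nonneg_nonneg) auto
  define V where "V = unit_vol TYPE('n) powr (1 / q)"
  \<comment> \<open>The factor 4 is that of \<open>eLp_add_le\<close>; the factor 2 is 1 + a with a
    = 1, from the weight \<open>bosc b g r x + 1 * N\<close>.\<close>
  define C where "C = 4 * (C1 + c * (M2 * 2 * V))"
  have "eLp q lebesgue (\<lambda>x. comm \<alpha> b F x * indicator (hball g r) x) \<le> ennreal (C * N * r powr (?Q / q)) * local_sum p q F g r"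
    if b: "b \<in> Lp_loc 1" "bmo_norm b \<le> ennreal N" "0 < N" and F [measurable]: "F \<in> borel_measurable lebesgue" and r: "0 < r"
    for b :: "'n heis \<Rightarrow> real" and N F g r
  proof -
    have bm [measurable]: "b \<in> borel_measurable lebesgue" using b(1) by (rule Lp_loc_measurable)
    let ?F1 = "\<lambda>h. F h * indicator (hball g (2 * r)) h"
    have [measurable]: "hball g (2 * r) \<in> sets lebesgue" "hball g r \<in> sets lebesgue" by (rule hball_lebesgue)+
    let ?S = "local_sum p q F g r" and ?w = "\<lambda>x. ennreal (bosc b g r x + 1 * N) * indicator (hball g r) x"
    have "eLp q lebesgue (\<lambda>x. comm \<alpha> b F x * indicator (hball g r) x)
       \<le> eLp q lebesgue (\<lambda>x. comm \<alpha> b ?F1 x + (ennreal c * ?S) * ?w x)"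
    proof (intro eLp_mono q0)
      fix x
      show "comm \<alpha> b F x * indicator (hball g r) x \<le> comm \<alpha> b ?F1 x + (ennreal c * ?S) * ?w x"
      proof (cases "x \<in> hball g r")
        case True
        have "comm \<alpha> b F x \<le> comm \<alpha> b ?F1 x + ennreal (c * (bosc b g r x + N)) * ?S"
          unfolding c_def by (rule comm_pointwise_local[OF p q \<alpha>Q b F r True M(1) M(2)[OF b]])
        then show ?thesis using True c b(3) by (simp add: ennreal_mult mult_ac)
      qed simp
    qed
    also have "\<dots> \<le> 4 * (eLp q lebesgue (comm \<alpha> b ?F1) + eLp q lebesgue (\<lambda>x. (ennreal c * ?S) * ?w x))"
      using q1 by (intro eLp_add_le) auto
    also have "eLp q lebesgue (\<lambda>x. (ennreal c * ?S) * ?w x) = (ennreal c * ?S) * eLp q lebesgue ?w"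
      by (intro eLp_cmult q0) measurable
    also have "eLp q lebesgue (comm \<alpha> b ?F1) + (ennreal c * ?S) * eLp q lebesgue ?w
       \<le> ennreal (C1 * N) * eLp p lebesgue ?F1 + (ennreal c * ?S) * ennreal (M2 * (1 + 1) * N * vol TYPE('n) r powr (1 / q))"
      using r by (intro add_mono mult_left_mono C1 M2 b) auto
    \<comment> \<open>The term with k = 0 of \<open>local_sum\<close> is r^(-Q/q) times this
      norm.\<close>
    also have "eLp p lebesgue ?F1 \<le> ennreal (r powr (?Q / q)) * ?S"
    proof -
      have "ennreal (r powr - (?Q / q)) * eLp p lebesgue ?F1 \<le> ?S"
        unfolding local_sum_def
        using ennreal_le_suminf[of "\<lambda>k. ennreal ((real k + 1) * (2 ^ k * r) powr - (?Q / q)) *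
           eLp p lebesgue (\<lambda>h. F h * indicator (hball g (2 * (2 ^ k * r))) h)" 0] by simp
      then have "ennreal (r powr (?Q / q)) * (ennreal (r powr - (?Q / q)) * eLp p lebesgue ?F1) \<le> ennreal (r powr (?Q / q)) * ?S"
        by (rule mult_left_mono) simp
      moreover have "ennreal (r powr (?Q / q)) * ennreal (r powr - (?Q / q)) = 1"
        using r by (simp add: ennreal_mult[symmetric] powr_add[symmetric])
      ultimately show ?thesis by (simp add: mult.assoc[symmetric])
    qed
    also have "vol TYPE('n) r powr (1 / q) = V * r powr (?Q / q)"
      unfolding vol_def V_def by (simp add: powr_mult powr_powr less_imp_le)
    also have "4 * (ennreal (C1 * N) * (ennreal (r powr (?Q / q)) * ?S) + (ennreal c * ?S) * ennreal (M2 * (1 + 1) * N * (V * r powr (?Q / q))))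
      = ennreal (C * N * r powr (?Q / q)) * ?S"
    proof -
      have V: "0 \<le> V" by (simp add: V_def)
      let ?X = "C1 * N * r powr (?Q / q)" and ?Y = "c * (M2 * (1 + 1) * N * (V * r powr (?Q / q)))"
      have XY: "0 \<le> ?X" "0 \<le> ?Y" using C1 M2 V c b(3) by (auto intro!: mult_nonneg_nonneg)
      have "ennreal (C * N * r powr (?Q / q)) = ennreal (4 * (?X + ?Y))"
        by (rule arg_cong[where f=ennreal]) (simp add: C_def algebra_simps)
      also have "\<dots> = 4 * (ennreal ?X + ennreal ?Y)"
        using XY by (subst ennreal_mult) simp_all
      also have "ennreal ?X = ennreal (C1 * N) * ennreal (r powr (?Q / q))"
        using C1 b(3) by (intro ennreal_mult) auto
      also have "ennreal ?Y = ennreal c * ennreal (M2 * (1 + 1) * N * (V * r powr (?Q / q)))"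
        using c M2 V b(3) by (intro ennreal_mult) (auto intro!: mult_nonneg_nonneg)
      finally show ?thesis by (simp add: distrib_left distrib_right mult_ac)
    qed
    finally show ?thesis by (simp add: mult_left_mono add_mono)
  qed
  moreover have "0 < C" using C1 c M2 unfolding C_def V_def by (auto intro!: add_pos_nonneg mult_nonneg_nonneg)
  ultimately show ?thesis by blast
qed

section \<open>Passage to Morrey norms and the condition on the weights\<close>

lemma eLp_hball_eq_Lp_norm:
  fixes f :: "'n::finite heis \<Rightarrow> real"
  assumes f: "f \<in> Lp_loc p" and p: "0 < p"
  shows "eLp p lebesgue (\<lambda>h. ennreal \<bar>f h\<bar> * indicator (hball g r) h) = ennreal (Lp_norm p (hball g r) f)"
proof -
  have "set_integrable lebesgue (closure (hball g r)) (\<lambda>x. \<bar>f x\<bar> powr p)"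
    using f by (simp add: Lp_loc_def)
  then have i: "set_integrable lebesgue (hball g r) (\<lambda>x. \<bar>f x\<bar> powr p)"
    by (rule set_integrable_subset) (auto simp: hball_lebesgue closure_subset)
  have "(\<integral>\<^sup>+x. epowr (ennreal \<bar>f x\<bar> * indicator (hball g r) x) p \<partial>lebesgue)
    = (\<integral>\<^sup>+x. ennreal (\<bar>f x\<bar> powr p) * indicator (hball g r) x \<partial>lebesgue)"
    by (intro nn_integral_cong) (auto simp: indicator_def)
  also have "\<dots> = ennreal (LINT x:hball g r|lebesgue. \<bar>f x\<bar> powr p)"
    by (rule set_nn_integral_eq_set_integral[OF i]) simp
  finally show ?thesis
    by (simp add: eLp_def Lp_norm_def set_lebesgue_integral_def integral_nonneg_AE)
qed

lemma morrey_ball_le: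
  fixes f :: "'n::finite heis \<Rightarrow> real"
  assumes f: "f \<in> Lp_loc p" and p: "0 < p" and M: "morrey_norm p \<phi> f = ennreal M" "0 \<le> M" and r: "0 < r" and \<phi>: "0 < \<phi> g r"
  shows "eLp p lebesgue (\<lambda>h. ennreal \<bar>f h\<bar> * indicator (hball g r) h)
    \<le> ennreal (unit_vol TYPE('n) powr (1 / p) * M) * ennreal (\<phi> g r * r powr (hdim TYPE('n) / p))"
proof -
  let ?L = "Lp_norm p (hball g r) f" and ?v = "vol TYPE('n) r"
  have v: "0 < ?v" using r by simp
  have "ennreal (inverse (\<phi> g r) * measure lebesgue (hball g r) powr (- 1 / p) * ?L) \<le> morrey_norm p \<phi> f"
    unfolding morrey_norm_def using r by (intro SUP_upper2[of g] SUP_upper2[of r]) auto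
  then have "inverse (\<phi> g r) * ?v powr (- 1 / p) * ?L \<le> M"
    using M by (simp add: measure_hball_vol[OF r] ennreal_le_iff)
  then have "?L \<le> M * \<phi> g r * ?v powr (1 / p)"
    using \<phi> v by (simp add: powr_minus field_simps)
  also have "?v powr (1 / p) = unit_vol TYPE('n) powr (1 / p) * r powr (hdim TYPE('n) / p)"
    by (simp add: vol_def powr_mult powr_powr)
  finally show ?thesis
    unfolding eLp_hball_eq_Lp_norm[OF f p] using M \<phi> by (subst ennreal_mult[symmetric]) (auto simp: mult_ac intro!: ennreal_leI)
qed

lemma ennreal_divide_mult: "0 \<le> x \<Longrightarrow> 0 < y \<Longrightarrow> ennreal (x / y) * z = ennreal x * (z / ennreal y)"
  by (simp add: divide_ennreal_def inverse_ennreal divide_inverse ennreal_mult mult_ac)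

lemma ennreal_mult4:
  "0 \<le> w \<Longrightarrow> 0 \<le> x \<Longrightarrow> 0 \<le> y \<Longrightarrow> 0 \<le> z \<Longrightarrow>
    ennreal (w * (x * y * z)) = ennreal w * (ennreal x * ennreal y * ennreal z)"
  by (simp add: ennreal_mult)

text \<open>The norm of \<open>f\<close> on B(g, s) is nondecreasing in s, so it is at most c
  \<phi>1(g, t) t^(Q/p) for every t > s, and hence at most c times the essential infimum in the
  hypothesis. Integrating over disjoint dyadic intervals compares the sum with the integral.\<close>

lemma local_sum_le:
  fixes f :: "'n::finite heis \<Rightarrow> real"
  assumes p: "0 < p" and q: "0 < q" and spanne: "spanne_condition p q C \<phi>1 \<phi>2" and \<phi>1: "\<And>g r. 0 < r \<Longrightarrow> 0 < \<phi>1 g r"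
    and f: "f \<in> Lp_loc p" and M: "morrey_norm p \<phi>1 f = ennreal M" "0 \<le> M" and r: "0 < r"
  shows "local_sum p q (\<lambda>h. ennreal \<bar>f h\<bar>) g r
    \<le> ennreal (2 * 4 powr (hdim TYPE('n) / q) / ln 2 * (unit_vol TYPE('n) powr (1 / p) * M)) * ennreal (C * \<phi>2 g r)"
proof -
  let ?Q = "hdim TYPE('n)"
  define c where "c = unit_vol TYPE('n) powr (1 / p) * M"
  define \<Phi> where "\<Phi> s = eLp p lebesgue (\<lambda>h. ennreal \<bar>f h\<bar> * indicator (hball g s) h)" for s
  have \<Phi>_mono: "s \<le> s' \<Longrightarrow> \<Phi> s \<le> \<Phi> s'" for s s'
    unfolding \<Phi>_def using hball_mono[of g g s s'] p by (intro eLp_mono) (auto simp: indicator_def)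
  have \<Phi>_le: "\<Phi> s \<le> ennreal c * ennreal (\<phi>1 g s * s powr (?Q / p))" if "0 < s" for s
    unfolding \<Phi>_def c_def by (rule morrey_ball_le[where \<phi>=\<phi>1, OF f p M that \<phi>1[OF that]])
  show ?thesis
  proof (cases "M = 0")
    case True
    have "\<Phi> (2 * (2 ^ k * r)) = 0" for k :: nat
      using \<Phi>_le[of "2 * (2 ^ k * r)"] r True by (simp add: c_def)
    then show ?thesis unfolding local_sum_def \<Phi>_def by simp
  next
    case False
    then have c: "0 < c" using M less_imp_neq[OF unit_vol_pos[where 'n='n]] unfolding c_def by (intro mult_pos_pos) auto
    let ?e = "\<lambda>\<tau>. ess_inf_above \<tau> (\<lambda>s. ennreal (\<phi>1 g s * s powr (?Q / p)))"
    \<comment> \<open>The bound holds for all t beyond \<tau>, so the normalised norm is one of the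
      constants over which the supremum defining \<open>ess_inf_above\<close> is taken.\<close>
    have ess: "ennreal (1 / c) * \<Phi> s \<le> ?e \<tau>" if "0 < s" "s \<le> \<tau>" for s \<tau>
      unfolding ess_inf_above_def
    proof (rule Sup_upper, rule CollectI, rule AE_I2, rule impI)
      fix t assume "\<tau> < t"
      then have "\<Phi> s \<le> ennreal c * ennreal (\<phi>1 g t * t powr (?Q / p))"
        using \<Phi>_mono[of s t] \<Phi>_le[of t] that by (auto intro: order.trans)
      then have "ennreal (1 / c) * \<Phi> s \<le> ennreal (1 / c) * (ennreal c * ennreal (\<phi>1 g t * t powr (?Q / p)))"
        by (rule mult_left_mono) simp
      also have "\<dots> = ennreal (\<phi>1 g t * t powr (?Q / p))"
        using c by (simp add: mult.assoc[symmetric] ennreal_mult[symmetric])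
      finally show "ennreal (1 / c) * \<Phi> s \<le> ennreal (\<phi>1 g t * t powr (?Q / p))" .
    qed
    \<comment> \<open>Each interval starts at the radius of the k-th ball in
      \<open>local_sum\<close>, so \<open>ess\<close> applies throughout it. The intervals are
      disjoint, lie beyond r and have length 2 * 2^k r.\<close>
    define J where "J k = {2 * (2 ^ k * r)<..4 * (2 ^ k * r)}" for k :: nat
    \<comment> \<open>A lower bound of the integrand on \<open>J k\<close>: there ln(\<tau>/r) is at
      least (k + 1) ln 2, and \<tau> is at most 4 * 2^k r.\<close>
    define w where "w k = ennreal ((real k + 1) * ln 2 / (4 * (2 ^ k * r)) powr (?Q / q + 1)) * (ennreal (1 / c) * \<Phi> (2 * (2 ^ k * r)))" for k :: nat
    have ln2: "0 < ln (2::real)" by simp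
    let ?f = "\<lambda>\<tau>. ennreal (1 + ln (\<tau> / r)) * (?e \<tau> / ennreal (\<tau> powr (?Q / q + 1)))"
    have pow: "(0::real) < 2 ^ k * r" for k :: nat using r by simp
    have step: "(\<Sum>k. w k * indicator (J k) \<tau>) \<le> ?f \<tau> * indicator {r<..} \<tau>" for \<tau>
    proof (cases "\<exists>k. \<tau> \<in> J k")
      case True
      then obtain k where k: "\<tau> \<in> J k" by blast
      have uniq: "j = k" if "\<tau> \<in> J j" for j
      proof (rule ccontr)
        assume "j \<noteq> k"
        have lt: "\<tau> \<notin> J b" if "\<tau> \<in> J a" "a < b" for a b
        proof -
          have "(2::real) ^ Suc a \<le> 2 ^ b" using that by (intro power_increasing) auto
          then have "2 * (2 * 2 ^ a) * r \<le> 2 * 2 ^ b * r" using r by (intro mult_right_mono) auto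
          then show ?thesis using that(1) unfolding J_def by (simp add: mult_ac)
        qed
        show False using lt[of j k] lt[of k j] \<open>j \<noteq> k\<close> that k by (metis linorder_neqE_nat)
      qed
      have "(\<Sum>j. w j * indicator (J j) \<tau>) = (\<Sum>j\<in>{k}. w j * indicator (J j) \<tau>)"
        using uniq by (intro suminf_finite) (auto simp: indicator_def)
      also have "\<dots> = w k" using k by simp
      also have "\<dots> \<le> ?f \<tau>"
      proof -
        have \<tau>: "2 * (2 ^ k * r) < \<tau>" "\<tau> \<le> 4 * (2 ^ k * r)" "0 < \<tau>"
          using k pow[of k] by (auto simp: J_def intro: less_trans[of 0 "2 * (2 ^ k * r)"])
        have "(real k + 1) * ln 2 = ln (2 ^ (k + 1))" by (subst ln_realpow) (auto simp: add.commute)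
        also have "\<dots> \<le> ln (\<tau> / r)" using \<tau> r by (intro ln_mono) (auto simp: field_simps)
        finally have l: "(real k + 1) * ln 2 \<le> 1 + ln (\<tau> / r)" by simp
        have d: "\<tau> powr (?Q / q + 1) \<le> (4 * (2 ^ k * r)) powr (?Q / q + 1)"
          using \<tau> q hdim_pos[where 'n='n] by (intro powr_mono2) (auto intro!: add_nonneg_nonneg divide_nonneg_nonneg simp: less_imp_le)
        have "w k \<le> ennreal ((1 + ln (\<tau> / r)) / \<tau> powr (?Q / q + 1)) * ?e \<tau>"
          unfolding w_def
        proof (intro mult_mono ennreal_leI frac_le ess)
          show "0 \<le> 1 + ln (\<tau> / r)" using l ln2 by (meson mult_nonneg_nonneg less_imp_le of_nat_0_le_iff order.trans add_nonneg_nonneg zero_le_one)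
        qed (use l d \<tau> r in auto)
        also have "\<dots> = ?f \<tau>"
          using order.trans[OF mult_nonneg_nonneg l, OF _ less_imp_le[OF ln2]] \<tau> by (intro ennreal_divide_mult) auto
        finally show ?thesis .
      qed
      finally have le: "(\<Sum>j. w j * indicator (J j) \<tau>) \<le> ?f \<tau>" .
      have "r \<le> 2 ^ k * r" using r one_le_power[of "2::real" k] by simp
      moreover have "2 * (2 ^ k * r) < \<tau>" using k unfolding J_def by simp
      ultimately have "r < \<tau>" using pow[of k] by linarith
      then show ?thesis using le by simp
    qed (simp add: indicator_def)
    have "(\<Sum>k. w k * ennreal (2 * (2 ^ k * r))) = (\<Sum>k. \<integral>\<^sup>+\<tau>. w k * indicator (J k) \<tau> \<partial>lebesgue)"
    proof (rule suminf_cong)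
      fix k
      have J: "J k \<in> sets lebesgue" unfolding J_def by (intro sets_completionI_sets) simp
      have "emeasure lebesgue (J k) = ennreal (2 * (2 ^ k * r))"
        unfolding J_def using pow[of k] emeasure_lborel_Ioc[of "2 * (2 ^ k * r)" "4 * (2 ^ k * r)"]
        by (subst emeasure_lebesgue_eq) (simp_all only: greaterThanAtMost_borel, simp add: mult.commute)
      then show "w k * ennreal (2 * (2 ^ k * r)) = (\<integral>\<^sup>+\<tau>. w k * indicator (J k) \<tau> \<partial>lebesgue)"
        using nn_integral_cmult_indicator[OF J, of "w k"] by simp
    qed
    also have "\<dots> = (\<integral>\<^sup>+\<tau>. (\<Sum>k. w k * indicator (J k) \<tau>) \<partial>lebesgue)"
    proof (rule nn_integral_suminf[symmetric])
      have "J k \<in> sets lebesgue" for k unfolding J_def by (intro sets_completionI_sets) simp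
      then show "(\<lambda>\<tau>. w k * indicator (J k) \<tau>) \<in> borel_measurable lebesgue" for k by measurable
    qed
    also have "\<dots> \<le> (\<integral>\<^sup>+\<tau>. ?f \<tau> * indicator {r<..} \<tau> \<partial>lebesgue)"
      by (intro nn_integral_mono step)
    also have "\<dots> \<le> ennreal (C * \<phi>2 g r)"
      using spanne r unfolding spanne_condition_def by blast
    finally have sum_le: "(\<Sum>k. w k * ennreal (2 * (2 ^ k * r))) \<le> ennreal (C * \<phi>2 g r)" .
    \<comment> \<open>It undoes \<open>w k\<close> times the length of \<open>J k\<close>: with
      \<sigma> = 2^k r, (4 \<sigma>)^(Q/q + 1) / (2 \<sigma>) = 2 * 4^(Q/q) \<sigma>^(Q/q), while 1
      / ln 2 and c cancel the other factors.\<close>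
    let ?K = "2 * 4 powr (?Q / q) / ln 2 * c"
    have K: "0 < ?K" using c by simp
    have "local_sum p q (\<lambda>h. ennreal \<bar>f h\<bar>) g r = (\<Sum>k. ennreal ?K * (w k * ennreal (2 * (2 ^ k * r))))"
      unfolding local_sum_def \<Phi>_def[symmetric]
    proof (rule suminf_cong)
      fix k :: nat
      let ?s = "2 ^ k * r"
      have s: "0 < ?s" by (rule pow)
      have "?K * (((real k + 1) * ln 2 / (4 * ?s) powr (?Q / q + 1)) * (1 / c) * (2 * ?s)) = (real k + 1) * ?s powr - (?Q / q)"
      proof -
        have "(4 * ?s) powr (?Q / q + 1) = 4 powr (?Q / q) * ?s powr (?Q / q) * (4 * ?s)"
          using s by (simp add: powr_add powr_mult)
        then show ?thesis using c s ln2 r by (simp add: powr_minus field_simps)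
      qed
      moreover have "ennreal ?K * (w k * ennreal (2 * ?s))
        = ennreal (?K * (((real k + 1) * ln 2 / (4 * ?s) powr (?Q / q + 1)) * (1 / c) * (2 * ?s))) * \<Phi> (2 * ?s)"
      proof -
        have nn: "0 \<le> (real k + 1) * ln 2 / (4 * ?s) powr (?Q / q + 1)" using ln2 by simp
        have "ennreal (?K * (((real k + 1) * ln 2 / (4 * ?s) powr (?Q / q + 1)) * (1 / c) * (2 * ?s)))
          = ennreal ?K * (ennreal ((real k + 1) * ln 2 / (4 * ?s) powr (?Q / q + 1)) * ennreal (1 / c) * ennreal (2 * ?s))"
          using K c s nn by (intro ennreal_mult4) (auto simp: less_imp_le)
        then show ?thesis unfolding w_def by (simp only: mult_ac)
      qed
      ultimately show "ennreal ((real k + 1) * ?s powr - (?Q / q)) * \<Phi> (2 * ?s) = ennreal ?K * (w k * ennreal (2 * ?s))"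
        by (simp only:)
    qed
    also have "\<dots> = ennreal ?K * (\<Sum>k. w k * ennreal (2 * (2 ^ k * r)))" by simp
    also have "\<dots> \<le> ennreal ?K * ennreal (C * \<phi>2 g r)" by (intro mult_left_mono sum_le) simp
    finally show ?thesis unfolding c_def .
  qed
qed

lemma Lp_loc_if_eLp_hball_finite:
  fixes f :: "'n::finite heis \<Rightarrow> real"
  assumes f [measurable]: "f \<in> borel_measurable lebesgue" and q: "0 < q"
    and fin: "\<And>R. 0 < R \<Longrightarrow> eLp q lebesgue (\<lambda>h. ennreal \<bar>f h\<bar> * indicator (hball 0 R) h) < top"
  shows "f \<in> Lp_loc q"
  unfolding Lp_loc_def
proof (intro CollectI conjI allI impI f)
  fix K :: "'n heis set" assume "compact K"
  then obtain R where R: "0 < R" "K \<subseteq> hball 0 R" by (rule compact_subset_hball)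
  have K: "K \<in> sets lebesgue" using \<open>compact K\<close> by (simp add: borel_compact)
  have bound: "(\<integral>\<^sup>+h. epowr (ennreal \<bar>f h\<bar> * indicator (hball 0 R) h) q \<partial>lebesgue) < top"
    using fin[OF R(1)] unfolding eLp_def less_top[symmetric] by simp
  have "(\<integral>\<^sup>+h. ennreal (norm (indicator K h *\<^sub>R \<bar>f h\<bar> powr q)) \<partial>lebesgue)
    \<le> (\<integral>\<^sup>+h. epowr (ennreal \<bar>f h\<bar> * indicator (hball 0 R) h) q \<partial>lebesgue)"
    using R(2) by (intro nn_integral_mono) (auto simp: indicator_def)
  also note bound
  finally have "(\<integral>\<^sup>+h. ennreal (norm (indicator K h *\<^sub>R \<bar>f h\<bar> powr q)) \<partial>lebesgue) < \<infinity>"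
    by simp
  then show "set_integrable lebesgue K (\<lambda>x. \<bar>f x\<bar> powr q)"
    unfolding set_integrable_def integrable_iff_bounded using K by simp
qed

lemma morrey_norm_le:
  fixes f :: "'n::finite heis \<Rightarrow> real"
  assumes f: "f \<in> Lp_loc q" and q: "0 < q" and \<phi>: "\<And>g r. 0 < r \<Longrightarrow> 0 < \<phi> g r" and A: "0 \<le> A"
    and le: "\<And>g r. 0 < r \<Longrightarrow> eLp q lebesgue (\<lambda>h. ennreal \<bar>f h\<bar> * indicator (hball g r) h) \<le> ennreal (A * r powr (hdim TYPE('n) / q) * \<phi> g r)"
  shows "morrey_norm q \<phi> f \<le> ennreal (unit_vol TYPE('n) powr (- 1 / q) * A)"
  unfolding morrey_norm_def
proof (intro SUP_least)
  fix g :: "'n heis" and r :: real assume "r \<in> {0<..}"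
  then have r: "0 < r" by simp
  let ?L = "Lp_norm q (hball g r) f"
  have "?L \<le> A * r powr (hdim TYPE('n) / q) * \<phi> g r"
    using le[OF r, of g] A \<phi>[OF r, of g] unfolding eLp_hball_eq_Lp_norm[OF f q] by (simp add: ennreal_le_iff)
  then have "inverse (\<phi> g r) * vol TYPE('n) r powr (- 1 / q) * ?L
     \<le> inverse (\<phi> g r) * vol TYPE('n) r powr (- 1 / q) * (A * r powr (hdim TYPE('n) / q) * \<phi> g r)"
    using \<phi>[OF r, of g] by (intro mult_left_mono) auto
  also have v: "vol TYPE('n) r powr (- 1 / q) = unit_vol TYPE('n) powr (- 1 / q) * r powr - (hdim TYPE('n) / q)"
    by (simp add: vol_def powr_mult powr_powr)
  also have "inverse (\<phi> g r) * (unit_vol TYPE('n) powr (- 1 / q) * r powr - (hdim TYPE('n) / q)) * (A * r powr (hdim TYPE('n) / q) * \<phi> g r)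
    = unit_vol TYPE('n) powr (- 1 / q) * A"
    using r \<phi>[OF r, of g] by (simp add: powr_minus field_simps)
  finally show "ennreal (inverse (\<phi> g r) * measure lebesgue (hball g r) powr (- 1 / q) * ?L) \<le> ennreal (unit_vol TYPE('n) powr (- 1 / q) * A)"
    unfolding measure_hball_vol[OF r] v by (rule ennreal_leI)
qed

theorem theorem2:
  fixes p q \<alpha> c0 C :: real
  assumes "1 < p"
    and "0 < \<alpha>" and "\<alpha> < hdim TYPE('n::finite) / p"
    and "1 / q = 1 / p - \<alpha> / hdim TYPE('n)"
  shows "\<exists>C'>0. \<forall>(b :: 'n heis \<Rightarrow> real) T \<phi>1 \<phi>2.
    b \<in> BMO \<longrightarrow>
    sublinear_on (Lp_space p) T \<longrightarrow>
    size_condition \<alpha> c0 b T \<longrightarrow>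
    bounded_Lp p q T \<longrightarrow>
    positive_measurable_weight \<phi>1 \<longrightarrow>
    positive_measurable_weight \<phi>2 \<longrightarrow>
    spanne_condition p q C \<phi>1 \<phi>2 \<longrightarrow>
    determined_by_truncations (morrey_space p \<phi>1 - Lp_space p) T \<longrightarrow>
      bounded_morrey p \<phi>1 q \<phi>2 T \<and>
      (\<forall>f\<in>morrey_space p \<phi>1.
         morrey_norm q \<phi>2 (T f) \<le> ennreal C' * bmo_norm b * morrey_norm p \<phi>1 f)"
proof -
  let ?Q = "hdim TYPE('n)"
  have p0: "0 < p" using assms(1) by simp
  have "\<alpha> / ?Q < 1 / p" using assms p0 hdim_pos[where 'n='n] by (simp add: field_simps)
  then have q0: "0 < q" using assms(4) zero_less_divide_1_iff[of q] by simp
  have "1 / q < 1 / p" using assms hdim_pos[where 'n='n] by simp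
  then have pq: "p < q" using p0 q0 by (simp add: field_simps)
  obtain D where D: "0 < D" "\<And>(b :: 'n heis \<Rightarrow> real) N F g r. b \<in> Lp_loc 1 \<Longrightarrow> bmo_norm b \<le> ennreal N \<Longrightarrow> 0 < N \<Longrightarrow> F \<in> borel_measurable lebesgue \<Longrightarrow> 0 < r \<Longrightarrow>
    eLp q lebesgue (\<lambda>x. comm \<alpha> b F x * indicator (hball g r) x) \<le> ennreal (D * N * r powr (?Q / q)) * local_sum p q F g r"
    using comm_local_estimate[OF assms] by blast
  \<comment> \<open>The maxima with 0 are taken because no sign is assumed for \<open>c0\<close> and
    \<open>C\<close>.\<close>
  define E where "E = D * max c0 0 * (2 * 4 powr (?Q / q) / ln 2 * unit_vol TYPE('n) powr (1 / p)) * max C 0"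
  have E: "0 \<le> E" using D by (simp add: E_def)
  \<comment> \<open>The summand 1 keeps the constant positive when \<open>E = 0\<close>.\<close>
  define C' where "C' = unit_vol TYPE('n) powr (- 1 / q) * E + 1"
  have C': "0 < C'" using E by (simp add: C'_def add_nonneg_pos)
  have main: "T f \<in> morrey_space q \<phi>2 \<and> morrey_norm q \<phi>2 (T f) \<le> ennreal C' * bmo_norm b * morrey_norm p \<phi>1 f"
    if bmo: "b \<in> BMO" and sub: "sublinear_on (Lp_space p) T" and size: "size_condition \<alpha> c0 b T"
      and bdd: "bounded_Lp p q T" and w1: "positive_measurable_weight \<phi>1" and w2: "positive_measurable_weight \<phi>2"
      and spanne: "spanne_condition p q C \<phi>1 \<phi>2" and det: "determined_by_truncations (morrey_space p \<phi>1 - Lp_space p) T"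
      and f: "f \<in> morrey_space p \<phi>1"
    for b :: "'n heis \<Rightarrow> real" and T \<phi>1 \<phi>2 f
  proof -
    have b: "b \<in> Lp_loc 1" and bfin: "bmo_norm b < top" using bmo by (auto simp: BMO_def)
    have bm: "b \<in> borel_measurable lebesgue" using b by (rule Lp_loc_measurable)
    have fl: "f \<in> Lp_loc p" and ffin: "morrey_norm p \<phi>1 f < top" using f by (auto simp: morrey_space_def)
    have fm [measurable]: "f \<in> borel_measurable lebesgue" using fl by (rule Lp_loc_measurable)
    obtain \<beta> where \<beta>: "bmo_norm b = ennreal \<beta>" "0 \<le> \<beta>" using bfin unfolding less_top_ennreal by blast
    obtain M where M: "morrey_norm p \<phi>1 f = ennreal M" "0 \<le> M" using ffin unfolding less_top_ennreal by blast
    have \<phi>1: "0 < \<phi>1 g r" if "0 < r" for g r using w1 that unfolding positive_measurable_weight_def by blast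
    have \<phi>2: "0 < \<phi>2 g r" if "0 < r" for g r using w2 that unfolding positive_measurable_weight_def by blast
    note dom = domination_Lp[OF less_imp_le[OF assms(1)] pq bm sub size bdd]
      domination_truncations[OF less_imp_le[OF assms(1)] pq bm sub size bdd fl]
    have Tf: "T f \<in> borel_measurable lebesgue \<and> (AE g in lebesgue. ennreal \<bar>T f g\<bar> \<le> ennreal c0 * comm \<alpha> b (\<lambda>h. ennreal \<bar>f h\<bar>) g)"
    \<comment> \<open>For \<open>f\<close> in L_p, measurability of \<open>T f\<close> and the
      domination follow from boundedness and the size condition; for all other \<open>f\<close> they
      come from the truncations.\<close>
    proof (cases "f \<in> Lp_space p")
      case True
      then have "T f \<in> Lp_space q" using bdd unfolding bounded_between_def by blast
      then show ?thesis using dom(1)[OF True] by (auto simp: Lp_space_def)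
    next
      case False
      then show ?thesis using det f dom(2) unfolding determined_by_truncations_def by blast
    qed
    then have [measurable]: "T f \<in> borel_measurable lebesgue" by simp
    have est: "eLp q lebesgue (\<lambda>h. ennreal \<bar>T f h\<bar> * indicator (hball g r) h) \<le> ennreal (E * N * M * r powr (?Q / q) * \<phi>2 g r)"
      if N: "bmo_norm b \<le> ennreal N" "0 < N" and r: "0 < r" for N g r
    proof -
      let ?G = "\<lambda>x. comm \<alpha> b (\<lambda>h. ennreal \<bar>f h\<bar>) x * indicator (hball g r) x"
      have [measurable]: "?G \<in> borel_measurable lebesgue"
        using bm hball_lebesgue[of g r] by measurable
      have "eLp q lebesgue (\<lambda>h. ennreal \<bar>T f h\<bar> * indicator (hball g r) h) \<le> eLp q lebesgue (\<lambda>x. ennreal (max c0 0) * ?G x)"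
      proof (rule eLp_mono_AE[OF q0])
        from Tf have "AE g in lebesgue. ennreal \<bar>T f g\<bar> \<le> ennreal c0 * comm \<alpha> b (\<lambda>h. ennreal \<bar>f h\<bar>) g" by simp
        then show "AE x in lebesgue. ennreal \<bar>T f x\<bar> * indicator (hball g r) x \<le> ennreal (max c0 0) * ?G x"
        proof eventually_elim
          case (elim x)
          also have "ennreal c0 * comm \<alpha> b (\<lambda>h. ennreal \<bar>f h\<bar>) x \<le> ennreal (max c0 0) * comm \<alpha> b (\<lambda>h. ennreal \<bar>f h\<bar>) x"
            by (intro mult_right_mono ennreal_leI) auto
          finally show ?case by (simp add: mult.assoc[symmetric] mult_right_mono)
        qed
      qed
      also have "\<dots> = ennreal (max c0 0) * eLp q lebesgue ?G"
        by (intro eLp_cmult q0) measurable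
      also have "\<dots> \<le> ennreal (max c0 0) * (ennreal (D * N * r powr (?Q / q)) * local_sum p q (\<lambda>h. ennreal \<bar>f h\<bar>) g r)"
        by (intro mult_left_mono D b N r) auto
      also have "\<dots> \<le> ennreal (max c0 0) * (ennreal (D * N * r powr (?Q / q)) *
          (ennreal (2 * 4 powr (?Q / q) / ln 2 * (unit_vol TYPE('n) powr (1 / p) * M)) * ennreal (C * \<phi>2 g r)))"
        by (intro mult_left_mono local_sum_le[OF p0 q0 spanne \<phi>1 fl M r]) auto
      also have "\<dots> \<le> ennreal (max c0 0) * (ennreal (D * N * r powr (?Q / q)) *
          (ennreal (2 * 4 powr (?Q / q) / ln 2 * (unit_vol TYPE('n) powr (1 / p) * M)) * ennreal (max C 0 * \<phi>2 g r)))"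
        using \<phi>2[OF r, of g] by (intro mult_left_mono ennreal_leI mult_right_mono) auto
      also have "\<dots> = ennreal (max c0 0 * ((D * N * r powr (?Q / q)) *
          ((2 * 4 powr (?Q / q) / ln 2 * (unit_vol TYPE('n) powr (1 / p) * M)) * (max C 0 * \<phi>2 g r))))"
      proof -
        have nn: "0 \<le> max c0 0" "0 \<le> D * N * r powr (?Q / q)" "0 \<le> 2 * 4 powr (?Q / q) / ln 2 * (unit_vol TYPE('n) powr (1 / p) * M)"
          "0 \<le> max C 0 * \<phi>2 g r"
          using D N M \<phi>2[OF r, of g] by auto
        show ?thesis by (simp only: ennreal_mult nn mult_nonneg_nonneg)
      qed
      also have "max c0 0 * ((D * N * r powr (?Q / q)) *
          ((2 * 4 powr (?Q / q) / ln 2 * (unit_vol TYPE('n) powr (1 / p) * M)) * (max C 0 * \<phi>2 g r))) = E * N * M * r powr (?Q / q) * \<phi>2 g r"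
        unfolding E_def by (simp only: mult_ac times_divide_eq_left times_divide_eq_right)
      finally show ?thesis .
    qed
    have Tl: "T f \<in> Lp_loc q"
    proof (rule Lp_loc_if_eLp_hball_finite[OF _ q0])
      fix R :: real assume "0 < R"
      have "bmo_norm b \<le> ennreal (\<beta> + 1)" "0 < \<beta> + 1" using \<beta> by (auto intro: ennreal_leI)
      from est[OF this \<open>0 < R\<close>, of 0]
      show "eLp q lebesgue (\<lambda>h. ennreal \<bar>T f h\<bar> * indicator (hball 0 R) h) < top"
        by (rule le_less_trans) simp
    qed measurable
    have le: "morrey_norm q \<phi>2 (T f) \<le> ennreal (unit_vol TYPE('n) powr (- 1 / q) * (E * N * M))"
      if N: "bmo_norm b \<le> ennreal N" "0 < N" for N
      by (rule morrey_norm_le[OF Tl q0 \<phi>2 _ est[OF N]]) (use E N M in auto)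
    have final: "morrey_norm q \<phi>2 (T f) \<le> ennreal (C' * \<beta> * M)"
    proof (rule ennreal_le_epsilon)
      fix e :: real assume e: "0 < e"
      \<comment> \<open>Slightly above the BMO norm \<beta>, which may be 0. The increment is scaled
        so that it contributes at most e to the bound; the denominator stays positive for M =
        0.\<close>
      define N where "N = \<beta> + e / (C' * M + 1)"
      have CM: "0 < C' * M + 1" using C' M by (simp add: add_nonneg_pos)
      then have N: "\<beta> < N" "0 < N" using e \<beta> by (auto simp: N_def intro: add_nonneg_pos)
      have "morrey_norm q \<phi>2 (T f) \<le> ennreal (unit_vol TYPE('n) powr (- 1 / q) * (E * N * M))"
        using N \<beta> by (intro le) (auto intro: ennreal_leI)
      also have "\<dots> \<le> ennreal (C' * \<beta> * M + e)"
      proof (intro ennreal_leI)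
        have "unit_vol TYPE('n) powr (- 1 / q) * (E * N * M) \<le> C' * (N * M)"
          unfolding C'_def using N M by (simp add: algebra_simps)
        also have "C' * (N * M) = C' * \<beta> * M + e * (C' * M / (C' * M + 1))"
          by (simp add: N_def algebra_simps)
        also have "\<dots> \<le> C' * \<beta> * M + e"
          using e CM mult_left_mono[of "C' * M / (C' * M + 1)" 1 e] by simp
        finally show "unit_vol TYPE('n) powr (- 1 / q) * (E * N * M) \<le> C' * \<beta> * M + e" .
      qed
      also have "\<dots> = ennreal (C' * \<beta> * M) + ennreal e"
        using C' \<beta> M e by (intro ennreal_plus) auto
      finally show "morrey_norm q \<phi>2 (T f) \<le> ennreal (C' * \<beta> * M) + ennreal e" .
    qed
    moreover have "ennreal (C' * \<beta> * M) = ennreal C' * bmo_norm b * morrey_norm p \<phi>1 f"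
      unfolding \<beta> M using C' \<beta> M by (simp add: ennreal_mult)
    moreover have "morrey_norm q \<phi>2 (T f) < top" using final by (rule le_less_trans) simp
    ultimately show ?thesis using Tl by (simp add: morrey_space_def)
  qed
  show ?thesis
  proof (intro exI[of _ C'] conjI allI impI C' ballI)
    fix b :: "'n heis \<Rightarrow> real" and T :: "('n heis \<Rightarrow> real) \<Rightarrow> 'n heis \<Rightarrow> real" and \<phi>1 \<phi>2 :: "'n heis \<Rightarrow> real \<Rightarrow> real"
    assume h: "b \<in> BMO" "sublinear_on (Lp_space p) T" "size_condition \<alpha> c0 b T" "bounded_Lp p q T"
      "positive_measurable_weight \<phi>1" "positive_measurable_weight \<phi>2" "spanne_condition p q C \<phi>1 \<phi>2"
      "determined_by_truncations (morrey_space p \<phi>1 - Lp_space p) T"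
    note m = main[OF h]
    obtain \<beta> where \<beta>: "bmo_norm b = ennreal \<beta>" "0 \<le> \<beta>"
      using h(1) unfolding BMO_def infinity_ennreal_def less_top_ennreal by blast
    have "ennreal C' * bmo_norm b = ennreal (C' * \<beta>)"
      unfolding \<beta> using C' \<beta> by (simp add: ennreal_mult)
    then show "bounded_morrey p \<phi>1 q \<phi>2 T"
      unfolding bounded_between_def using m by (intro exI[of _ "C' * \<beta>"]) auto
    show "morrey_norm q \<phi>2 (T f) \<le> ennreal C' * bmo_norm b * morrey_norm p \<phi>1 f" if "f \<in> morrey_space p \<phi>1" for f
      using m[OF that] by blast
  qed
qed

end
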